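(* Let $C$ be the $\textup{A}_n$ Cartan matrix. Then \begin{equation*} \sum_{m=0}^{\infty}\frac{q^m}{(q)_m}\, Q'_{(2^m)}(1^n) =\sum_{\boldsymbol{r}\in\mathbb N^n} \frac{q^{\frac{1}{2}\boldsymbol{r} C\boldsymbol{r}^t}}{(q)_{\boldsymbol{r}}} \end{equation*} and \begin{equation*} \sum_{m=0}^{\infty}\frac{q^{2m}}{(q)_m}\, Q'_{(2^m)}(\underbrace{1,q^{-1},1,q^{-1},\dots}_{n \text{ terms}}) =\sum_{\boldsymbol{r}\in\mathbb N^n} \frac{q^{\frac{1}{2}\boldsymbol{r} C\boldsymbol{r}^t+|\boldsymbol{r}|_{-}}}{(q)_{\boldsymbol{r}}}. \end{equation*}
   Context: For $\boldsymbol{x}=(x_1,\dots,x_n)$ and a partition $\mu$ of length at most $n$, $Q'_{\mu}(\boldsymbol{x})=Q'_{\mu}(\boldsymbol{x};q)=\sum_{\lambda}K_{\lambda\mu}(q)s_{\lambda}(\boldsymbol{x})$ is the modified Hall–Littlewood polynomial, with $K_{\lambda\mu}(q)$ the Kostka–Foulkes polynomials and $s_\lambda$ the Schur functions; $(2^m)$ is the partition with $m$ parts equal to $2$, and $1^n$ denotes $n$ variables equal to $1$. $(a)_m=\prod_{i=1}^m(1-aq^{i-1})$, $(q)_{\boldsymbol{r}}=(q)_{r_1}\cdots(q)_{r_n}$, $\mathbb N=\{0,1,2,\dots\}$, $\frac12\boldsymbol{r}C\boldsymbol{r}^t=\sum_{i=1}^n r_i^2-\sum_{i=1}^{n-1}r_ir_{i+1}$,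 and $|\boldsymbol{r}|_{-}=\sum_{i=1}^{n}(-1)^{i-1}r_i$. *)

theory Defs
  imports "HOL-Analysis.Analysis" "HOL-Computational_Algebra.Computational_Algebra"
begin

text \<open>
  All indices are 0-based: variables are \<open>x 0, \<dots>, x (n - 1)\<close>, cells of a Young diagram are pairs
  (row, column) starting at \<open>(0, 0)\<close>, and tableau entries lie in \<open>{..<n}\<close>.
\<close>

definition partitions_of :: "nat \<Rightarrow> nat list set" where
  "partitions_of k = {\<mu>. sorted_wrt (\<ge>) \<mu> \<and> 0 \<notin> set \<mu> \<and> sum_list \<mu> = k}"

definition diagram :: "nat list \<Rightarrow> (nat \<times> nat) set" where
  "diagram \<mu> = {(i, j). i < length \<mu> \<and> j < \<mu> ! i}"

definition ssyt :: "nat \<Rightarrow> nat list \<Rightarrow> (nat \<times> nat \<Rightarrow> nat) set" where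
  "ssyt n \<mu> = {T \<in> diagram \<mu> \<rightarrow>\<^sub>E {..<n}.
     (\<forall>i j. (i, Suc j) \<in> diagram \<mu> \<longrightarrow> T (i, j) \<le> T (i, Suc j)) \<and>
     (\<forall>i j. (Suc i, j) \<in> diagram \<mu> \<longrightarrow> T (i, j) < T (Suc i, j))}"

definition schur :: "nat \<Rightarrow> (nat \<Rightarrow> complex) \<Rightarrow> nat list \<Rightarrow> complex" where
  "schur n x \<mu> = (\<Sum>T\<in>ssyt n \<mu>. \<Prod>c\<in>diagram \<mu>. x (T c))"

text \<open>
  The Hall--Littlewood polynomial \<open>P\<^sub>\<mu>(x\<^sub>1,\<dots>,x\<^sub>n;t)\<close> is the sum over \<open>w \<in> S\<^sub>n / S\<^sub>n\<^sup>\<mu>\<close> of \<open>w\<close> applied to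
  \<open>x\<^sup>\<mu> \<Prod> (x\<^sub>i - t x\<^sub>j) / (x\<^sub>i - x\<^sub>j)\<close>, the product being over all \<open>i, j\<close> with \<open>\<mu>\<^sub>i > \<mu>\<^sub>j\<close>. The cosets
  correspond to the distinct rearrangements \<open>\<alpha>\<close> of \<open>(\<mu>\<^sub>1,\<dots>,\<mu>\<^sub>n)\<close>, where \<open>\<mu>\<close> is padded with zeros;
  it is \<open>0\<close> if \<open>\<mu>\<close> has more than \<open>n\<close> parts. As a quotient of complex numbers the formula is only
  meaningful for pairwise distinct \<open>x\<^sub>i\<close>, which suffices to determine a polynomial.
\<close>

definition rearrangements :: "nat \<Rightarrow> nat list \<Rightarrow> nat list set" where
  "rearrangements n \<mu> = {\<alpha>. mset \<alpha> = mset (\<mu> @ replicate (n - length \<mu>) 0)}"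

definition hall_littlewood_P :: "nat \<Rightarrow> (nat \<Rightarrow> complex) \<Rightarrow> complex \<Rightarrow> nat list \<Rightarrow> complex" where
  "hall_littlewood_P n x t \<mu> =
     (if length \<mu> \<le> n then
        \<Sum>\<alpha>\<in>rearrangements n \<mu>.
          (\<Prod>i<n. x i ^ (\<alpha> ! i)) *
          (\<Prod>(i, j)\<in>{(i, j). i < n \<and> j < n \<and> \<alpha> ! i > \<alpha> ! j}. (x i - t * x j) / (x i - x j))
      else 0)"

text \<open>
  The Kostka--Foulkes polynomials \<open>K\<^sub>\<lambda>\<^sub>\<mu>\<close> are the coefficients in
  \<open>s\<^sub>\<lambda>(x) = \<Sum>\<^sub>\<mu> K\<^sub>\<lambda>\<^sub>\<mu>(t) P\<^sub>\<mu>(x;t)\<close>, an identity of symmetric functions, hence required in every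
  number \<open>n\<close> of variables. They are unique because the \<open>P\<^sub>\<mu>\<close> with \<open>\<mu>\<close> a partition of \<open>k\<close> are linearly
  independent as soon as \<open>n \<ge> k\<close>.
\<close>

definition kostka_foulkes :: "nat list \<Rightarrow> nat list \<Rightarrow> int poly" where
  "kostka_foulkes \<nu> = (THE K.
     (\<forall>\<mu>. \<mu> \<notin> partitions_of (sum_list \<nu>) \<longrightarrow> K \<mu> = 0) \<and>
     (\<forall>n x t. inj_on x {..<n} \<longrightarrow>
        schur n x \<nu> = (\<Sum>\<mu>\<in>partitions_of (sum_list \<nu>).
          poly (map_poly of_int (K \<mu>)) t * hall_littlewood_P n x t \<mu>)))"

text \<open>
  The sum over \<open>\<nu>\<close> may be restricted to partitions of the same size as \<open>\<mu>\<close>, since the other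
  Kostka--Foulkes polynomials vanish. There is no bound on the length of \<open>\<mu>\<close> in terms of \<open>n\<close>.
\<close>

definition modified_hall_littlewood :: "nat \<Rightarrow> (nat \<Rightarrow> complex) \<Rightarrow> complex \<Rightarrow> nat list \<Rightarrow> complex" where
  "modified_hall_littlewood n x q \<mu> =
     (\<Sum>\<nu>\<in>partitions_of (sum_list \<mu>). poly (map_poly of_int (kostka_foulkes \<nu> \<mu>)) q * schur n x \<nu>)"

definition qpoch :: "complex \<Rightarrow> complex \<Rightarrow> nat \<Rightarrow> complex" where
  "qpoch a q m = (\<Prod>i<m. 1 - a * q ^ i)"

definition cartan_A :: "nat \<Rightarrow> nat \<Rightarrow> int" where
  "cartan_A i j = (if i = j then 2 else if i = Suc j \<or> j = Suc i then -1 else 0)"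

text \<open>The division by two is exact, as the lemma below shows.\<close>

definition half_cartan_form :: "nat \<Rightarrow> (nat \<Rightarrow> nat) \<Rightarrow> int" where
  "half_cartan_form n r = (\<Sum>i<n. \<Sum>j<n. int (r i) * cartan_A i j * int (r j)) div 2"

lemma cartan_form_eq:
  "(\<Sum>i<n. \<Sum>j<n. int (r i) * cartan_A i j * int (r j)) =
     2 * ((\<Sum>i<n. int (r i) ^ 2) - (\<Sum>i<n - 1. int (r i) * int (r (Suc i))))"
proof (induction n)
  case (Suc n)
  have border: "(\<Sum>i<n. int (r i) * cartan_A i n * int (r n)) =
      - (if n = 0 then 0 else int (r (n - 1)) * int (r n))"
       "(\<Sum>i<n. int (r n) * cartan_A n i * int (r i)) =
      - (if n = 0 then 0 else int (r (n - 1)) * int (r n))"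
    by (cases n; simp add: cartan_A_def)+
  have step: "(\<Sum>i<n. int (r i) * int (r (Suc i))) =
      (\<Sum>i<n - 1. int (r i) * int (r (Suc i))) +
      (if n = 0 then 0 else int (r (n - 1)) * int (r n))"
    by (cases n) auto
  have "cartan_A n n = 2"
    by (simp add: cartan_A_def)
  then show ?case
    using Suc.IH border step by (simp add: sum.distrib power2_eq_square algebra_simps)
qed simp

lemma half_cartan_form_eq:
  "half_cartan_form n r = (\<Sum>i<n. int (r i) ^ 2) - (\<Sum>i<n - 1. int (r i) * int (r (Suc i)))"
  unfolding half_cartan_form_def cartan_form_eq by simp

definition alternating_sum :: "nat \<Rightarrow> (nat \<Rightarrow> nat) \<Rightarrow> int" where
  "alternating_sum n r = (\<Sum>i<n. (-1) ^ i * int (r i))"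

end

theory Submission
  imports Defs
begin

text \<open>
  Write \<open>Q'(r, b)\<close> for \<open>Q'\<^sub>\<mu>\<close> with \<open>\<mu> = (2\<^sup>r 1\<^sup>b)\<close>. By the branching rule and the Pieri rule for Schur
  functions, adding a variable to \<open>Q'\<close> is dual to multiplying by the generating function of the complete
  symmetric functions \<open>h\<^sub>k\<close> in the basis of Hall--Littlewood polynomials \<open>P\<^sub>\<mu>\<close>. Multiplication by the
  elementary symmetric functions \<open>e\<^sub>k\<close> in this basis can be read off from the definition of \<open>P\<^sub>\<mu>\<close>, and on
  partitions with at most two columns q-binomial inversion turns it into a formula for \<open>h\<^sub>k\<close>. This gives a
  recursion for \<open>Q'(r, b)\<close> in the number of variables.

  Consider the functionals \<open>\<Phi>\<^sub>s = \<Sum> z ^ r y ^ b q ^ (b (b + 1) / 2 - s b) [s choose b]\<^sub>q Q'(r, b) / (q)\<^sub>r\<close>, summed over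
  \<open>r\<close> and \<open>b\<close>. By the recursion, removing a variable \<open>x\<close> with \<open>z x = q y\<close> replaces \<open>\<Phi>\<^sub>s\<close> by
  \<open>\<Sum>\<^sub>n q ^ (n n - s n) (x y) ^ n / (q)\<^sub>n \<Phi>\<^sub>n\<close>, now with \<open>y = 1 / x\<close>. Starting from \<open>\<Phi>\<^sub>0\<close>, which only involves
  \<open>b = 0\<close>, and removing all variables produces the multisum, provided that neighbouring variables have
  product \<open>q / z\<close>. The two identities are the cases \<open>z = q\<close> and \<open>z = q\<^sup>2\<close>; \<open>q = 0\<close> is treated apart because
  of the negative exponents.
\<close>

section \<open>Gaussian binomial coefficients\<close>

text \<open>Uniqueness comes from a degenerate evaluation. Existence rests on the same rule for
  multiplying by elementary symmetric functions: it shows that multiplication by \<open>h_k\<close>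
  preserves expansions with integral polynomial coefficients, and a Schur function is
  \<open>h_k\<close> times a smaller one, minus Schur functions higher in dominance order. The
  factor \<open>e_k\<close> is accessible because, for any exponent vector, the t-weights of the
  ties of that vector can be inserted into \<open>e_k\<close> without changing its value; after
  that, multiplication just moves factors between pairs of indices. The weight in the functionals
  does two jobs. The sum over \<open>b\<close> that arises when a variable is removed becomes the
  count of matrices by rank, which has a closed form; and since
  \<open>tri (n - b) = tri n + tri (b + 1) - n b\<close>, the sum left over is such a functional
  again.\<close>

fun qbinom :: "'a::comm_semiring_1 \<Rightarrow> nat \<Rightarrow> nat \<Rightarrow> 'a" where
  "qbinom q n 0 = 1"
| "qbinom q 0 (Suc k) = 0"
| "qbinom q (Suc n) (Suc k) = qbinom q n k + q ^ Suc k * qbinom q n (Suc k)"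

lemma qbinom_eq_0: "n < k \<Longrightarrow> qbinom q n k = 0"
  by (induction q n k rule: qbinom.induct) auto

lemma qbinom_self [simp]: "qbinom q n n = 1"
  by (induction n) (auto simp: qbinom_eq_0)

definition tri :: "nat \<Rightarrow> nat" where "tri n = n * (n - 1) div 2"

lemma tri_0 [simp]: "tri 0 = 0" by (simp add: tri_def)

lemma tri_Suc [simp]: "tri (Suc n) = tri n + n"
proof -
  have "Suc n * n = n * (n - 1) + 2 * n" by (cases n) auto
  then show ?thesis by (simp add: tri_def)
qed

lemma two_tri: "2 * tri n + n = n * n"
  by (induction n) auto

lemma int_tri: "2 * int (tri n) = int n * int n - int n"
  by (induction n) (simp_all add: algebra_simps)

lemma qpoch_0 [simp]: "qpoch a q 0 = 1"
  by (simp add: qpoch_def)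

lemma qpoch_Suc: "qpoch a q (Suc n) = qpoch a q n * (1 - a * q ^ n)"
  by (simp add: qpoch_def)

lemma one_minus_power_nonzero:
  fixes q :: complex assumes "norm q < 1" shows "1 - q ^ Suc n \<noteq> 0"
proof
  assume "1 - q ^ Suc n = 0"
  then have "norm (q ^ Suc n) = 1" by simp
  moreover have "norm (q ^ Suc n) < 1"
    unfolding norm_power using assms by (intro power_less_one_iff[THEN iffD2]) auto
  ultimately show False by simp
qed

lemma qpoch_nonzero: "norm (q::complex) < 1 \<Longrightarrow> qpoch q q n \<noteq> 0"
  using one_minus_power_nonzero[of q] by (simp add: qpoch_def)

text \<open>The two terms of the Pascal recursion contribute \<open>1 - q ^ k\<close> and
  \<open>q ^ k * (1 - q ^ m)\<close>, which add up to \<open>1 - q ^ (m + k)\<close>.\<close>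

lemma qbinom_qpoch:
  fixes q :: complex
  assumes "norm q < 1"
  shows "qbinom q (m + k) k * (qpoch q q k * qpoch q q m) = qpoch q q (m + k)"
proof (induction "m + k" arbitrary: m k)
  case 0 then show ?case by simp
next
  case (Suc n)
  show ?case
  proof (cases k)
    case 0 then show ?thesis by simp
  next
    case k: (Suc k')
    show ?thesis
    proof (cases m)
      case 0 then show ?thesis by simp
    next
      case m: (Suc m')
      have 1: "qbinom q (m + k') k' * (qpoch q q k' * qpoch q q m) = qpoch q q (m + k')"
        using Suc k by simp
      have 2: "qbinom q (m' + k) k * (qpoch q q k * qpoch q q m') = qpoch q q (m' + k)"
        using Suc m by simp
      have e: "m + k = Suc (m + k')" "m + k' = m' + k" using k m by auto
      have "qbinom q (m + k) k * (qpoch q q k * qpoch q q m)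
         = (qbinom q (m + k') k' * (qpoch q q k' * qpoch q q m)) * (1 - q ^ k)
         + q ^ k * (qbinom q (m' + k) k * (qpoch q q k * qpoch q q m')) * (1 - q ^ m)"
        by (simp add: e(1) k m qpoch_Suc algebra_simps)
      also have "\<dots> = qpoch q q (m + k') * (1 - q ^ (m + k))"
        unfolding 1 2 by (simp only: e(2)[symmetric]) (simp add: algebra_simps power_add)
      also have "\<dots> = qpoch q q (m + k)" by (simp add: e(1) qpoch_Suc)
      finally show ?thesis .
    qed
  qed
qed

lemma qbinom_eq_divide:
  fixes q :: complex
  assumes "norm q < 1" "k \<le> n"
  shows "qbinom q n k = qpoch q q n / (qpoch q q k * qpoch q q (n - k))"
  using qbinom_qpoch[OF assms(1), of "n - k" k] assms(2) qpoch_nonzero[OF assms(1)]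
  by (simp add: field_simps)

lemma qbinom_symmetric:
  fixes q :: complex
  assumes "norm q < 1" "k \<le> n"
  shows "qbinom q n (n - k) = qbinom q n k"
  using assms by (simp add: qbinom_eq_divide mult.commute)

text \<open>Pascal's rule turns the sum for \<open>n + 1\<close> into the sum for \<open>n\<close>
  at \<open>z * q\<close>, minus \<open>z\<close> times that same sum. This yields the factor
  \<open>1 - z\<close> and is why \<open>z\<close> varies in the induction.\<close>

lemma qbinomial_theorem:
  fixes q z :: "'a::comm_ring_1"
  shows "(\<Sum>k\<le>n. (- 1) ^ k * qbinom q n k * q ^ tri k * z ^ k) = (\<Prod>i<n. 1 - z * q ^ i)"
proof (induction n arbitrary: z)
  case 0 then show ?case by simp
next
  case (Suc n)
  have "(\<Sum>k\<le>Suc n. (- 1) ^ k * qbinom q (Suc n) k * q ^ tri k * z ^ k) =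
     1 + (\<Sum>k\<le>n. (- 1) ^ Suc k * (qbinom q n k + q ^ Suc k * qbinom q n (Suc k)) * q ^ (tri k + k) * z ^ Suc k)"
    by (subst sum.atMost_Suc_shift) (simp del: sum.atMost_Suc)
  also have "\<dots> = (1 + (\<Sum>k\<le>n. (- 1) ^ Suc k * qbinom q n (Suc k) * q ^ tri (Suc k) * (z * q) ^ Suc k))
      - z * (\<Sum>k\<le>n. (- 1) ^ k * qbinom q n k * q ^ tri k * (z * q) ^ k)"
    by (simp add: sum_distrib_left sum_subtractf[symmetric] sum_negf[symmetric] sum.distrib[symmetric]
        power_add power_mult_distrib algebra_simps)
  also have "1 + (\<Sum>k\<le>n. (- 1) ^ Suc k * qbinom q n (Suc k) * q ^ tri (Suc k) * (z * q) ^ Suc k)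
      = (\<Sum>k\<le>Suc n. (- 1) ^ k * qbinom q n k * q ^ tri k * (z * q) ^ k)"
    by (subst sum.atMost_Suc_shift) (simp del: sum.atMost_Suc)
  also have "\<dots> = (\<Sum>k\<le>n. (- 1) ^ k * qbinom q n k * q ^ tri k * (z * q) ^ k)"
    by (simp add: qbinom_eq_0)
  finally have "(\<Sum>k\<le>Suc n. (- 1) ^ k * qbinom q (Suc n) k * q ^ tri k * z ^ k) =
      (1 - z) * (\<Prod>i<n. 1 - z * q * q ^ i)"
    unfolding Suc.IH by (simp add: left_diff_distrib)
  then show ?case
    by (simp only: prod.lessThan_Suc_shift) (simp add: mult.assoc)
qed

text \<open>Because \<open>[r, v] [r - v, k] = [r, k] [r - k, v]\<close>, the sum reduces to the
  q-binomial theorem at \<open>z = 1\<close>, whose product has the factor \<open>1 - 1\<close>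
  unless \<open>k = r\<close>. This is the inversion that leads from elementary to complete
  symmetric functions.\<close>

lemma qbinom_inversion:
  fixes q :: complex
  assumes "norm q < 1"
  shows "(\<Sum>v\<le>r. (- 1) ^ v * qbinom q r v * (qbinom q (r - v) k * q ^ tri (r - v - k))) =
     (if k = r then 1 else 0)"
proof (cases "k \<le> r")
  case False
  then show ?thesis by (auto intro!: sum.neutral simp: qbinom_eq_0)
next
  case True
  have "(\<Sum>v\<le>r. (- 1) ^ v * qbinom q r v * (qbinom q (r - v) k * q ^ tri (r - v - k))) =
     (\<Sum>v\<le>r - k. (- 1) ^ v * qbinom q r v * (qbinom q (r - v) k * q ^ tri (r - v - k)))"
    using True by (intro sum.mono_neutral_right) (auto intro!: qbinom_eq_0 simp: not_le)
  \<comment> \<open>The triangular exponent belongs to \<open>r - k - v\<close> and not to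
    \<open>v\<close>, so the terms are written in the reversed index, at the price of the global
    sign \<open>(- 1) ^ (r - k)\<close>.\<close>
  also have "\<dots> = (\<Sum>v\<le>r - k. (- 1) ^ (r - k) * qbinom q r k * ((- 1) ^ (r - k - v) * qbinom q (r - k) (r - k - v) * q ^ tri (r - k - v) * 1 ^ (r - k - v)))"
  proof (rule sum.cong)
    fix v assume "v \<in> {..r - k}"
    then obtain w where r: "r = v + k + w"
      using True by (metis atMost_iff le_diff_conv2 le_Suc_ex)
    have d: "r - v = k + w" "r - v - k = w" "r - k = v + w" "r - k - v = w" using r by auto
    have 1: "qbinom q r v * qbinom q (k + w) k = qbinom q r k * qbinom q (v + w) w"
      using qpoch_nonzero[OF assms] d by (simp add: qbinom_eq_divide[OF assms] r)
    have 2: "(- 1 :: complex) ^ (v + w) * (- 1) ^ w = (- 1) ^ v"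
      by (simp add: power_add flip: power_mult_distrib)
    have "(- 1) ^ v * qbinom q r v * (qbinom q (r - v) k * q ^ tri (r - v - k))
        = (- 1) ^ v * (qbinom q r v * qbinom q (k + w) k) * q ^ tri w"
      unfolding d by (simp add: mult.assoc)
    also have "\<dots> = (- 1) ^ (v + w) * (- 1) ^ w * (qbinom q r k * qbinom q (v + w) w) * q ^ tri w"
      unfolding 1 2 ..
    finally show "(- 1) ^ v * qbinom q r v * (qbinom q (r - v) k * q ^ tri (r - v - k)) =
      (- 1) ^ (r - k) * qbinom q r k * ((- 1) ^ (r - k - v) * qbinom q (r - k) (r - k - v) * q ^ tri (r - k - v) * 1 ^ (r - k - v))"
      unfolding d by (simp add: mult_ac)
  qed simp
  also have "\<dots> = (- 1) ^ (r - k) * qbinom q r k * (\<Sum>v\<le>r - k. (- 1) ^ v * qbinom q (r - k) v * q ^ tri v * 1 ^ v)"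
    unfolding sum_distrib_left
    by (rule sum.reindex_bij_witness[of _ "\<lambda>v. r - k - v" "\<lambda>v. r - k - v"]) auto
  also have "\<dots> = (if k = r then 1 else 0)"
    unfolding qbinomial_theorem using True by (auto intro!: bexI[of _ 0])
  finally show ?thesis .
qed

text \<open>Counts the \<open>s \<times> n\<close> matrices over the field with \<open>1 / q\<close> elements by rank.\<close>

lemma qbinom_rank_sum:
  fixes q :: complex
  assumes "norm q < 1" "q \<noteq> 0"
  shows "(\<Sum>b\<le>min s n. qbinom q s b * q powi (int b * int b - int (n + s) * int b) / qpoch q q (n - b))
    = q powi (- int s * int n) / qpoch q q n"
proof (induction s arbitrary: n)
  case 0 then show ?case by simp
next
  case (Suc s)
  define F where "F s n b = qbinom q s b * q powi (int b * int b - int (n + s) * int b) / qpoch q q (n - b)" for s n b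
  have IH: "(\<Sum>b\<le>min s n. F s n b) = q powi (- int s * int n) / qpoch q q n" for n
    using Suc by (simp add: F_def)
  have F0: "F s n b = 0" if "b > s" for b s n
    using that by (simp add: F_def qbinom_eq_0)
  \<comment> \<open>Terms beyond \<open>s\<close> vanish, so all sums may run up to
    \<open>n\<close>, and Pascal's rule in \<open>s\<close> can act term by term.\<close>
  have ext: "(\<Sum>b\<le>min s n. F s n b) = (\<Sum>b\<le>n. F s n b)" for s n
    by (rule sum.mono_neutral_left) (auto simp: not_le intro!: F0)
  show ?case
  proof (cases n)
    case 0 then show ?thesis by simp
  next
    case (Suc n')
    have pa: "q powi (i + j) = q powi i * q powi j" for i j
      using assms(2) by (simp add: power_int_add)
    have F_0: "F s n 0 = 1 / qpoch q q n" for s n by (simp add: F_def)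
    \<comment> \<open>Pascal's rule for the q-binomial of \<open>s + 1\<close> and
      \<open>b + 1\<close>: its first term is the summand for one row and one column less, up to a
      power of \<open>q\<close>; in its second term the extra \<open>q ^ (b + 1)\<close> lowers
      \<open>n + s + 1\<close> to \<open>n + s\<close>.\<close>
    have step: "F (Suc s) (Suc n') (Suc b) = q powi (- int n' - int s - 1) * F s n' b + F s (Suc n') (Suc b)" for b
    proof -
      have "int (Suc b) * int (Suc b) - int (Suc n' + Suc s) * int (Suc b) =
        (- int n' - int s - 1) + (int b * int b - int (n' + s) * int b)"
        by (simp add: algebra_simps)
      moreover have "q powi (int (Suc b) * int (Suc b) - int (Suc n' + Suc s) * int (Suc b)) * q ^ Suc b =
        q powi (int (Suc b) * int (Suc b) - int (Suc n' + s) * int (Suc b))"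
      proof -
        have "int (Suc b) * int (Suc b) - int (Suc n' + s) * int (Suc b) =
         (int (Suc b) * int (Suc b) - int (Suc n' + Suc s) * int (Suc b)) + int (Suc b)"
         by (simp add: algebra_simps)
        then show ?thesis by (simp only: pa power_int_of_nat)
      qed
      ultimately show ?thesis
        using assms(2) unfolding F_def qbinom.simps
        by (simp only: pa add_divide_distrib distrib_right distrib_left diff_Suc_Suc) (simp add: mult_ac)
    qed
    have "(\<Sum>b\<le>min (Suc s) n. F (Suc s) n b) = F (Suc s) n 0 + (\<Sum>b\<le>n'. F (Suc s) n (Suc b))"
      unfolding ext Suc by (subst sum.atMost_Suc_shift) simp
    also have "\<dots> = F s n 0 + (\<Sum>b\<le>n'. F s n (Suc b)) + q powi (- int n' - int s - 1) * (\<Sum>b\<le>n'. F s n' b)"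
      unfolding Suc step by (simp add: sum.distrib sum_distrib_left F_0)
    also have "F s n 0 + (\<Sum>b\<le>n'. F s n (Suc b)) = (\<Sum>b\<le>min s n. F s n b)"
      unfolding ext Suc by (simp add: sum.atMost_Suc_shift del: sum.atMost_Suc)
    also have "\<dots> + q powi (- int n' - int s - 1) * (\<Sum>b\<le>n'. F s n' b) =
       q powi (- int s * int n) / qpoch q q n + q powi (- int n' - int s - 1) * (q powi (- int s * int n') / qpoch q q n')"
      unfolding ext[symmetric] IH ..
    also have "\<dots> = q powi (- int s * int n) / qpoch q q n * (1 + q powi (- int n) * (1 - q ^ n))"
    proof -
      have "q powi (- int n' - int s - 1) * q powi (- int s * int n') = q powi (- int s * int n) * q powi (- int n)"
        unfolding pa[symmetric] Suc by (rule arg_cong) (simp add: algebra_simps)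
      moreover have "qpoch q q n = qpoch q q n' * (1 - q ^ n)" by (simp add: Suc qpoch_Suc)
      moreover have "1 - q ^ n \<noteq> 0" unfolding Suc by (rule one_minus_power_nonzero[OF assms(1)])
      ultimately show ?thesis
        using qpoch_nonzero[OF assms(1), of n'] by (simp add: divide_simps) (simp add: algebra_simps)
    qed
    also have "\<dots> = q powi (- int (Suc s) * int n) / qpoch q q n"
    proof -
      have "1 + q powi (- int n) * (1 - q ^ n) = q powi (- int n)"
        using assms(2) by (simp add: power_int_minus field_simps)
      then show ?thesis
        by (simp add: power_int_add[OF disjI1[OF assms(2)], symmetric] algebra_simps)
    qed
    finally show ?thesis by (simp add: F_def)
  qed
qed

section \<open>Symmetrization identities\<close>

definition cross_weight :: "(nat \<Rightarrow> complex) \<Rightarrow> complex \<Rightarrow> nat set \<Rightarrow> nat set \<Rightarrow> complex" where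
  "cross_weight x t I J = (\<Prod>i\<in>I. \<Prod>j\<in>J. (x i - t * x j) / (x i - x j))"

lemma sum_Pow_insert:
  assumes "finite S" "k \<notin> S"
  shows "(\<Sum>I\<in>Pow (insert k S). f I) = (\<Sum>I\<in>Pow S. f I) + (\<Sum>I\<in>Pow S. f (insert k I))"
proof -
  have "inj_on (insert k) (Pow S)"
    using assms(2) by (intro inj_onI) (metis PowD insert_ident subsetD)
  moreover have "Pow S \<inter> insert k ` Pow S = {}" using assms(2) by auto
  ultimately show ?thesis
    unfolding Pow_insert using assms(1)
    by (subst sum.union_disjoint) (auto simp: sum.reindex)
qed

text \<open>Subtracting the multiple of the product cancels the coefficient of degree
  \<open>card S\<close>, which leaves too low a degree for \<open>card S\<close> distinct
  roots.\<close>

lemma poly_eq_smult_prod_roots: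
  fixes p :: "complex poly"
  assumes "finite S" "inj_on x S" "degree p \<le> card S" "\<And>s. s \<in> S \<Longrightarrow> poly p (x s) = 0"
  shows "p = smult (coeff p (card S)) (\<Prod>s\<in>S. [:- x s, 1:])"
proof (rule ccontr)
  let ?P = "\<Prod>s\<in>S. [:- x s, 1:]"
  define r where "r = p - smult (coeff p (card S)) ?P"
  assume "p \<noteq> smult (coeff p (card S)) ?P"
  then have r0: "r \<noteq> 0" by (simp add: r_def)
  have deg: "degree ?P = card S"
    by (subst degree_prod_eq_sum_degree) (auto simp: sum_constant)
  have "lead_coeff ?P = 1" by (simp add: lead_coeff_prod)
  then have "coeff r (card S) = 0" by (simp add: r_def deg)
  moreover have "degree r \<le> card S"
    unfolding r_def using assms(3) deg by (intro degree_diff_le) (auto intro: order_trans[OF degree_smult_le])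
  ultimately have lt: "degree r < card S"
    using r0 by (metis leading_coeff_0_iff le_neq_implies_less)
  have "x ` S \<subseteq> {z. poly r z = 0}"
    using assms(1,4) by (auto simp: r_def poly_prod prod_zero_iff)
  then have "card (x ` S) \<le> card {z. poly r z = 0}"
    by (intro card_mono poly_roots_finite r0)
  also have "\<dots> \<le> degree r" by (rule card_poly_roots_bound[OF r0])
  finally show False using lt by (simp add: card_image assms(2))
qed

context
  fixes x :: "nat \<Rightarrow> complex" and t :: complex and c :: "nat \<Rightarrow> complex" and \<phi> :: "complex poly"
begin

text \<open>The contributions of the subsets without and with a new element \<open>n\<close> to a sum over subsets of
  \<open>insert n S\<close>, as polynomials in \<open>x n\<close> after multiplication by \<open>\<Prod>\<^sub>j (x n - x j)\<close>. Their sum vanishes at each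
  \<open>x k\<close>, so the poles cancel.\<close>

definition outside_term :: "nat set \<Rightarrow> nat set \<Rightarrow> complex poly" where
  "outside_term S I = smult (c (card I) * (\<Prod>i\<in>I. poly \<phi> (x i)) * cross_weight x t I (S - I))
     ((\<Prod>i\<in>I. [:- x i, t:]) * (\<Prod>j\<in>S - I. [:- x j, 1:]))"

definition inside_term :: "nat set \<Rightarrow> nat set \<Rightarrow> complex poly" where
  "inside_term S J = smult (c (Suc (card J)) * (\<Prod>i\<in>J. poly \<phi> (x i)) * cross_weight x t J (S - J))
     (\<phi> * (\<Prod>j\<in>S - J. [:- t * x j, 1:]) * (\<Prod>i\<in>J. [:- x i, 1:]))"

definition cleared_sum :: "nat set \<Rightarrow> complex poly" where
  "cleared_sum S = (\<Sum>I\<in>Pow S. outside_term S I) + (\<Sum>I\<in>Pow S. inside_term S I)"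

lemma cleared_sum_root:
  assumes S: "finite S" "inj_on x S" and k: "k \<in> S"
  shows "poly (cleared_sum S) (x k) = 0"
proof -
  define S' where "S' = S - {k}"
  have S': "S = insert k S'" "k \<notin> S'" "finite S'" using S k by (auto simp: S'_def)
  have ne: "x k \<noteq> x j" if "j \<in> S'" for j using that S(2) S' by (auto simp: inj_on_def)
  have A0: "poly (outside_term S J) (x k) = 0" if "J \<subseteq> S'" for J
  proof -
    have "k \<in> S - J" "finite (S - J)" using that S' by auto
    then have "(\<Prod>j\<in>S - J. poly [:- x j, 1:] (x k)) = 0" by (intro prod_zero) (auto intro!: bexI[of _ k])
    then show ?thesis by (simp add: outside_term_def poly_prod)
  qed
  have C0: "poly (inside_term S (insert k J)) (x k) = 0" if "J \<subseteq> S'" for J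
  proof -
    have "finite J" using that S' finite_subset by auto
    then have "(\<Prod>j\<in>insert k J. poly [:- x j, 1:] (x k)) = 0" by (intro prod_zero) (auto intro!: bexI[of _ k])
    then show ?thesis by (simp add: inside_term_def poly_prod)
  qed
  \<comment> \<open>At \<open>x n = x k\<close> the indices \<open>n\<close> and \<open>k\<close>
    are interchangeable. The subset with \<open>k\<close> but not \<open>n\<close> and the one with
    \<open>n\<close> but not \<open>k\<close> give the same factors except for
    \<open>t * x k - x k\<close> against \<open>x k - t * x k\<close>, so they cancel.\<close>
  have AC: "poly (outside_term S (insert k J)) (x k) + poly (inside_term S J) (x k) = 0" if J: "J \<subseteq> S'" for J
  proof -
    define K where "K = S' - J"
    have fin: "finite J" "finite K" using J S' finite_subset by (auto simp: K_def)
    have kJ: "k \<notin> J" "k \<notin> K" using J S' by (auto simp: K_def)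
    have s1: "S - insert k J = K" "S - J = insert k K" using J S' by (auto simp: K_def)
    have w1: "cross_weight x t (insert k J) K = (\<Prod>j\<in>K. (x k - t * x j) / (x k - x j)) * cross_weight x t J K"
      unfolding cross_weight_def using fin kJ by simp
    have w2: "cross_weight x t J (insert k K) = (\<Prod>i\<in>J. (x i - t * x k) / (x i - x k)) * cross_weight x t J K"
      unfolding cross_weight_def using fin kJ by (simp flip: prod.distrib)
    have c1: "(\<Prod>j\<in>K. (x k - t * x j) / (x k - x j)) * (\<Prod>j\<in>K. x k - x j) = (\<Prod>j\<in>K. x k - t * x j)"
      unfolding prod.distrib[symmetric] by (rule prod.cong) (use ne in \<open>auto simp: K_def\<close>)
    have c2: "(\<Prod>i\<in>J. (x i - t * x k) / (x i - x k)) * (\<Prod>i\<in>J. x k - x i) = (\<Prod>i\<in>J. t * x k - x i)"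
      unfolding prod.distrib[symmetric]
      by (rule prod.cong) (use ne[THEN not_sym] J in \<open>auto simp: divide_simps subset_iff algebra_simps\<close>)
    define E where "E = c (Suc (card J)) * poly \<phi> (x k) * (\<Prod>i\<in>J. poly \<phi> (x i)) * cross_weight x t J K"
    have "poly (outside_term S (insert k J)) (x k) =
       E * (t * x k - x k) * ((\<Prod>j\<in>K. (x k - t * x j) / (x k - x j)) * (\<Prod>j\<in>K. x k - x j)) * (\<Prod>i\<in>J. t * x k - x i)"
      unfolding outside_term_def s1 w1 E_def using fin kJ by (simp add: poly_prod algebra_simps)
    moreover have "poly (inside_term S J) (x k) =
       E * (x k - t * x k) * ((\<Prod>i\<in>J. (x i - t * x k) / (x i - x k)) * (\<Prod>i\<in>J. x k - x i)) * (\<Prod>j\<in>K. x k - t * x j)"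
      unfolding inside_term_def s1 w2 E_def using fin kJ by (simp add: poly_prod algebra_simps)
    ultimately show ?thesis unfolding c1 c2 by (simp only:) (simp add: algebra_simps)
  qed
  have "poly (cleared_sum S) (x k) = (\<Sum>I\<in>Pow S'. poly (outside_term S I) (x k) + poly (outside_term S (insert k I)) (x k)
      + poly (inside_term S I) (x k) + poly (inside_term S (insert k I)) (x k))"
    unfolding cleared_sum_def S'(1) sum_Pow_insert[OF S'(3,2)] by (simp add: poly_sum sum.distrib)
  also have "\<dots> = 0" by (intro sum.neutral) (auto simp: A0 C0 AC add.assoc)
  finally show ?thesis .
qed

lemma sum_insert_eq_cleared_sum:
  assumes S: "finite S" "n \<notin> S" "inj_on x (insert n S)"
  shows "(\<Sum>I\<in>Pow (insert n S). c (card I) * (\<Prod>i\<in>I. poly \<phi> (x i)) * cross_weight x t I (insert n S - I))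
     * (\<Prod>j\<in>S. x n - x j) = poly (cleared_sum S) (x n)"
proof -
  have ne: "x n \<noteq> x j" if "j \<in> S" for j using that S by (auto simp: inj_on_def)
  have 1: "c (card I) * (\<Prod>i\<in>I. poly \<phi> (x i)) * cross_weight x t I (insert n S - I) * (\<Prod>j\<in>S. x n - x j)
     = poly (outside_term S I) (x n)" if I: "I \<subseteq> S" for I
  proof -
    have fin: "finite I" "finite (S - I)" using I S finite_subset by auto
    have e: "insert n S - I = insert n (S - I)" using I S by auto
    have w: "cross_weight x t I (insert n (S - I)) = (\<Prod>i\<in>I. (x i - t * x n) / (x i - x n)) * cross_weight x t I (S - I)"
      unfolding cross_weight_def using fin S by (simp flip: prod.distrib)
    have "(\<Prod>i\<in>I. (x i - t * x n) / (x i - x n)) * (\<Prod>i\<in>I. x n - x i) = (\<Prod>i\<in>I. t * x n - x i)"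
      unfolding prod.distrib[symmetric]
      by (rule prod.cong) (use ne[THEN not_sym] I in \<open>auto simp: divide_simps subset_iff algebra_simps\<close>)
    moreover have "(\<Prod>j\<in>S. x n - x j) = (\<Prod>j\<in>S - I. x n - x j) * (\<Prod>i\<in>I. x n - x i)"
      by (rule prod.subset_diff) (use I S in auto)
    ultimately show ?thesis
      unfolding e w outside_term_def by (simp add: poly_prod algebra_simps)
  qed
  have 2: "c (card (insert n I)) * (\<Prod>i\<in>insert n I. poly \<phi> (x i)) * cross_weight x t (insert n I) (insert n S - insert n I) * (\<Prod>j\<in>S. x n - x j)
     = poly (inside_term S I) (x n)" if I: "I \<subseteq> S" for I
  proof -
    have fin: "finite I" "finite (S - I)" "n \<notin> I" using I S finite_subset by auto
    have e: "insert n S - insert n I = S - I" using I S by auto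
    have w: "cross_weight x t (insert n I) (S - I) = (\<Prod>j\<in>S - I. (x n - t * x j) / (x n - x j)) * cross_weight x t I (S - I)"
      unfolding cross_weight_def using fin S by simp
    have "(\<Prod>j\<in>S - I. (x n - t * x j) / (x n - x j)) * (\<Prod>j\<in>S - I. x n - x j) = (\<Prod>j\<in>S - I. x n - t * x j)"
      unfolding prod.distrib[symmetric] by (rule prod.cong) (use ne in auto)
    moreover have "(\<Prod>j\<in>S. x n - x j) = (\<Prod>j\<in>S - I. x n - x j) * (\<Prod>i\<in>I. x n - x i)"
      by (rule prod.subset_diff) (use I S in auto)
    ultimately show ?thesis
      unfolding e w inside_term_def using fin by (simp add: poly_prod algebra_simps)
  qed
  show ?thesis
    unfolding sum_Pow_insert[OF S(1,2)] distrib_right sum_distrib_right cleared_sum_def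
poly_add poly_sum
    by (intro arg_cong2[where f = "(+)"] sum.cong refl 1 2) auto
qed

end

lemma coeff_mult_degree_le:
  fixes p r :: "complex poly"
  assumes "degree p \<le> m" "degree r \<le> n"
  shows "coeff (p * r) (m + n) = coeff p m * coeff r n"
proof -
  have "coeff (p * r) (m + n) = (\<Sum>i\<in>{m}. coeff p i * coeff r (m + n - i))"
    unfolding coeff_mult
  proof (intro sum.mono_neutral_right ballI)
    fix i assume "i \<in> {..m + n} - {m}"
    then have "degree p < i \<or> degree r < m + n - i" using assms by auto
    then show "coeff p i * coeff r (m + n - i) = 0" by (auto simp: coeff_eq_0)
  qed auto
  then show ?thesis by simp
qed

lemma degree_mult_le':
  fixes p r :: "complex poly"
  shows "degree p \<le> m \<Longrightarrow> degree r \<le> n \<Longrightarrow> degree (p * r) \<le> m + n"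
  using degree_mult_le[of p r] by linarith

lemma prod_linear_degree:
  fixes a :: "nat \<Rightarrow> complex"
  assumes "finite S"
  shows "degree (\<Prod>i\<in>S. [:a i, b i:]) \<le> card S" "coeff (\<Prod>i\<in>S. [:a i, b i:]) (card S) = (\<Prod>i\<in>S. b i)"
proof -
  have "degree (\<Prod>i\<in>S. [:a i, b i:]) \<le> card S \<and> coeff (\<Prod>i\<in>S. [:a i, b i:]) (card S) = (\<Prod>i\<in>S. b i)"
    using assms
  proof (induction S rule: finite_induct)
    case (insert k S)
    have "degree [:a k, b k:] \<le> 1" by (auto intro: order_trans[OF degree_pCons_le])
    from coeff_mult_degree_le[OF this insert.IH[THEN conjunct1]]
         degree_mult_le'[OF this insert.IH[THEN conjunct1]] insert show ?case by simp
  qed simp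
  then show "degree (\<Prod>i\<in>S. [:a i, b i:]) \<le> card S" "coeff (\<Prod>i\<in>S. [:a i, b i:]) (card S) = (\<Prod>i\<in>S. b i)"
    by auto
qed

lemma outside_term_degree:
  assumes "finite S" "I \<subseteq> S"
  shows "degree (outside_term x t c \<phi> S I) \<le> card S"
    "coeff (outside_term x t c \<phi> S I) (card S) =
      c (card I) * t ^ card I * (\<Prod>i\<in>I. poly \<phi> (x i)) * cross_weight x t I (S - I)"
proof -
  have f: "finite I" "finite (S - I)" using assms finite_subset by auto
  have e: "card S = card I + card (S - I)" using assms f by (simp add: card_Diff_subset card_mono)
  show "degree (outside_term x t c \<phi> S I) \<le> card S"
    unfolding outside_term_def e
    by (intro order_trans[OF degree_smult_le] degree_mult_le' prod_linear_degree f)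
  show "coeff (outside_term x t c \<phi> S I) (card S) =
      c (card I) * t ^ card I * (\<Prod>i\<in>I. poly \<phi> (x i)) * cross_weight x t I (S - I)"
    unfolding outside_term_def e
    by (simp add: coeff_mult_degree_le prod_linear_degree f)
qed

lemma inside_term_degree:
  assumes "finite S" "I \<subseteq> S" "degree \<phi> \<le> d"
  shows "degree (inside_term x t c \<phi> S I) \<le> d + card S"
    "coeff (inside_term x t c \<phi> S I) (d + card S) =
      c (Suc (card I)) * coeff \<phi> d * (\<Prod>i\<in>I. poly \<phi> (x i)) * cross_weight x t I (S - I)"
proof -
  have f: "finite I" "finite (S - I)" using assms finite_subset by auto
  have "card S = card I + card (S - I)" using assms f by (simp add: card_Diff_subset card_mono)
  then have e: "d + card S = d + card (S - I) + card I" by simp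
  show "degree (inside_term x t c \<phi> S I) \<le> d + card S"
    unfolding inside_term_def e
    by (intro order_trans[OF degree_smult_le] degree_mult_le' prod_linear_degree f assms)
  show "coeff (inside_term x t c \<phi> S I) (d + card S) =
      c (Suc (card I)) * coeff \<phi> d * (\<Prod>i\<in>I. poly \<phi> (x i)) * cross_weight x t I (S - I)"
    unfolding inside_term_def e
    by (simp add: coeff_mult_degree_le degree_mult_le' prod_linear_degree f assms)
qed

lemma prod_diff_nonzero:
  fixes x :: "nat \<Rightarrow> complex"
  assumes "finite S" "n \<notin> S" "inj_on x (insert n S)"
  shows "(\<Prod>j\<in>S. x n - x j) \<noteq> 0"
  using assms by (auto simp: prod_zero_iff inj_on_def)

text \<open>After clearing denominators the sum is a polynomial in \<open>x n\<close> of degree at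
  most \<open>card S\<close> that vanishes at every \<open>x s\<close>, hence a constant times the
  product of the linear factors. The constant is read off from the top coefficient, and it is the
  same kind of sum over \<open>S\<close> with \<open>c k\<close> replaced by
  \<open>c k * t ^ k + c (Suc k)\<close>: Pascal's rule in dual form. This is why \<open>c\<close>
  is arbitrary.\<close>

lemma sum_cross_weight:
  assumes "finite B" "inj_on x B"
  shows "(\<Sum>I\<in>Pow B. c (card I) * cross_weight x t I (B - I)) = (\<Sum>k\<le>card B. c k * qbinom t (card B) k)"
  using assms
proof (induction B arbitrary: c rule: finite_induct)
  case empty
  then show ?case by (simp add: cross_weight_def)
next
  case (insert n S)
  let ?p = "cleared_sum x t c 1 S"
  have inj: "inj_on x S" using insert.prems by (simp add: inj_on_def)
  have "degree ?p \<le> card S"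
    unfolding cleared_sum_def using outside_term_degree(1)[OF insert.hyps(1)]
      inside_term_degree(1)[OF insert.hyps(1), where d = 0 and \<phi> = 1]
    by (intro degree_add_le degree_sum_le) (auto simp: insert.hyps)
  from poly_eq_smult_prod_roots[OF insert.hyps(1) inj this cleared_sum_root[OF insert.hyps(1) inj]]
  have "poly ?p (x n) = coeff ?p (card S) * (\<Prod>j\<in>S. x n - x j)"
    by (metis (no_types, lifting) poly_smult poly_prod poly_pCons poly_0 mult_zero_right add_0_right
        mult_1_right uminus_add_conv_diff prod.cong)
  moreover have "(\<Sum>I\<in>Pow (insert n S). c (card I) * cross_weight x t I (insert n S - I))
     * (\<Prod>j\<in>S. x n - x j) = poly ?p (x n)"
    using sum_insert_eq_cleared_sum[OF insert.hyps insert.prems, of c 1 t] by simp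
  ultimately have "(\<Sum>I\<in>Pow (insert n S). c (card I) * cross_weight x t I (insert n S - I)) = coeff ?p (card S)"
    using prod_diff_nonzero[OF insert.hyps insert.prems] by simp
  also have "\<dots> = (\<Sum>I\<in>Pow S. (c (card I) * t ^ card I + c (Suc (card I))) * cross_weight x t I (S - I))"
    unfolding cleared_sum_def coeff_add coeff_sum
    using inside_term_degree(2)[OF insert.hyps(1), where d = 0 and \<phi> = 1]
    by (simp add: outside_term_degree insert.hyps sum.distrib[symmetric] distrib_right)
  also have "\<dots> = (\<Sum>k\<le>card S. (c k * t ^ k + c (Suc k)) * qbinom t (card S) k)"
    by (rule insert.IH[OF inj])
  also have "\<dots> = (\<Sum>k\<le>card (insert n S). c k * qbinom t (card (insert n S)) k)"
  proof -
    have "(\<Sum>k\<le>card S. c k * t ^ k * qbinom t (card S) k) =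
       c 0 + (\<Sum>k\<le>card S. c (Suc k) * t ^ Suc k * qbinom t (card S) (Suc k))"
      using sum.atMost_Suc_shift[of "\<lambda>k. c k * t ^ k * qbinom t (card S) k" "card S"]
      by (simp add: qbinom_eq_0)
    then show ?thesis
      using insert.hyps by (simp add: sum.atMost_Suc_shift sum.distrib algebra_simps del: sum.atMost_Suc)
  qed
  finally show ?case .
qed

text \<open>With the extra factors \<open>x i\<close> the weights drop out, so that every elementary
  symmetric polynomial can be given such weights. The cleared sum now has degree at most
  \<open>card S + 1\<close> in \<open>x n\<close>. Its roots at the \<open>x s\<close> leave a
  linear factor \<open>a + b * x n\<close>, which is determined by the top coefficient and by the
  value at \<open>0\<close>.\<close>

lemma sum_prod_cross_weight:
  assumes "finite B" "inj_on x B"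
  shows "(\<Sum>I\<in>Pow B. c (card I) * (\<Prod>i\<in>I. x i) * cross_weight x t I (B - I)) =
    (\<Sum>I\<in>Pow B. c (card I) * (\<Prod>i\<in>I. x i))"
  using assms
proof (induction "card B" arbitrary: B c)
  case 0
  then show ?case by (simp add: cross_weight_def)
next
  case (Suc N)
  \<comment> \<open>By injectivity at most one \<open>x i\<close> vanishes. It is taken as the new
    element if it exists; otherwise \<open>0\<close> differs from all \<open>x s\<close> and can
    serve as an additional interpolation point.\<close>
  have "\<exists>n\<in>B. \<forall>s\<in>B - {n}. x n = 0 \<or> x s \<noteq> 0"
  proof (cases "\<exists>n\<in>B. x n = 0")
    case False
    moreover have "B \<noteq> {}" using Suc.hyps(2) by auto
    ultimately show ?thesis by auto
  qed auto
  then obtain n where n: "n \<in> B" "\<And>s. s \<in> B - {n} \<Longrightarrow> x n = 0 \<or> x s \<noteq> 0" by blast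
  define S where "S = B - {n}"
  have B: "B = insert n S" and S: "finite S" "n \<notin> S" "N = card S"
    using n Suc by (auto simp: S_def)
  have inj: "inj_on x S" "inj_on x (insert n S)" using Suc.prems by (auto simp: inj_on_def B)
  have IH: "(\<Sum>I\<in>Pow S. c (card I) * (\<Prod>i\<in>I. x i) * cross_weight x t I (S - I)) =
    (\<Sum>I\<in>Pow S. c (card I) * (\<Prod>i\<in>I. x i))" for c
    using Suc.hyps(1)[OF S(3,1) inj(1)] .
  have card_ins: "card (insert n I) = Suc (card I)" "(\<Prod>i\<in>insert n I. x i) = x n * (\<Prod>i\<in>I. x i)" if "I \<in> Pow S" for I
  proof -
    have "finite I" "n \<notin> I" using that S finite_subset[of I S] by auto
    then show "card (insert n I) = Suc (card I)" "(\<Prod>i\<in>insert n I. x i) = x n * (\<Prod>i\<in>I. x i)" by auto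
  qed
  have split: "(\<Sum>I\<in>Pow B. c (card I) * (\<Prod>i\<in>I. x i)) = (\<Sum>I\<in>Pow S. c (card I) * (\<Prod>i\<in>I. x i)) +
     x n * (\<Sum>I\<in>Pow S. c (Suc (card I)) * (\<Prod>i\<in>I. x i))"
    unfolding B sum_Pow_insert[OF S(1,2)] sum_distrib_left by (simp add: card_ins mult_ac)
  show ?case
  proof (cases "x n = 0")
    case True
    \<comment> \<open>If \<open>x n = 0\<close>, the factor pairing \<open>i\<close> with
      \<open>n\<close> is \<open>x i / x i\<close>, and subsets containing \<open>n\<close>
      contribute nothing.\<close>
    have w: "cross_weight x t I (insert n S - I) = cross_weight x t I (S - I)" if "I \<in> Pow S" for I
    proof -
      have "insert n S - I = insert n (S - I)" using that S by auto
      moreover have "\<forall>i\<in>I. x i \<noteq> 0" using inj(2) that S True by (auto simp: inj_on_def)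
      ultimately show ?thesis
        unfolding cross_weight_def using S True by (auto intro!: prod.cong)
    qed
    show ?thesis
      unfolding split unfolding B sum_Pow_insert[OF S(1,2)]
      using IH[of c] by (simp add: card_ins w True)
  next
    case False
    let ?\<phi> = "[:0, 1:] :: complex poly"
    let ?p = "cleared_sum x t c ?\<phi> S"
    let ?P = "\<Prod>s\<in>S. [:- x s, 1:]"
    define a where "a = (\<Sum>I\<in>Pow S. c (card I) * (\<Prod>i\<in>I. x i))"
    define b where "b = (\<Sum>I\<in>Pow S. c (Suc (card I)) * (\<Prod>i\<in>I. x i))"
    have nz: "x s \<noteq> 0" if "s \<in> S" for s using n(2) False that by (auto simp: S_def)
    define r where "r = ?p - [:a, b:] * ?P"
    have d1: "degree ?\<phi> \<le> 1" by simp
    have "degree ?p \<le> 1 + card S"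
      unfolding cleared_sum_def using outside_term_degree(1)[OF S(1)] inside_term_degree(1)[OF S(1) _ d1]
      by (intro degree_add_le degree_sum_le) (auto simp: S intro: le_SucI)
    moreover have "degree ([:a, b:] * ?P) \<le> 1 + card S"
      by (intro degree_mult_le' prod_linear_degree S) (auto intro: order_trans[OF degree_pCons_le])
    ultimately have "degree r \<le> 1 + card S" unfolding r_def by (intro degree_diff_le) auto
    moreover have "coeff r (1 + card S) = 0"
    proof -
      have "coeff ?p (1 + card S) = b"
        unfolding cleared_sum_def coeff_add coeff_sum b_def IH[of "\<lambda>k. c (Suc k)", symmetric]
        using inside_term_degree(2)[OF S(1) _ d1]
        by (simp add: coeff_eq_0 outside_term_degree(1)[OF S(1)] le_imp_less_Suc)
      moreover have "coeff ([:a, b:] * ?P) (1 + card S) = b"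
        by (subst coeff_mult_degree_le) (auto intro: order_trans[OF degree_pCons_le] simp: prod_linear_degree S)
      ultimately show ?thesis by (simp add: r_def)
    qed
    ultimately have dr: "degree r \<le> card S"
      by (metis One_nat_def Suc_eq_plus1_left le_SucE leading_coeff_0_iff degree_0 le0)
    have roots: "poly r (x s) = 0" if "s \<in> S" for s
    proof -
      have "poly ?P (x s) = 0" using that S by (auto simp: poly_prod intro!: prod_zero bexI[of _ s])
      then show ?thesis using cleared_sum_root[OF S(1) inj(1) that] by (simp add: r_def)
    qed
    \<comment> \<open>At \<open>0\<close> the inside terms vanish because of the factor
      \<open>\<phi> = X\<close>, and the outside terms reproduce the weighted sum over
      \<open>S\<close>, to which the induction hypothesis applies.\<close>
    have r0: "poly r 0 = 0"
    proof -
      have "poly ?p 0 = (\<Sum>I\<in>Pow S. c (card I) * (\<Prod>i\<in>I. x i) * cross_weight x t I (S - I) * (\<Prod>i\<in>S. - x i))"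
        unfolding cleared_sum_def poly_add poly_sum
      proof (subst (2) sum.neutral)
        show "(\<Sum>I\<in>Pow S. poly (outside_term x t c ?\<phi> S I) 0) + 0 =
          (\<Sum>I\<in>Pow S. c (card I) * (\<Prod>i\<in>I. x i) * cross_weight x t I (S - I) * (\<Prod>i\<in>S. - x i))"
          unfolding add_0_right
        proof (rule sum.cong)
          fix I assume I: "I \<in> Pow S"
          have "(\<Prod>i\<in>S. - x i) = (\<Prod>i\<in>S - I. - x i) * (\<Prod>i\<in>I. - x i)"
            by (rule prod.subset_diff) (use I S in auto)
          then show "poly (outside_term x t c ?\<phi> S I) 0 =
              c (card I) * (\<Prod>i\<in>I. x i) * cross_weight x t I (S - I) * (\<Prod>i\<in>S. - x i)"
            by (simp add: outside_term_def poly_prod)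
        qed simp
      qed (auto simp: inside_term_def poly_prod)
      also have "\<dots> = a * poly ?P 0"
        unfolding sum_distrib_right[symmetric] IH a_def by (simp add: poly_prod)
      finally show ?thesis by (simp add: r_def)
    qed
    have "r = 0"
    proof (rule ccontr)
      assume "r \<noteq> 0"
      have "0 \<notin> x ` S" using nz by auto
      then have "Suc (card S) = card (insert 0 (x ` S))" using S inj by (simp add: card_image)
      also have "\<dots> \<le> card {z. poly r z = 0}"
        using roots r0 \<open>r \<noteq> 0\<close> by (intro card_mono poly_roots_finite) auto
      also have "\<dots> \<le> degree r" by (rule card_poly_roots_bound[OF \<open>r \<noteq> 0\<close>])
      finally show False using dr by simp
    qed
    then have "poly ?p (x n) = (a + b * x n) * (\<Prod>j\<in>S. x n - x j)"
      by (simp add: r_def poly_prod algebra_simps)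
    moreover have "(\<Sum>I\<in>Pow B. c (card I) * (\<Prod>i\<in>I. x i) * cross_weight x t I (B - I))
       * (\<Prod>j\<in>S. x n - x j) = poly ?p (x n)"
      using sum_insert_eq_cleared_sum[OF S(1,2) inj(2), of c ?\<phi> t] by (simp add: B)
    ultimately have "(\<Sum>I\<in>Pow B. c (card I) * (\<Prod>i\<in>I. x i) * cross_weight x t I (B - I)) = a + b * x n"
      using prod_diff_nonzero[OF S(1,2) inj(2)] by simp
    then show ?thesis unfolding split a_def b_def by simp
  qed
qed

lemma sum_Pow_Un:
  assumes "A \<inter> B = {}"
  shows "(\<Sum>D\<in>Pow (A \<union> B). f D) = (\<Sum>D\<in>Pow A. \<Sum>E\<in>Pow B. f (D \<union> E))"
  unfolding sum.cartesian_product
  by (rule sum.reindex_bij_witness[of _ "\<lambda>(D, E). D \<union> E" "\<lambda>D. (D \<inter> A, D \<inter> B)"])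
     (use assms in \<open>auto simp: Int_Un_distrib2 intro!: arg_cong[of _ _ f]\<close>)

lemma sum_PiE_insert:
  assumes "v \<notin> V"
  shows "(\<Sum>d\<in>PiE (insert v V) B. F d) = (\<Sum>k\<in>B v. \<Sum>d\<in>PiE V B. F (d(v := k)))"
  unfolding sum.cartesian_product PiE_insert_eq
  by (subst sum.reindex[OF inj_combinator[OF assms]]) (simp add: case_prod_unfold)

text \<open>The lower index stays \<open>card B - k\<close>: \<open>qbinom_symmetric\<close> is
  proved for a base of norm below 1, whereas \<open>t\<close> is arbitrary here.\<close>

lemma sum_cross_weight_complement:
  assumes "finite B" "inj_on x B"
  shows "(\<Sum>D\<in>Pow B. c (card D) * cross_weight x t (B - D) D) = (\<Sum>k\<le>card B. c k * qbinom t (card B) (card B - k))"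
proof -
  have c: "card B - card (B - D) = card D" if "D \<subseteq> B" for D
    using that assms(1) finite_subset[OF that] by (simp add: card_Diff_subset card_mono)
  have "(\<Sum>D\<in>Pow B. c (card D) * cross_weight x t (B - D) D) =
    (\<Sum>I\<in>Pow B. c (card B - card I) * cross_weight x t I (B - I))"
    by (rule sum.reindex_bij_witness[of _ "\<lambda>D. B - D" "\<lambda>D. B - D"])
       (auto simp: double_diff c)
  also have "\<dots> = (\<Sum>k\<le>card B. c (card B - k) * qbinom t (card B) k)"
    by (rule sum_cross_weight[OF assms])
  also have "\<dots> = (\<Sum>k\<le>card B. c k * qbinom t (card B) (card B - k))"
    by (rule sum.reindex_bij_witness[of _ "\<lambda>k. card B - k" "\<lambda>k. card B - k"]) auto
  finally show ?thesis .
qed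

text \<open>The blocks will be the level sets of an exponent vector. The factor \<open>F\<close>
  sees a subset only through the sizes of its intersections with the blocks, so the blocks can be
  summed out one after another by \<open>sum_cross_weight_complement\<close>.\<close>

lemma sum_cross_weight_blocks:
  assumes "finite V" "\<And>v. v \<in> V \<Longrightarrow> finite (B v)" "disjoint_family_on B V" "\<And>v. v \<in> V \<Longrightarrow> inj_on x (B v)"
  shows "(\<Sum>D\<in>Pow (\<Union>v\<in>V. B v). F (\<lambda>v\<in>V. card (D \<inter> B v)) * (\<Prod>v\<in>V. cross_weight x t (B v - D) (D \<inter> B v)))
    = (\<Sum>d\<in>PiE V (\<lambda>v. {..card (B v)}). F d * (\<Prod>v\<in>V. qbinom t (card (B v)) (card (B v) - d v)))"
  using assms
proof (induction V arbitrary: F rule: finite_induct)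
  case (insert v V)
  let ?U = "\<Union>v\<in>V. B v"
  have disj: "B v \<inter> ?U = {}"
    using insert.prems(2) insert.hyps by (auto simp: disjoint_family_on_def)
  have IH: "(\<Sum>D\<in>Pow ?U. F (\<lambda>v\<in>V. card (D \<inter> B v)) * (\<Prod>v\<in>V. cross_weight x t (B v - D) (D \<inter> B v)))
    = (\<Sum>d\<in>PiE V (\<lambda>v. {..card (B v)}). F d * (\<Prod>v\<in>V. qbinom t (card (B v)) (card (B v) - d v)))" for F
    using insert.prems by (intro insert.IH) (auto simp: disjoint_family_on_def)
  have "(\<Sum>D\<in>Pow (\<Union>v\<in>insert v V. B v). F (\<lambda>v\<in>insert v V. card (D \<inter> B v)) * (\<Prod>v\<in>insert v V. cross_weight x t (B v - D) (D \<inter> B v)))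
    = (\<Sum>E\<in>Pow ?U. \<Sum>D\<in>Pow (B v). F ((\<lambda>v\<in>V. card (E \<inter> B v))(v := card D)) * cross_weight x t (B v - D) D
        * (\<Prod>v\<in>V. cross_weight x t (B v - E) (E \<inter> B v)))"
    unfolding UN_insert sum_Pow_Un[OF disj]
  proof (subst sum.swap, intro sum.cong refl)
    fix D E assume D: "D \<in> Pow (B v)" and E: "E \<in> Pow ?U"
    have 1: "(D \<union> E) \<inter> B v = D" "B v - (D \<union> E) = B v - D" using D E disj by auto
    have 2: "(D \<union> E) \<inter> B w = E \<inter> B w" "B w - (D \<union> E) = B w - E" if "w \<in> V" for w
      using that D disj by auto
    have 3: "(\<lambda>w\<in>insert v V. card ((D \<union> E) \<inter> B w)) = (\<lambda>v\<in>V. card (E \<inter> B v))(v := card D)"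
      using 1 2 by (auto simp: restrict_def fun_eq_iff)
    have "(\<Prod>w\<in>V. cross_weight x t (B w - (D \<union> E)) ((D \<union> E) \<inter> B w)) = (\<Prod>w\<in>V. cross_weight x t (B w - E) (E \<inter> B w))"
      by (simp add: 2 cong: prod.cong)
    then show "F (\<lambda>v\<in>insert v V. card ((D \<union> E) \<inter> B v)) *
        (\<Prod>v\<in>insert v V. cross_weight x t (B v - (D \<union> E)) ((D \<union> E) \<inter> B v)) =
      F ((\<lambda>v\<in>V. card (E \<inter> B v))(v := card D)) * cross_weight x t (B v - D) D *
        (\<Prod>v\<in>V. cross_weight x t (B v - E) (E \<inter> B v))"
      using insert.hyps by (simp add: 1 3)
  qed
  also have "\<dots> = (\<Sum>E\<in>Pow ?U. (\<Sum>k\<le>card (B v). F ((\<lambda>v\<in>V. card (E \<inter> B v))(v := k)) * qbinom t (card (B v)) (card (B v) - k))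
        * (\<Prod>v\<in>V. cross_weight x t (B v - E) (E \<inter> B v)))"
    using sum_cross_weight_complement[of "B v" x "\<lambda>k. F ((\<lambda>v\<in>V. card (_ \<inter> B v))(v := k))" t] insert.prems
    by (simp flip: sum_distrib_right)
  also have "\<dots> = (\<Sum>k\<le>card (B v). qbinom t (card (B v)) (card (B v) - k) *
       (\<Sum>E\<in>Pow ?U. F ((\<lambda>v\<in>V. card (E \<inter> B v))(v := k)) * (\<Prod>v\<in>V. cross_weight x t (B v - E) (E \<inter> B v))))"
    unfolding sum_distrib_right sum_distrib_left by (subst sum.swap) (simp add: mult_ac)
  also have "\<dots> = (\<Sum>k\<le>card (B v). qbinom t (card (B v)) (card (B v) - k) *
       (\<Sum>d\<in>PiE V (\<lambda>v. {..card (B v)}). F (d(v := k)) * (\<Prod>v\<in>V. qbinom t (card (B v)) (card (B v) - d v))))"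
    unfolding IH[of "\<lambda>d. F (d(v := _))"] ..
  also have "\<dots> = (\<Sum>d\<in>PiE (insert v V) (\<lambda>v. {..card (B v)}). F d * (\<Prod>v\<in>insert v V. qbinom t (card (B v)) (card (B v) - d v)))"
    unfolding sum_PiE_insert[OF insert.hyps(2)] sum_distrib_left
  proof (intro sum.cong refl)
    fix k and d
    have "(\<Prod>w\<in>V. qbinom t (card (B w)) (card (B w) - (d(v := k)) w)) = (\<Prod>v\<in>V. qbinom t (card (B v)) (card (B v) - d v))"
      by (rule prod.cong) (use insert.hyps in auto)
    then show "qbinom t (card (B v)) (card (B v) - k) * (F (d(v := k)) * (\<Prod>v\<in>V. qbinom t (card (B v)) (card (B v) - d v))) =
       F (d(v := k)) * (\<Prod>w\<in>insert v V. qbinom t (card (B w)) (card (B w) - (d(v := k)) w))"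
      using insert.hyps by (simp add: mult_ac)
  qed
  finally show ?case .
qed (simp add: restrict_def)

text \<open>For one block, the part \<open>E\<close> of the subset outside it is held fixed; it
  merely shifts the argument of \<open>c\<close> by \<open>card E\<close>, and
  \<open>sum_prod_cross_weight\<close> removes the weights of that block.\<close>

lemma sum_prod_cross_weight_blocks:
  assumes "finite S" "inj_on x S" "finite V" "disjoint_family_on B V" "\<And>v. v \<in> V \<Longrightarrow> B v \<subseteq> S"
  shows "(\<Sum>D\<in>Pow S. c (card D) * (\<Prod>i\<in>D. x i) * (\<Prod>v\<in>V. cross_weight x t (D \<inter> B v) (B v - D)))
    = (\<Sum>D\<in>Pow S. c (card D) * (\<Prod>i\<in>D. x i))"
  using assms(3,4,5)
proof (induction V rule: finite_induct)
  case (insert v V)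
  let ?R = "S - B v"
  have Bv: "B v \<subseteq> S" "finite (B v)" "inj_on x (B v)" "B v \<inter> ?R = {}" "S = B v \<union> ?R"
    using insert.prems(2)[of v] assms(1,2) by (auto intro: finite_subset inj_on_subset)
  have disj: "B v \<inter> B w = {}" if "w \<in> V" for w
    using insert.prems(1) insert.hyps that by (auto simp: disjoint_family_on_def)
  have dist: "c (card (D \<union> E)) * (\<Prod>i\<in>D \<union> E. x i) * (\<Prod>v\<in>V. cross_weight x t ((D \<union> E) \<inter> B v) (B v - (D \<union> E))) =
     (\<Prod>i\<in>E. x i) * (\<Prod>v\<in>V. cross_weight x t (E \<inter> B v) (B v - E)) * (c (card D + card E) * (\<Prod>i\<in>D. x i))"
    if "D \<in> Pow (B v)" "E \<in> Pow ?R" for D E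
  proof -
    have f: "finite D" "finite E" "D \<inter> E = {}" using that Bv assms(1) finite_subset by blast+
    have "(D \<union> E) \<inter> B w = E \<inter> B w" "B w - (D \<union> E) = B w - E" if "w \<in> V" for w
      using disj[OF that] \<open>D \<in> Pow (B v)\<close> by auto
    then show ?thesis using f by (simp add: card_Un_disjoint prod.union_disjoint mult_ac cong: prod.cong)
  qed
  have cw: "cross_weight x t ((D \<union> E) \<inter> B v) (B v - (D \<union> E)) = cross_weight x t D (B v - D)"
    if "D \<in> Pow (B v)" "E \<in> Pow ?R" for D E
    using that Bv by (intro arg_cong2[where f = "cross_weight x t"]) auto
  have "(\<Sum>D\<in>Pow S. c (card D) * (\<Prod>i\<in>D. x i) * (\<Prod>v\<in>insert v V. cross_weight x t (D \<inter> B v) (B v - D)))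
     = (\<Sum>D\<in>Pow (B v \<union> ?R). (c (card D) * (\<Prod>i\<in>D. x i) * (\<Prod>v\<in>V. cross_weight x t (D \<inter> B v) (B v - D))) * cross_weight x t (D \<inter> B v) (B v - D))"
    using insert.hyps Bv(5) by (simp add: mult_ac)
  also have "\<dots> = (\<Sum>E\<in>Pow ?R. \<Sum>D\<in>Pow (B v). (\<Prod>i\<in>E. x i) * (\<Prod>v\<in>V. cross_weight x t (E \<inter> B v) (B v - E)) *
      (c (card D + card E) * (\<Prod>i\<in>D. x i) * cross_weight x t D (B v - D)))"
    unfolding sum_Pow_Un[OF Bv(4)] by (subst sum.swap, intro sum.cong refl) (simp only: dist cw, simp only: mult_ac)
  also have "\<dots> = (\<Sum>E\<in>Pow ?R. \<Sum>D\<in>Pow (B v). (\<Prod>i\<in>E. x i) * (\<Prod>v\<in>V. cross_weight x t (E \<inter> B v) (B v - E)) *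
      (c (card D + card E) * (\<Prod>i\<in>D. x i)))"
    unfolding sum_distrib_left[symmetric]
    by (intro sum.cong refl arg_cong2[where f = "(*)"] sum_prod_cross_weight[where c = "\<lambda>k. c (k + _)"] Bv)
  also have "\<dots> = (\<Sum>D\<in>Pow (B v \<union> ?R). c (card D) * (\<Prod>i\<in>D. x i) * (\<Prod>v\<in>V. cross_weight x t (D \<inter> B v) (B v - D)))"
    unfolding sum_Pow_Un[OF Bv(4)] by (subst (2) sum.swap, intro sum.cong refl) (simp only: dist)
  also have "\<dots> = (\<Sum>D\<in>Pow S. c (card D) * (\<Prod>i\<in>D. x i))"
    unfolding Bv(5)[symmetric] by (rule insert.IH) (use insert.prems in \<open>auto simp: disjoint_family_on_def\<close>)
  finally show ?case .
qed simp

section \<open>Hall--Littlewood polynomials as sums over exponent vectors\<close>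

definition is_partition :: "nat list \<Rightarrow> bool" where
  "is_partition \<mu> \<longleftrightarrow> sorted_wrt (\<ge>) \<mu> \<and> 0 \<notin> set \<mu>"

lemma partitions_of_iff: "\<mu> \<in> partitions_of k \<longleftrightarrow> is_partition \<mu> \<and> sum_list \<mu> = k"
  by (simp add: partitions_of_def is_partition_def)

lemma is_partition_eqI:
  assumes "is_partition \<mu>" "is_partition \<nu>" "mset \<mu> = mset \<nu>"
  shows "\<mu> = \<nu>"
proof -
  have "sorted (rev \<mu>)" "sorted (rev \<nu>)"
    using assms(1,2) by (auto simp: is_partition_def sorted_wrt_rev)
  then have "rev \<mu> = rev \<nu>"
    using assms(3) by (metis mset_rev sorted_list_of_multiset_mset sorted_sort_id)
  then show ?thesis by simp
qed

lemma is_partition_count_eqI: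
  assumes "is_partition \<mu>" "is_partition \<nu>" "\<And>v. v \<ge> 1 \<Longrightarrow> count (mset \<mu>) v = count (mset \<nu>) v"
  shows "\<mu> = \<nu>"
proof (rule is_partition_eqI[OF assms(1,2)], rule multiset_eqI)
  fix v show "count (mset \<mu>) v = count (mset \<nu>) v"
    using assms by (cases "v = 0") (auto simp: is_partition_def not_in_iff[THEN iffD1])
qed

lemma length_le_sum_list: "0 \<notin> set \<mu> \<Longrightarrow> length \<mu> \<le> sum_list (\<mu> :: nat list)"
  by (induction \<mu>) auto

lemma finite_partitions_of [simp]: "finite (partitions_of k)"
proof (rule finite_subset)
  show "partitions_of k \<subseteq> {\<mu>. set \<mu> \<subseteq> {..k} \<and> length \<mu> \<le> k}"
    using length_le_sum_list by (auto simp: partitions_of_def member_le_sum_list)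
  show "finite {\<mu>. set \<mu> \<subseteq> {..k} \<and> length \<mu> \<le> k}"
    by (intro finite_lists_length_le) simp
qed

text \<open>Zeros are dropped because partitions carry no padding here; the number of variables
  survives only in the domain of the vectors.\<close>

definition shape :: "nat \<Rightarrow> (nat \<Rightarrow> nat) \<Rightarrow> nat list" where
  "shape N \<alpha> = rev (sort (filter (\<lambda>v. v \<noteq> 0) (map \<alpha> [0..<N])))"

lemma is_partition_shape [simp]: "is_partition (shape N \<alpha>)"
  by (simp add: is_partition_def shape_def sorted_wrt_rev)

lemma count_list_nth: "count (mset l) v = card {i. i < length l \<and> l ! i = v}"
  unfolding count_mset count_list_eq_length_filter length_filter_conv_card by (rule arg_cong[of _ _ card]) auto

lemma count_shape:
  assumes "v \<ge> 1"
  shows "count (mset (shape N \<alpha>)) v = card {i. i < N \<and> \<alpha> i = v}"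
proof -
  have "count (mset (shape N \<alpha>)) v = count (mset (map \<alpha> [0..<N])) v"
    using assms by (simp add: shape_def)
  also have "\<dots> = card {i. i < N \<and> \<alpha> i = v}"
    unfolding count_list_nth by (rule arg_cong[of _ _ card]) auto
  finally show ?thesis .
qed

lemma sum_list_shape [simp]: "sum_list (shape N \<alpha>) = (\<Sum>i<N. \<alpha> i)"
proof -
  have "sum_list (filter (\<lambda>v. v \<noteq> 0) l) = sum_list l" for l :: "nat list" by (induction l) auto
  then have "sum_list (shape N \<alpha>) = sum_list (map \<alpha> [0..<N])"
    unfolding shape_def by (metis mset_rev mset_sort sum_mset_sum_list)
  then show ?thesis by (simp add: sum_list_sum_nth atLeast0LessThan)
qed

lemma shape_eq_iff:
  assumes "is_partition \<mu>"
  shows "shape N \<alpha> = \<mu> \<longleftrightarrow> (\<forall>v\<ge>1. card {i. i < N \<and> \<alpha> i = v} = count (mset \<mu>) v)"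
  using is_partition_count_eqI[OF is_partition_shape assms, of N \<alpha>] by (auto simp: count_shape)

definition vectors :: "nat \<Rightarrow> nat list \<Rightarrow> (nat \<Rightarrow> nat) set" where
  "vectors N \<mu> = {\<alpha> \<in> {..<N} \<rightarrow>\<^sub>E UNIV. shape N \<alpha> = \<mu>}"

lemma finite_weight_vectors: "finite {\<alpha> \<in> {..<N::nat} \<rightarrow>\<^sub>E UNIV. (\<Sum>i<N. \<alpha> i) = (k::nat)}"
proof (rule finite_subset)
  show "{\<alpha> \<in> {..<N} \<rightarrow>\<^sub>E UNIV. (\<Sum>i<N. \<alpha> i) = k} \<subseteq> {..<N} \<rightarrow>\<^sub>E {..k}"
  proof
    fix \<alpha> assume \<alpha>: "\<alpha> \<in> {\<alpha> \<in> {..<N} \<rightarrow>\<^sub>E UNIV. (\<Sum>i<N. \<alpha> i) = k}"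
    have "\<forall>i\<in>{..<N}. \<alpha> i \<le> sum \<alpha> {..<N}" by (intro ballI member_le_sum) auto
    with \<alpha> show "\<alpha> \<in> {..<N} \<rightarrow>\<^sub>E {..k}" by (simp add: PiE_iff)
  qed
qed (auto intro: finite_PiE)

lemma vectors_weight:
  assumes "\<alpha> \<in> vectors N \<mu>"
  shows "(\<Sum>i<N. \<alpha> i) = sum_list \<mu>"
proof -
  have "shape N \<alpha> = \<mu>" using assms unfolding vectors_def by blast
  then show ?thesis by (rule subst) (rule sum_list_shape[symmetric])
qed

lemma finite_vectors [simp]: "finite (vectors N \<mu>)"
proof (rule finite_subset)
  show "vectors N \<mu> \<subseteq> {\<alpha> \<in> {..<N} \<rightarrow>\<^sub>E UNIV. (\<Sum>i<N. \<alpha> i) = sum_list \<mu>}"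
    using vectors_weight unfolding vectors_def by blast
qed (rule finite_weight_vectors)

lemma sum_vectors_partitions:
  "(\<Sum>\<alpha> | \<alpha> \<in> {..<N} \<rightarrow>\<^sub>E UNIV \<and> (\<Sum>i<N. \<alpha> i) = k. f \<alpha>) = (\<Sum>\<mu>\<in>partitions_of k. \<Sum>\<alpha>\<in>vectors N \<mu>. f \<alpha>)"
proof -
  let ?W = "{\<alpha> \<in> {..<N} \<rightarrow>\<^sub>E UNIV. (\<Sum>i<N. \<alpha> i) = k}"
  have "shape N ` ?W \<subseteq> partitions_of k"
  proof
    fix \<mu> assume "\<mu> \<in> shape N ` ?W"
    then obtain \<alpha> where "\<mu> = shape N \<alpha>" "(\<Sum>i<N. \<alpha> i) = k" by blast
    then show "\<mu> \<in> partitions_of k"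
      unfolding partitions_of_iff by (simp only: is_partition_shape sum_list_shape)
  qed
  from sum.group[OF finite_weight_vectors finite_partitions_of this, of f]
  have "sum f ?W = (\<Sum>\<mu>\<in>partitions_of k. sum f {\<alpha> \<in> ?W. shape N \<alpha> = \<mu>})" by (rule sym)
  also have "\<dots> = (\<Sum>\<mu>\<in>partitions_of k. \<Sum>\<alpha>\<in>vectors N \<mu>. f \<alpha>)"
  proof (rule sum.cong[OF refl], rule sum.cong[OF _ refl])
    fix \<mu> assume "\<mu> \<in> partitions_of k"
    then show "{\<alpha> \<in> ?W. shape N \<alpha> = \<mu>} = vectors N \<mu>"
      using vectors_weight[of _ N \<mu>] unfolding vectors_def partitions_of_iff by blast
  qed
  finally show ?thesis .
qed

definition pair_weight :: "(nat \<Rightarrow> complex) \<Rightarrow> complex \<Rightarrow> (nat \<times> nat) set \<Rightarrow> complex" where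
  "pair_weight x t R = (\<Prod>(i, j)\<in>R. (x i - t * x j) / (x i - x j))"

definition hl_term :: "nat \<Rightarrow> (nat \<Rightarrow> complex) \<Rightarrow> complex \<Rightarrow> (nat \<Rightarrow> nat) \<Rightarrow> complex" where
  "hl_term N x t \<alpha> = (\<Prod>i<N. x i ^ \<alpha> i) * pair_weight x t {(i, j). i < N \<and> j < N \<and> \<alpha> i > \<alpha> j}"

text \<open>Rearrangements become functions on index sets, so that raising and lowering act
  pointwise and the entries equal to \<open>v\<close> form a set of indices.\<close>

lemma hall_littlewood_P_eq:
  assumes "is_partition \<mu>"
  shows "hall_littlewood_P N x t \<mu> = (\<Sum>\<alpha>\<in>vectors N \<mu>. hl_term N x t \<alpha>)"
proof (cases "length \<mu> \<le> N")
  case False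
  have "vectors N \<mu> = {}"
  proof (rule ccontr)
    assume "vectors N \<mu> \<noteq> {}"
    then obtain \<alpha> where "shape N \<alpha> = \<mu>" by (auto simp: vectors_def)
    moreover have "length (shape N \<alpha>) \<le> length (map \<alpha> [0..<N])"
      unfolding shape_def length_rev length_sort by (rule length_filter_le)
    ultimately show False using False by auto
  qed
  then show ?thesis using False by (simp add: hall_littlewood_P_def)
next
  case True
  have iff: "l \<in> rearrangements N \<mu> \<longleftrightarrow> length l = N \<and> shape N (\<lambda>i. l ! i) = \<mu>" for l
  proof -
    have *: "card {i. i < length l \<and> l ! i = v} = count (mset l) v" for v
      by (simp add: count_list_nth)
    have "l \<in> rearrangements N \<mu> \<longleftrightarrow> length l = N \<and> (\<forall>v\<ge>1. count (mset l) v = count (mset \<mu>) v)"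
    proof
      assume l: "l \<in> rearrangements N \<mu>"
      then have "mset l = mset (\<mu> @ replicate (N - length \<mu>) 0)" by (simp add: rearrangements_def)
      moreover from this have "length l = N" using True by (metis size_mset length_append length_replicate le_add_diff_inverse)
      ultimately show "length l = N \<and> (\<forall>v\<ge>1. count (mset l) v = count (mset \<mu>) v)" by simp
    next
      assume l: "length l = N \<and> (\<forall>v\<ge>1. count (mset l) v = count (mset \<mu>) v)"
      have f: "filter_mset (\<lambda>v. v \<noteq> 0) (mset l) = mset \<mu>"
        using l assms by (intro multiset_eqI) (auto simp: is_partition_def count_eq_zero_iff Suc_le_eq)
      have d: "mset l = filter_mset (\<lambda>v. v \<noteq> 0) (mset l) + filter_mset (\<lambda>v. v = 0) (mset l)"
        using multiset_partition[of "mset l" "\<lambda>v. v \<noteq> 0"] by simp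
      have z: "filter_mset (\<lambda>v. v = 0) (mset l) = replicate_mset (count (mset l) 0) 0"
        by (rule filter_eq_replicate_mset)
      have "size (mset l) = length \<mu> + count (mset l) 0"
        by (subst d) (simp only: size_union f z size_replicate_mset size_mset)
      then have "count (mset l) 0 = N - length \<mu>" using l by simp
      then show "l \<in> rearrangements N \<mu>"
        unfolding rearrangements_def using d unfolding f z by simp
    qed
    then show ?thesis by (auto simp: shape_eq_iff[OF assms] *)
  qed
  have sh: "shape N (restrict (\<lambda>i. l ! i) {..<N}) = shape N (\<lambda>i. l ! i)" for l
    unfolding shape_def by (rule arg_cong[of _ _ "\<lambda>l. rev (sort (filter _ l))"]) auto
  have sh': "shape N (\<lambda>i. map \<alpha> [0..<N] ! i) = shape N \<alpha>" for \<alpha>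
    unfolding shape_def by (rule arg_cong[of _ _ "\<lambda>l. rev (sort (filter _ l))"]) auto
  have "hall_littlewood_P N x t \<mu> = (\<Sum>l\<in>rearrangements N \<mu>. hl_term N x t (restrict (\<lambda>i. l ! i) {..<N}))"
    using True unfolding hall_littlewood_P_def hl_term_def pair_weight_def
    by (auto intro!: sum.cong arg_cong2[where f = "(*)"] prod.cong)
  also have "\<dots> = (\<Sum>\<alpha>\<in>vectors N \<mu>. hl_term N x t \<alpha>)"
    by (rule sum.reindex_bij_witness[of _ "\<lambda>\<alpha>. map \<alpha> [0..<N]" "\<lambda>l. restrict (\<lambda>i. l ! i) {..<N}"])
       (auto simp: iff vectors_def sh sh' fun_eq_iff PiE_iff extensional_def intro!: nth_equalityI)
  finally show ?thesis .
qed

section \<open>Multiplication by elementary symmetric functions\<close>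

definition esym :: "nat \<Rightarrow> nat \<Rightarrow> (nat \<Rightarrow> complex) \<Rightarrow> complex" where
  "esym N k x = (\<Sum>D\<in>Pow {..<N}. of_bool (card D = k) * (\<Prod>i\<in>D. x i))"

definition raise_on :: "nat \<Rightarrow> (nat \<Rightarrow> nat) \<Rightarrow> nat set \<Rightarrow> nat \<Rightarrow> nat" where
  "raise_on N \<alpha> D = (\<lambda>i\<in>{..<N}. \<alpha> i + of_bool (i \<in> D))"

definition lower_on :: "nat \<Rightarrow> (nat \<Rightarrow> nat) \<Rightarrow> nat set \<Rightarrow> nat \<Rightarrow> nat" where
  "lower_on N \<beta> D = (\<lambda>i\<in>{..<N}. \<beta> i - of_bool (i \<in> D))"

definition support :: "nat \<Rightarrow> (nat \<Rightarrow> nat) \<Rightarrow> nat set" where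
  "support N \<beta> = {i. i < N \<and> \<beta> i \<noteq> 0}"

lemma pair_weight_blocks:
  assumes "finite V" "\<And>v. v \<in> V \<Longrightarrow> finite (I v)" "\<And>v. v \<in> V \<Longrightarrow> finite (J v)"
    "\<And>v w. v \<in> V \<Longrightarrow> w \<in> V \<Longrightarrow> v \<noteq> w \<Longrightarrow> I v \<inter> I w = {}"
  shows "pair_weight x t (\<Union>v\<in>V. I v \<times> J v) = (\<Prod>v\<in>V. cross_weight x t (I v) (J v))"
  unfolding pair_weight_def cross_weight_def prod.cartesian_product
  using assms by (intro prod.UNION_disjoint) blast+

text \<open>Raising on \<open>D\<close> changes the comparison only for pairs with exactly one index
  in \<open>D\<close>. Ties with \<open>i\<close> in \<open>D\<close> become strict, and strict
  inequalities of gap one with \<open>j\<close> in \<open>D\<close> become ties. Hence the ordered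
  pairs together with the ties before raising form the same set as the ordered pairs together with
  the opposite ties afterwards.\<close>

lemma hl_term_raise:
  assumes "D \<subseteq> {..<N}"
  shows "hl_term N x t \<alpha> * ((\<Prod>i\<in>D. x i) * pair_weight x t {(i, j). i \<in> D \<and> j \<in> {..<N} - D \<and> \<alpha> i = \<alpha> j}) =
    hl_term N x t (raise_on N \<alpha> D) *
      pair_weight x t {(i, j). i \<in> {..<N} - D \<and> j \<in> D \<and> raise_on N \<alpha> D i = raise_on N \<alpha> D j}"
proof -
  let ?\<beta> = "raise_on N \<alpha> D"
  let ?R1 = "{(i, j). i < N \<and> j < N \<and> \<alpha> i > \<alpha> j}" and ?R2 = "{(i, j). i \<in> D \<and> j \<in> {..<N} - D \<and> \<alpha> i = \<alpha> j}"
  let ?R3 = "{(i, j). i < N \<and> j < N \<and> ?\<beta> i > ?\<beta> j}" and ?R4 = "{(i, j). i \<in> {..<N} - D \<and> j \<in> D \<and> ?\<beta> i = ?\<beta> j}"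
  have fin: "finite R" if "R \<subseteq> {..<N} \<times> {..<N}" for R :: "(nat \<times> nat) set"
    using that finite_subset by blast
  have "pair_weight x t ?R1 * pair_weight x t ?R2 = pair_weight x t (?R1 \<union> ?R2)"
    unfolding pair_weight_def by (rule prod.union_disjoint[symmetric]) (use assms in \<open>auto intro!: fin\<close>)
  also have "?R1 \<union> ?R2 = ?R3 \<union> ?R4"
    using assms by (auto simp: raise_on_def split: if_splits)
  also have "pair_weight x t (?R3 \<union> ?R4) = pair_weight x t ?R3 * pair_weight x t ?R4"
    unfolding pair_weight_def by (rule prod.union_disjoint) (use assms in \<open>auto intro!: fin\<close>)
  finally have 1: "pair_weight x t ?R1 * pair_weight x t ?R2 = pair_weight x t ?R3 * pair_weight x t ?R4" .
  have "(\<Prod>i<N. x i ^ ?\<beta> i) = (\<Prod>i<N. x i ^ \<alpha> i * (if i \<in> D then x i else 1))"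
    by (rule prod.cong) (auto simp: raise_on_def)
  also have "\<dots> = (\<Prod>i<N. x i ^ \<alpha> i) * (\<Prod>i\<in>D. x i)"
    using assms by (simp add: prod.distrib prod.If_cases Int_absorb1)
  finally have 2: "(\<Prod>i<N. x i ^ ?\<beta> i) = (\<Prod>i<N. x i ^ \<alpha> i) * (\<Prod>i\<in>D. x i)" .
  show ?thesis
    unfolding hl_term_def 2 using 1 by (simp add: mult_ac)
qed

text \<open>The number \<open>d v\<close> counts the entries \<open>v\<close> of a vector of shape \<open>\<nu>\<close> which are lowered to
  \<open>v - 1\<close> in order to obtain a vector of shape \<open>\<mu>\<close>.\<close>

definition pieri_coeff :: "'a::comm_ring_1 \<Rightarrow> nat \<Rightarrow> nat list \<Rightarrow> nat list \<Rightarrow> 'a" where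
  "pieri_coeff t k \<nu> \<mu> = (\<Sum>d\<in>PiE {1..sum_list \<nu> + 2} (\<lambda>v. {..count (mset \<nu>) v}).
     of_bool ((\<Sum>v\<in>{1..sum_list \<nu> + 2}. d v) = k \<and>
        (\<forall>v\<ge>1. count (mset \<mu>) v + (if v \<le> sum_list \<nu> + 2 then d v else 0) =
           count (mset \<nu>) v + (if Suc v \<le> sum_list \<nu> + 2 then d (Suc v) else 0))) *
     (\<Prod>v\<in>{1..sum_list \<nu> + 2}. qbinom t (count (mset \<nu>) v) (count (mset \<nu>) v - d v)))"

text \<open>The tie weights factor over the level sets of \<beta>, and whether lowering produces the
  shape \<mu> depends only on how many indices of each level are lowered;
  \<open>sum_cross_weight_blocks\<close> applies. The value depends on \<beta> through \<nu> alone,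
  which is what lets \<open>P\<close> of \<nu> be factored out.\<close>

lemma pieri_inner_sum:
  assumes "inj_on x {..<N}" "is_partition \<mu>" "\<beta> \<in> vectors N \<nu>"
  shows "(\<Sum>D | D \<subseteq> support N \<beta> \<and> card D = k \<and> shape N (lower_on N \<beta> D) = \<mu>.
     pair_weight x t {(i, j). i \<in> {..<N} - D \<and> j \<in> D \<and> \<beta> i = \<beta> j}) = pieri_coeff t k \<nu> \<mu>"
proof -
  define M where "M = sum_list \<nu> + 2"
  define B where "B v = {i. i < N \<and> \<beta> i = v}" for v
  define F where "F d = (of_bool ((\<Sum>v\<in>{1..M}. d v) = k \<and>
        (\<forall>v\<ge>1. count (mset \<mu>) v + (if v \<le> M then d v else 0) =
           count (mset \<nu>) v + (if Suc v \<le> M then d (Suc v) else 0))) :: complex)" for d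
  have sh: "shape N \<beta> = \<nu>" using assms(3) by (simp add: vectors_def)
  have cB: "card (B v) = count (mset \<nu>) v" if "v \<ge> 1" for v
    using count_shape[OF that, of N \<beta>] by (simp add: sh B_def)
  have le: "\<beta> i < M" if "i < N" for i
  proof -
    have "\<beta> i \<le> (\<Sum>i<N. \<beta> i)" using that by (intro member_le_sum) auto
    then show ?thesis using vectors_weight[OF assms(3)] by (simp add: M_def)
  qed
  have fB: "finite (B v)" for v by (simp add: B_def)
  have U: "support N \<beta> = (\<Union>v\<in>{1..M}. B v)"
    using le by (fastforce simp: support_def B_def less_imp_le)
  have fS: "finite (support N \<beta>)" by (simp add: support_def)
  have disj: "disjoint_family_on B {1..M}" by (auto simp: disjoint_family_on_def B_def)
  have weight: "pair_weight x t {(i, j). i \<in> {..<N} - D \<and> j \<in> D \<and> \<beta> i = \<beta> j} =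
      (\<Prod>v\<in>{1..M}. cross_weight x t (B v - D) (D \<inter> B v))" if "D \<subseteq> support N \<beta>" for D
  proof -
    have "{(i, j). i \<in> {..<N} - D \<and> j \<in> D \<and> \<beta> i = \<beta> j} = (\<Union>v\<in>{1..M}. (B v - D) \<times> (D \<inter> B v))"
      using that le by (fastforce simp: support_def B_def less_imp_le)
    then show ?thesis
      by (simp only:) (rule pair_weight_blocks; auto simp: B_def)
  qed
  have cond: "of_bool (card D = k \<and> shape N (lower_on N \<beta> D) = \<mu>) = F (\<lambda>v\<in>{1..M}. card (D \<inter> B v))"
    if D: "D \<subseteq> support N \<beta>" for D
  proof -
    have fD: "finite D" using D fS finite_subset by blast
    have "D = (\<Union>v\<in>{1..M}. D \<inter> B v)" using D U by blast
    then have "card D = card (\<Union>v\<in>{1..M}. D \<inter> B v)" by simp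
    also have "\<dots> = (\<Sum>v\<in>{1..M}. card (D \<inter> B v))"
      by (rule card_UN_disjoint) (auto simp: B_def)
    finally have 1: "card D = (\<Sum>v\<in>{1..M}. card (D \<inter> B v))" .
    \<comment> \<open>Level \<open>v\<close> loses the indices lowered to \<open>v - 1\<close> and
      gains those lowered from \<open>v + 1\<close>.\<close>
    have 2: "card {i. i < N \<and> lower_on N \<beta> D i = v} + card (D \<inter> B v) = card (B v) + card (D \<inter> B (Suc v))" for v
    proof -
      have "{i. i < N \<and> lower_on N \<beta> D i = v} = (B v - D) \<union> (D \<inter> B (Suc v))"
        using D by (auto simp: lower_on_def B_def support_def split: if_splits)
      moreover have "card ((B v - D) \<union> (D \<inter> B (Suc v))) = card (B v - D) + card (D \<inter> B (Suc v))"
        by (rule card_Un_disjoint) (auto simp: B_def)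
      moreover have "card (B v) = card (B v - D) + card (D \<inter> B v)"
        by (subst card_Un_disjoint[symmetric]) (auto simp: fB fD intro: arg_cong[of _ _ card])
      ultimately show ?thesis by simp
    qed
    have 3: "D \<inter> B v = {}" if "M < v" for v using le that D by (force simp: B_def support_def)
    have d: "(if v \<le> M then (\<lambda>v\<in>{1..M}. card (D \<inter> B v)) v else 0) = card (D \<inter> B v)" if "v \<ge> 1" for v
      using that 3 by auto
    let ?d = "\<lambda>v\<in>{1..M}. card (D \<inter> B v)"
    have 4: "(card {i. i < N \<and> lower_on N \<beta> D i = v} = count (mset \<mu>) v) \<longleftrightarrow>
        (count (mset \<mu>) v + (if v \<le> M then ?d v else 0) =
           count (mset \<nu>) v + (if Suc v \<le> M then ?d (Suc v) else 0))" if v: "v \<ge> 1" for v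
      unfolding d[OF v] d[OF le_SucI[OF v]] using 2[of v] cB[OF v] by linarith
    have 5: "(shape N (lower_on N \<beta> D) = \<mu>) \<longleftrightarrow>
      (\<forall>v\<ge>1. count (mset \<mu>) v + (if v \<le> M then ?d v else 0) =
           count (mset \<nu>) v + (if Suc v \<le> M then ?d (Suc v) else 0))"
      unfolding shape_eq_iff[OF assms(2)] using 4 by blast
    have "(\<Sum>v\<in>{1..M}. ?d v) = (\<Sum>v\<in>{1..M}. card (D \<inter> B v))"
      by (rule sum.cong) auto
    then show ?thesis
      unfolding F_def 5 1 by simp
  qed
  have "(\<Sum>D | D \<subseteq> support N \<beta> \<and> card D = k \<and> shape N (lower_on N \<beta> D) = \<mu>.
     pair_weight x t {(i, j). i \<in> {..<N} - D \<and> j \<in> D \<and> \<beta> i = \<beta> j}) =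
     (\<Sum>D\<in>Pow (support N \<beta>). of_bool (card D = k \<and> shape N (lower_on N \<beta> D) = \<mu>) *
       pair_weight x t {(i, j). i \<in> {..<N} - D \<and> j \<in> D \<and> \<beta> i = \<beta> j})"
    using fS by (intro sum.mono_neutral_cong_left) auto
  also have "\<dots> = (\<Sum>D\<in>Pow (\<Union>v\<in>{1..M}. B v). F (\<lambda>v\<in>{1..M}. card (D \<inter> B v)) *
      (\<Prod>v\<in>{1..M}. cross_weight x t (B v - D) (D \<inter> B v)))"
    unfolding U[symmetric] by (rule sum.cong[OF refl]) (simp only: cond weight Pow_iff)
  also have "\<dots> = (\<Sum>d\<in>PiE {1..M} (\<lambda>v. {..card (B v)}). F d * (\<Prod>v\<in>{1..M}. qbinom t (card (B v)) (card (B v) - d v)))"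
    by (rule sum_cross_weight_blocks[OF _ fB disj])
       (auto simp: B_def intro: inj_on_subset[OF assms(1)])
  also have "\<dots> = pieri_coeff t k \<nu> \<mu>"
  proof -
    have "PiE {1..M} (\<lambda>v. {..card (B v)}) = PiE {1..M} (\<lambda>v. {..count (mset \<nu>) v})"
      by (rule PiE_cong) (simp add: cB)
    moreover have "(\<Prod>v\<in>{1..M}. qbinom t (card (B v)) (card (B v) - d v)) =
       (\<Prod>v\<in>{1..M}. qbinom t (count (mset \<nu>) v) (count (mset \<nu>) v - d v))" for d
      by (rule prod.cong) (simp_all add: cB)
    ultimately show ?thesis
      unfolding pieri_coeff_def F_def M_def by (simp only:)
  qed
  finally show ?thesis .
qed

text \<open>Each term of \<open>P\<close> is multiplied by its own weighted form of
  \<open>esym\<close>, \<open>hl_term_raise\<close> turns the product into a term for the raised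
  vector, and the pairs (vector, raised set) are then sorted by the raised vector.\<close>

lemma esym_mult_hall_littlewood_P:
  assumes inj: "inj_on x {..<N}" and \<mu>: "is_partition \<mu>"
  shows "esym N k x * hall_littlewood_P N x t \<mu> =
    (\<Sum>\<nu>\<in>partitions_of (sum_list \<mu> + k). pieri_coeff t k \<nu> \<mu> * hall_littlewood_P N x t \<nu>)"
proof -
  let ?E = "\<lambda>\<alpha> D. pair_weight x t {(i, j). i \<in> D \<and> j \<in> {..<N} - D \<and> \<alpha> i = \<alpha> j}"
  let ?E' = "\<lambda>\<beta> D. pair_weight x t {(i, j). i \<in> {..<N} - D \<and> j \<in> D \<and> \<beta> i = \<beta> j}"
  \<comment> \<open>The left side is free of \<alpha>, but it may carry the tie weights of any
    chosen \<alpha>; these are exactly the factors that \<open>hl_term_raise\<close>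
    consumes.\<close>
  have e: "esym N k x = (\<Sum>D | D \<subseteq> {..<N} \<and> card D = k. (\<Prod>i\<in>D. x i) * ?E \<alpha> D)" for \<alpha> :: "nat \<Rightarrow> nat"
  proof -
    define B where "B v = {i. i < N \<and> \<alpha> i = v}" for v
    have fB: "finite (B v)" for v by (simp add: B_def)
    have "?E \<alpha> D = (\<Prod>v\<in>\<alpha> ` {..<N}. cross_weight x t (D \<inter> B v) (B v - D))" if "D \<in> Pow {..<N}" for D
    proof -
      have "{(i, j). i \<in> D \<and> j \<in> {..<N} - D \<and> \<alpha> i = \<alpha> j} = (\<Union>v\<in>\<alpha> ` {..<N}. (D \<inter> B v) \<times> (B v - D))"
      proof (intro equalityI subsetI)
        fix p assume "p \<in> {(i, j). i \<in> D \<and> j \<in> {..<N} - D \<and> \<alpha> i = \<alpha> j}"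
        then obtain i j where p: "p = (i, j)" "i \<in> D" "j < N" "j \<notin> D" "\<alpha> i = \<alpha> j" by blast
        then have "i < N" using that by blast
        then show "p \<in> (\<Union>v\<in>\<alpha> ` {..<N}. (D \<inter> B v) \<times> (B v - D))"
          using p by (intro UN_I[of "\<alpha> i"]) (simp_all add: B_def)
      next
        fix p assume "p \<in> (\<Union>v\<in>\<alpha> ` {..<N}. (D \<inter> B v) \<times> (B v - D))"
        then show "p \<in> {(i, j). i \<in> D \<and> j \<in> {..<N} - D \<and> \<alpha> i = \<alpha> j}"
          by (elim UN_E SigmaE) (simp add: B_def)
      qed
      moreover have "pair_weight x t (\<Union>v\<in>\<alpha> ` {..<N}. (D \<inter> B v) \<times> (B v - D)) =
          (\<Prod>v\<in>\<alpha> ` {..<N}. cross_weight x t (D \<inter> B v) (B v - D))"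
      proof (rule pair_weight_blocks)
        show "D \<inter> B v \<inter> (D \<inter> B w) = {}" if "v \<noteq> w" for v w
          using that unfolding B_def by blast
      qed (simp_all add: fB)
      ultimately show ?thesis by (simp only:)
    qed
    moreover have "esym N k x = (\<Sum>D\<in>Pow {..<N}. of_bool (card D = k) * (\<Prod>i\<in>D. x i) *
       (\<Prod>v\<in>\<alpha> ` {..<N}. cross_weight x t (D \<inter> B v) (B v - D)))"
      unfolding esym_def
    proof (rule sum_prod_cross_weight_blocks[symmetric, where c = "\<lambda>j. of_bool (j = k)"])
      show "disjoint_family_on B (\<alpha> ` {..<N})" unfolding disjoint_family_on_def B_def by blast
      show "B v \<subseteq> {..<N}" for v unfolding B_def by blast
    qed (use inj in simp_all)
    ultimately have "esym N k x = (\<Sum>D\<in>Pow {..<N}. of_bool (card D = k) * (\<Prod>i\<in>D. x i) * ?E \<alpha> D)"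
      by (simp only: cong: sum.cong)
    also have "\<dots> = (\<Sum>D | D \<subseteq> {..<N} \<and> card D = k. (\<Prod>i\<in>D. x i) * ?E \<alpha> D)"
      by (rule sum.mono_neutral_cong_right) auto
    finally show ?thesis .
  qed
  let ?S1 = "SIGMA \<alpha>:vectors N \<mu>. {D. D \<subseteq> {..<N} \<and> card D = k}"
  let ?T = "\<lambda>\<beta>. {D. D \<subseteq> support N \<beta> \<and> card D = k \<and> shape N (lower_on N \<beta> D) = \<mu>}"
  let ?W = "{\<beta> \<in> {..<N} \<rightarrow>\<^sub>E UNIV. (\<Sum>i<N. \<beta> i) = sum_list \<mu> + k}"
  have raise_lower: "raise_on N (lower_on N \<beta> D) D = \<beta>" if "\<beta> \<in> {..<N} \<rightarrow>\<^sub>E UNIV" "D \<subseteq> support N \<beta>" for \<beta> D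
    using that by (auto simp: raise_on_def lower_on_def support_def PiE_iff extensional_def fun_eq_iff)
  have lower_raise: "lower_on N (raise_on N \<alpha> D) D = \<alpha>" if "\<alpha> \<in> {..<N} \<rightarrow>\<^sub>E UNIV" for \<alpha> D
    using that by (auto simp: raise_on_def lower_on_def support_def PiE_iff extensional_def fun_eq_iff)
  have ext: "lower_on N \<beta> D \<in> {..<N} \<rightarrow>\<^sub>E UNIV" "raise_on N \<beta> D \<in> {..<N} \<rightarrow>\<^sub>E UNIV" for \<beta> D
    by (auto simp: raise_on_def lower_on_def)
  have supp: "D \<subseteq> support N (raise_on N \<alpha> D)" if "D \<subseteq> {..<N}" for \<alpha> D
    using that by (auto simp: raise_on_def support_def)
  have weight: "(\<Sum>i<N. raise_on N \<alpha> D i) = (\<Sum>i<N. \<alpha> i) + card D" if "D \<subseteq> {..<N}" for \<alpha> D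
  proof -
    have "(\<Sum>i<N. raise_on N \<alpha> D i) = (\<Sum>i<N. \<alpha> i + (if i \<in> D then 1 else 0))"
      by (rule sum.cong) (auto simp: raise_on_def)
    then show ?thesis using that by (simp add: sum.distrib sum.If_cases Int_absorb1)
  qed
  have "esym N k x * hall_littlewood_P N x t \<mu> =
    (\<Sum>\<alpha>\<in>vectors N \<mu>. \<Sum>D | D \<subseteq> {..<N} \<and> card D = k. hl_term N x t \<alpha> * ((\<Prod>i\<in>D. x i) * ?E \<alpha> D))"
    unfolding hall_littlewood_P_eq[OF \<mu>] sum_distrib_left[of "esym N k x"]
    by (rule sum.cong[OF refl], unfold sum_distrib_left[symmetric] e[symmetric]) (rule mult.commute)
  also have "\<dots> = (\<Sum>(\<alpha>, D)\<in>?S1. hl_term N x t \<alpha> * ((\<Prod>i\<in>D. x i) * ?E \<alpha> D))"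
    by (subst sum.Sigma) auto
  \<comment> \<open>Raised entries are positive, so \<open>D\<close> lies in the support of \<beta>,
    and there the truncated subtraction in \<open>lower_on\<close> really undoes the
    raising.\<close>
  also have "\<dots> = (\<Sum>(\<beta>, D)\<in>Sigma ?W ?T. hl_term N x t \<beta> * ?E' \<beta> D)"
  proof (rule sum.reindex_bij_witness[of _ "\<lambda>(\<beta>, D). (lower_on N \<beta> D, D)" "\<lambda>(\<alpha>, D). (raise_on N \<alpha> D, D)"], goal_cases)
    case (1 a)
    then show ?case by (auto simp: lower_raise vectors_def)
  next
    case (2 a)
    then obtain \<alpha> D where a: "a = (\<alpha>, D)" "\<alpha> \<in> vectors N \<mu>" "D \<subseteq> {..<N}" "card D = k" by blast
    have \<alpha>: "\<alpha> \<in> {..<N} \<rightarrow>\<^sub>E UNIV" "shape N \<alpha> = \<mu>" using a(2) unfolding vectors_def by blast+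
    have "raise_on N \<alpha> D \<in> ?W"
      using ext(2) weight[OF a(3), of \<alpha>] vectors_weight[OF a(2)] a(4) by simp
    moreover have "D \<in> ?T (raise_on N \<alpha> D)"
      using supp[OF a(3)] a(4) \<alpha> by (simp add: lower_raise)
    ultimately show ?case by (simp add: a(1))
  next
    case (3 a)
    then obtain \<beta> D where a: "a = (\<beta>, D)" "\<beta> \<in> {..<N} \<rightarrow>\<^sub>E UNIV" "D \<subseteq> support N \<beta>" by blast
    then show ?case by (simp add: raise_lower)
  next
    case (4 a)
    then obtain \<beta> D where a: "a = (\<beta>, D)" "D \<subseteq> support N \<beta>" "card D = k" "shape N (lower_on N \<beta> D) = \<mu>" by blast
    moreover have "D \<subseteq> {..<N}" using a(2) by (auto simp: support_def)
    ultimately show ?case using ext(1)[of \<beta> D] by (simp add: vectors_def)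
  next
    case (5 a)
    then obtain \<alpha> D where a: "a = (\<alpha>, D)" "D \<subseteq> {..<N}" by blast
    show ?case unfolding a(1) prod.case by (rule hl_term_raise[OF a(2), symmetric])
  qed
  also have "\<dots> = (\<Sum>\<beta>\<in>?W. hl_term N x t \<beta> * (\<Sum>D\<in>?T \<beta>. ?E' \<beta> D))"
    unfolding sum_distrib_left
    by (subst sum.Sigma) (auto simp: finite_weight_vectors support_def)
  also have "\<dots> = (\<Sum>\<nu>\<in>partitions_of (sum_list \<mu> + k). \<Sum>\<beta>\<in>vectors N \<nu>. hl_term N x t \<beta> * (\<Sum>D\<in>?T \<beta>. ?E' \<beta> D))"
    by (rule sum_vectors_partitions)
  also have "\<dots> = (\<Sum>\<nu>\<in>partitions_of (sum_list \<mu> + k). pieri_coeff t k \<nu> \<mu> * hall_littlewood_P N x t \<nu>)"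
  proof (rule sum.cong[OF refl])
    fix \<nu> assume "\<nu> \<in> partitions_of (sum_list \<mu> + k)"
    then have "is_partition \<nu>" by (simp add: partitions_of_iff)
    then show "(\<Sum>\<beta>\<in>vectors N \<nu>. hl_term N x t \<beta> * (\<Sum>D\<in>?T \<beta>. ?E' \<beta> D)) = pieri_coeff t k \<nu> \<mu> * hall_littlewood_P N x t \<nu>"
      unfolding hall_littlewood_P_eq[OF \<open>is_partition \<nu>\<close>] sum_distrib_left[of "pieri_coeff t k \<nu> \<mu>"]
      by (intro sum.cong refl) (simp only: pieri_inner_sum[OF inj \<mu>] mult.commute)
  qed
  finally show ?thesis .
qed

section \<open>Schur functions\<close>

definition part :: "nat list \<Rightarrow> nat \<Rightarrow> nat" where
  "part \<mu> i = (if i < length \<mu> then \<mu> ! i else 0)"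

definition to_partition :: "(nat \<Rightarrow> nat) \<Rightarrow> nat list" where
  "to_partition f = map f [0..<LEAST l. f l = 0]"

lemma part_antimono:
  assumes "is_partition \<mu>" "i \<le> j"
  shows "part \<mu> j \<le> part \<mu> i"
proof (cases "i = j")
  case False
  then have "i < j" using assms by simp
  then show ?thesis
    using assms(1) by (auto simp: part_def is_partition_def sorted_wrt_iff_nth_less)
qed simp

lemma part_eq_0_iff:
  assumes "is_partition \<mu>"
  shows "part \<mu> i = 0 \<longleftrightarrow> length \<mu> \<le> i"
proof (cases "i < length \<mu>")
  case True
  then have "\<mu> ! i \<in> set \<mu>" by simp
  then have "\<mu> ! i \<noteq> 0" using assms unfolding is_partition_def by metis
  then show ?thesis using True by (simp add: part_def)
qed (simp add: part_def)

lemma part_eqI: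
  assumes "is_partition \<mu>" "is_partition \<nu>" "\<And>i. part \<mu> i = part \<nu> i"
  shows "\<mu> = \<nu>"
proof (rule nth_equalityI)
  show l: "length \<mu> = length \<nu>"
    using part_eq_0_iff[OF assms(1)] part_eq_0_iff[OF assms(2)] assms(3)
    by (metis le_antisym le_refl)
  show "\<mu> ! i = \<nu> ! i" if "i < length \<mu>" for i
    using assms(3)[of i] that l by (simp add: part_def)
qed

lemma sum_list_eq_sum_part:
  assumes "length \<mu> \<le> L"
  shows "sum_list \<mu> = (\<Sum>i<L. part \<mu> i)"
proof -
  have "sum_list \<mu> = (\<Sum>i<length \<mu>. part \<mu> i)"
    by (simp add: sum_list_sum_nth atLeast0LessThan part_def)
  also have "\<dots> = (\<Sum>i<L. part \<mu> i)"
    using assms by (intro sum.mono_neutral_left) (auto simp: part_def)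
  finally show ?thesis .
qed

lemma to_partition:
  assumes anti: "\<And>i. f (Suc i) \<le> f i" and z: "f L = 0"
  shows "is_partition (to_partition f)" "part (to_partition f) i = f i"
proof -
  define l where "l = (LEAST l. f l = 0)"
  have am: "f j \<le> f i" if "i \<le> j" for i j
    using lift_Suc_antimono_le[of f, OF anti that] .
  have l0: "f l = 0" unfolding l_def by (rule LeastI[of "\<lambda>l. f l = 0", OF z])
  have pos: "f i \<noteq> 0" if "i < l" for i
    using not_less_Least[of i "\<lambda>l. f l = 0"] that by (auto simp: l_def)
  have z0: "f i = 0" if "l \<le> i" for i using am[OF that] l0 by simp
  show "is_partition (to_partition f)"
    unfolding is_partition_def to_partition_def l_def[symmetric] sorted_wrt_map
  proof
    show "sorted_wrt (\<lambda>i j. f j \<le> f i) [0..<l]" by (auto simp: sorted_wrt_iff_nth_less am)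
    show "0 \<notin> set (map f [0..<l])"
    proof
      assume "0 \<in> set (map f [0..<l])"
      then obtain i where "i < l" "f i = 0" by auto
      then show False using pos by blast
    qed
  qed
  show "part (to_partition f) i = f i"
    unfolding part_def to_partition_def l_def[symmetric] using z0 by auto
qed

text \<open>The skew shape \<nu>/\<kappa> is a horizontal strip, expressed by interlacing of the
  parts.\<close>

definition strip :: "nat list \<Rightarrow> nat list \<Rightarrow> bool" where
  "strip \<kappa> \<nu> \<longleftrightarrow> (\<forall>i. part \<kappa> i \<le> part \<nu> i \<and> part \<nu> (Suc i) \<le> part \<kappa> i)"

definition inner_strips :: "nat list \<Rightarrow> nat list set" where
  "inner_strips \<nu> = {\<kappa>. is_partition \<kappa> \<and> strip \<kappa> \<nu>}"

definition outer_strips :: "nat list \<Rightarrow> nat \<Rightarrow> nat list set" where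
  "outer_strips \<kappa> k = {\<nu> \<in> partitions_of (sum_list \<kappa> + k). strip \<kappa> \<nu>}"

lemma strip_sum_list_le:
  assumes "strip \<kappa> \<nu>"
  shows "sum_list \<kappa> \<le> sum_list \<nu>"
proof -
  have "sum_list \<kappa> = (\<Sum>i<max (length \<kappa>) (length \<nu>). part \<kappa> i)" by (rule sum_list_eq_sum_part) simp
  also have "\<dots> \<le> (\<Sum>i<max (length \<kappa>) (length \<nu>). part \<nu> i)"
    using assms by (intro sum_mono) (simp add: strip_def)
  also have "\<dots> = sum_list \<nu>" by (rule sum_list_eq_sum_part[symmetric]) simp
  finally show ?thesis .
qed

lemma finite_inner_strips [simp]: "finite (inner_strips \<nu>)"
proof (rule finite_subset)
  show "inner_strips \<nu> \<subseteq> (\<Union>k\<le>sum_list \<nu>. partitions_of k)"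
    using strip_sum_list_le by (auto simp: inner_strips_def partitions_of_iff)
qed simp

lemma finite_outer_strips [simp]: "finite (outer_strips \<kappa> k)"
  by (simp add: outer_strips_def)

lemma diagram_iff: "(i, j) \<in> diagram \<mu> \<longleftrightarrow> j < part \<mu> i"
  by (simp add: diagram_def part_def)

lemma diagram_eq_Sigma: "diagram \<mu> = (SIGMA i:{..<length \<mu>}. {..<\<mu> ! i})"
  by (auto simp: diagram_def)

lemma finite_diagram [simp]: "finite (diagram \<mu>)"
  by (simp add: diagram_eq_Sigma)

lemma card_diagram: "card (diagram \<mu>) = sum_list \<mu>"
  by (simp add: diagram_eq_Sigma sum_list_sum_nth atLeast0LessThan)

lemma ssyt_row_mono:
  assumes "T \<in> ssyt N \<mu>" "j \<le> j'" "(i, j') \<in> diagram \<mu>"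
  shows "T (i, j) \<le> T (i, j')"
  using assms(2,3)
proof (induction j' rule: dec_induct)
  case (step m)
  then have "(i, m) \<in> diagram \<mu>" by (simp add: diagram_iff)
  moreover have "T (i, m) \<le> T (i, Suc m)" using assms(1) step.prems by (simp add: ssyt_def)
  ultimately show ?case using step.IH by linarith
qed simp

lemma finite_ssyt [simp]: "finite (ssyt N \<mu>)"
  by (rule finite_subset[of _ "diagram \<mu> \<rightarrow>\<^sub>E {..<N}"]) (auto simp: ssyt_def intro: finite_PiE)

definition small_part :: "nat \<Rightarrow> nat list \<Rightarrow> (nat \<times> nat \<Rightarrow> nat) \<Rightarrow> nat \<Rightarrow> nat" where
  "small_part N \<nu> T i = card {j. j < part \<nu> i \<and> T (i, j) < N}"

definition small_shape :: "nat \<Rightarrow> nat list \<Rightarrow> (nat \<times> nat \<Rightarrow> nat) \<Rightarrow> nat list" where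
  "small_shape N \<nu> T = to_partition (small_part N \<nu> T)"

definition extend_tableau :: "nat \<Rightarrow> nat list \<Rightarrow> nat list \<Rightarrow> (nat \<times> nat \<Rightarrow> nat) \<Rightarrow> nat \<times> nat \<Rightarrow> nat" where
  "extend_tableau N \<nu> \<kappa> T = (\<lambda>c\<in>diagram \<nu>. if c \<in> diagram \<kappa> then T c else N)"

lemma down_closed_eq_lessThan:
  fixes S :: "nat set"
  assumes "finite S" "\<And>j j'. j' \<in> S \<Longrightarrow> j \<le> j' \<Longrightarrow> j \<in> S"
  shows "S = {..<card S}"
proof -
  define m where "m = (LEAST m. m \<notin> S)"
  obtain m' where "m' \<notin> S" using ex_new_if_finite[OF _ assms(1)] by auto
  then have m: "m \<notin> S" unfolding m_def by (rule LeastI)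
  have "i \<in> S \<longleftrightarrow> i < m" for i
    using m assms(2)[of i m] not_less_Least[of i "\<lambda>m. m \<notin> S"] unfolding m_def[symmetric] by (meson linorder_not_less)
  then have "S = {..<m}" by auto
  then show ?thesis by simp
qed

lemma small_shape:
  assumes \<nu>: "is_partition \<nu>" and T: "T \<in> ssyt (Suc N) \<nu>"
  shows "small_shape N \<nu> T \<in> inner_strips \<nu>"
    and "(i, j) \<in> diagram (small_shape N \<nu> T) \<longleftrightarrow> (i, j) \<in> diagram \<nu> \<and> T (i, j) < N"
proof -
  have set_eq: "{j. j < part \<nu> i \<and> T (i, j) < N} = {..<small_part N \<nu> T i}" for i
  proof -
    have "j \<in> {j. j < part \<nu> i \<and> T (i, j) < N}"
      if "j' \<in> {j. j < part \<nu> i \<and> T (i, j) < N}" "j \<le> j'" for j j'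
      using ssyt_row_mono[OF T that(2), of i] that by (auto simp: diagram_iff)
    then show ?thesis unfolding small_part_def by (intro down_closed_eq_lessThan) simp_all
  qed
  have iff: "j < small_part N \<nu> T i \<longleftrightarrow> j < part \<nu> i \<and> T (i, j) < N" for i j
    using set_eq[of i] by auto
  have le: "small_part N \<nu> T i \<le> part \<nu> i" for i
    using iff[of "part \<nu> i" i] by (simp add: not_less)
  \<comment> \<open>Entries are at most \<open>N\<close> and columns increase strictly, so no cell
    can lie below an entry \<open>N\<close>.\<close>
  have ge: "part \<nu> (Suc i) \<le> small_part N \<nu> T i" for i
  proof (rule ccontr)
    assume "\<not> ?thesis"
    then have 1: "small_part N \<nu> T i < part \<nu> (Suc i)" by simp
    let ?j = "small_part N \<nu> T i"
    have "(Suc i, ?j) \<in> diagram \<nu>" using 1 by (simp add: diagram_iff)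
    then have "T (i, ?j) < T (Suc i, ?j)" "T (Suc i, ?j) < Suc N"
      using T by (auto simp: ssyt_def PiE_iff)
    moreover have "?j < part \<nu> i" using 1 part_antimono[OF \<nu>, of i "Suc i"] by simp
    ultimately show False using iff[of ?j i] by simp
  qed
  have anti: "small_part N \<nu> T (Suc i) \<le> small_part N \<nu> T i" for i
    using le[of "Suc i"] ge[of i] by simp
  have z: "small_part N \<nu> T (length \<nu>) = 0" using le[of "length \<nu>"] by (simp add: part_def)
  note tp = to_partition[of "small_part N \<nu> T", OF anti z, folded small_shape_def]
  show "small_shape N \<nu> T \<in> inner_strips \<nu>"
    using tp le ge by (simp add: inner_strips_def strip_def)
  show "(i, j) \<in> diagram (small_shape N \<nu> T) \<longleftrightarrow> (i, j) \<in> diagram \<nu> \<and> T (i, j) < N"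
    by (simp add: diagram_iff tp iff)
qed

lemma strip_diagram:
  assumes "strip \<kappa> \<nu>"
  shows "(i, j) \<in> diagram \<kappa> \<Longrightarrow> (i, j) \<in> diagram \<nu>"
    and "(Suc i, j) \<in> diagram \<nu> \<Longrightarrow> (i, j) \<in> diagram \<kappa>"
  using assms by (auto simp: strip_def diagram_iff intro: less_le_trans)

lemma extend_tableau_ssyt:
  assumes s: "strip \<kappa> \<nu>" and T: "T \<in> ssyt N \<kappa>"
  shows "extend_tableau N \<nu> \<kappa> T \<in> ssyt (Suc N) \<nu>"
proof -
  note sd = strip_diagram[OF s]
  have lt: "T c < N" if "c \<in> diagram \<kappa>" for c using T that by (auto simp: ssyt_def PiE_iff)
  have row: "T (i, j) \<le> T (i, Suc j)" if "(i, Suc j) \<in> diagram \<kappa>" for i j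
    using T that by (simp add: ssyt_def)
  have col: "T (i, j) < T (Suc i, j)" if "(Suc i, j) \<in> diagram \<kappa>" for i j
    using T that by (simp add: ssyt_def)
  have left: "(i, j) \<in> diagram \<mu>" if "(i, Suc j) \<in> diagram \<mu>" for i j \<mu>
    using that by (simp add: diagram_iff)
  let ?T = "extend_tableau N \<nu> \<kappa> T"
  have eq: "?T c = (if c \<in> diagram \<kappa> then T c else N)" if "c \<in> diagram \<nu>" for c
    using that by (simp add: extend_tableau_def)
  have le: "?T c \<le> N" if "c \<in> diagram \<nu>" for c
    using eq[OF that] lt[of c] by (auto simp: less_imp_le)
  show ?thesis unfolding ssyt_def
  proof (intro CollectI conjI allI impI)
    show "?T \<in> diagram \<nu> \<rightarrow>\<^sub>E {..<Suc N}"
      using le by (simp add: PiE_iff less_Suc_eq_le) (simp add: extend_tableau_def)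
  next
    fix i j assume ij: "(i, Suc j) \<in> diagram \<nu>"
    show "?T (i, j) \<le> ?T (i, Suc j)"
    proof (cases "(i, Suc j) \<in> diagram \<kappa>")
      case True
      then show ?thesis using row[OF True] left[OF True] by (simp add: eq ij left[OF ij])
    qed (use le[OF left[OF ij]] in \<open>simp add: eq[OF ij]\<close>)
  next
    fix i j assume ij: "(Suc i, j) \<in> diagram \<nu>"
    have k: "(i, j) \<in> diagram \<kappa>" by (rule sd(2)[OF ij])
    show "?T (i, j) < ?T (Suc i, j)"
      using col[of i j] lt[OF k] k by (auto simp: eq[OF ij] eq[OF sd(1)[OF k]])
  qed
qed

text \<open>Deleting the entries \<open>N\<close> from a tableau leaves a tableau with entries below
  \<open>N\<close>, and the deleted cells form a horizontal strip. Conversely, filling any such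
  strip with \<open>N\<close> gives a tableau.\<close>

lemma schur_branching:
  assumes \<nu>: "is_partition \<nu>"
  shows "schur (Suc N) x \<nu> = (\<Sum>\<kappa>\<in>inner_strips \<nu>. x N ^ (sum_list \<nu> - sum_list \<kappa>) * schur N x \<kappa>)"
proof -
  have "schur (Suc N) x \<nu> = (\<Sum>(\<kappa>, T)\<in>Sigma (inner_strips \<nu>) (ssyt N). x N ^ (sum_list \<nu> - sum_list \<kappa>) * (\<Prod>c\<in>diagram \<kappa>. x (T c)))"
    unfolding schur_def
  proof (rule sum.reindex_bij_witness[of _ "\<lambda>(\<kappa>, T). extend_tableau N \<nu> \<kappa> T"
        "\<lambda>T. (small_shape N \<nu> T, restrict T (diagram (small_shape N \<nu> T)))"], goal_cases)
    case (1 T)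
    have T: "T \<in> extensional (diagram \<nu>)" "\<And>c. c \<in> diagram \<nu> \<Longrightarrow> T c < Suc N"
      using 1 by (auto simp: ssyt_def PiE_iff)
    have "extend_tableau N \<nu> (small_shape N \<nu> T) (restrict T (diagram (small_shape N \<nu> T))) c = T c" for c
    proof (cases "c \<in> diagram \<nu>")
      case True
      then have "c \<in> diagram (small_shape N \<nu> T) \<longleftrightarrow> T c < N"
        using small_shape(2)[OF \<nu> 1, of "fst c" "snd c"] by simp
      then show ?thesis using T(2)[OF True] True by (simp add: extend_tableau_def)
    next
      case False
      then show ?thesis using extensional_arb[OF T(1) False] by (simp add: extend_tableau_def)
    qed
    then show ?case by auto
  next
    case (2 T)
    let ?\<kappa> = "small_shape N \<nu> T"
    have k: "(i, j) \<in> diagram ?\<kappa> \<longleftrightarrow> (i, j) \<in> diagram \<nu> \<and> T (i, j) < N" for i j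
      by (rule small_shape(2)[OF \<nu> 2])
    have kp: "is_partition ?\<kappa>" using small_shape(1)[OF \<nu> 2] by (simp add: inner_strips_def)
    have "restrict T (diagram ?\<kappa>) \<in> ssyt N ?\<kappa>" unfolding ssyt_def
    proof (intro CollectI conjI allI impI)
      show "restrict T (diagram ?\<kappa>) \<in> diagram ?\<kappa> \<rightarrow>\<^sub>E {..<N}"
        using k by (simp add: PiE_iff split_paired_all)
    next
      fix i j assume ij: "(i, Suc j) \<in> diagram ?\<kappa>"
      then have "(i, j) \<in> diagram ?\<kappa>" by (simp add: diagram_iff)
      moreover have "T (i, j) \<le> T (i, Suc j)" using 2 ij k by (simp add: ssyt_def)
      ultimately show "restrict T (diagram ?\<kappa>) (i, j) \<le> restrict T (diagram ?\<kappa>) (i, Suc j)"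
        using ij by simp
    next
      fix i j assume ij: "(Suc i, j) \<in> diagram ?\<kappa>"
      then have "(i, j) \<in> diagram ?\<kappa>"
        using part_antimono[OF kp, of i "Suc i"] by (simp add: diagram_iff)
      moreover have "T (i, j) < T (Suc i, j)" using 2 ij k by (simp add: ssyt_def)
      ultimately show "restrict T (diagram ?\<kappa>) (i, j) < restrict T (diagram ?\<kappa>) (Suc i, j)"
        using ij by simp
    qed
    then show ?case using small_shape(1)[OF \<nu> 2] by simp
  next
    case (3 a)
    then obtain \<kappa> T where a: "a = (\<kappa>, T)" "is_partition \<kappa>" "strip \<kappa> \<nu>" "T \<in> ssyt N \<kappa>"
      by (auto simp: inner_strips_def)
    let ?T = "extend_tableau N \<nu> \<kappa> T"
    have T': "?T \<in> ssyt (Suc N) \<nu>" by (rule extend_tableau_ssyt[OF a(3,4)])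
    have lt: "T c < N" if "c \<in> diagram \<kappa>" for c using a(4) that by (auto simp: ssyt_def PiE_iff)
    have d: "(i, j) \<in> diagram (small_shape N \<nu> ?T) \<longleftrightarrow> (i, j) \<in> diagram \<kappa>" for i j
      unfolding small_shape(2)[OF \<nu> T'] using strip_diagram(1)[OF a(3)] lt
      by (auto simp: extend_tableau_def)
    have "small_shape N \<nu> ?T = \<kappa>"
    proof (rule part_eqI)
      show "part (small_shape N \<nu> ?T) i = part \<kappa> i" for i
        using d[of i] unfolding diagram_iff by (metis linorder_neqE_nat less_irrefl)
    qed (use small_shape(1)[OF \<nu> T'] a in \<open>auto simp: inner_strips_def\<close>)
    moreover have "restrict ?T (diagram \<kappa>) = T"
    proof (rule extensionalityI[of _ "diagram \<kappa>"])
      show "T \<in> extensional (diagram \<kappa>)" using a(4) by (simp add: ssyt_def PiE_iff)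
      show "restrict ?T (diagram \<kappa>) c = T c" if "c \<in> diagram \<kappa>" for c
        using that strip_diagram(1)[OF a(3), of "fst c" "snd c"] by (simp add: extend_tableau_def)
    qed simp
    ultimately show ?case by (simp add: a(1))
  next
    case (4 a)
    then show ?case by (auto simp: inner_strips_def intro: extend_tableau_ssyt)
  next
    case (5 T)
    let ?\<kappa> = "small_shape N \<nu> T"
    have sub: "diagram ?\<kappa> \<subseteq> diagram \<nu>" using small_shape(2)[OF \<nu> 5] by auto
    have "(\<Prod>c\<in>diagram \<nu>. x (T c)) = (\<Prod>c\<in>diagram \<nu> - diagram ?\<kappa>. x (T c)) * (\<Prod>c\<in>diagram ?\<kappa>. x (T c))"
      by (rule prod.subset_diff[OF sub]) simp
    also have "(\<Prod>c\<in>diagram \<nu> - diagram ?\<kappa>. x (T c)) = (\<Prod>c\<in>diagram \<nu> - diagram ?\<kappa>. x N)"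
    proof (rule prod.cong[OF refl])
      fix c assume c: "c \<in> diagram \<nu> - diagram ?\<kappa>"
      then have "T c < Suc N" using 5 by (auto simp: ssyt_def PiE_iff)
      moreover have "\<not> T c < N" using c small_shape(2)[OF \<nu> 5, of "fst c" "snd c"] by simp
      ultimately have "T c = N" by simp
      then show "x (T c) = x N" by simp
    qed
    also have "\<dots> = x N ^ (sum_list \<nu> - sum_list ?\<kappa>)"
      using sub by (simp add: card_Diff_subset card_diagram)
    finally show ?case by simp
  qed
  also have "\<dots> = (\<Sum>\<kappa>\<in>inner_strips \<nu>. x N ^ (sum_list \<nu> - sum_list \<kappa>) * schur N x \<kappa>)"
    unfolding schur_def sum_distrib_left by (subst sum.Sigma) auto
  finally show ?thesis .
qed

lemma schur_0:
  assumes "is_partition \<nu>"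
  shows "schur 0 x \<nu> = of_bool (\<nu> = [])"
proof (cases "\<nu> = []")
  case True
  then have "ssyt 0 \<nu> = {\<lambda>_. undefined}" by (auto simp: ssyt_def diagram_def)
  then show ?thesis using True by (simp add: schur_def diagram_def)
next
  case False
  then have "part \<nu> 0 \<noteq> 0" using part_eq_0_iff[OF assms, of 0] by simp
  then have "(0, 0) \<in> diagram \<nu>" by (simp add: diagram_iff)
  then have "ssyt 0 \<nu> = {}" by (auto simp: ssyt_def PiE_iff)
  then show ?thesis using False by (simp add: schur_def)
qed

section \<open>Complete symmetric functions and the Pieri rule for Schur functions\<close>

fun hsym :: "nat \<Rightarrow> nat \<Rightarrow> (nat \<Rightarrow> complex) \<Rightarrow> complex" where
  "hsym 0 k x = of_bool (k = 0)"
| "hsym (Suc N) k x = (\<Sum>i\<le>k. x N ^ i * hsym N (k - i) x)"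

lemma hsym_0_right [simp]: "hsym N 0 x = 1"
  by (induction N) auto

lemma hsym_Suc_Suc: "hsym (Suc N) (Suc k) x = hsym N (Suc k) x + x N * hsym (Suc N) k x"
  by (simp add: sum.atMost_Suc_shift sum_distrib_left mult.assoc del: sum.atMost_Suc)

lemma esym_0_right [simp]: "esym N 0 x = 1"
proof -
  have "esym N 0 x = (\<Sum>D\<in>{{}}. of_bool (card D = 0) * (\<Prod>i\<in>D. x i))"
    unfolding esym_def
  proof (intro sum.mono_neutral_right ballI)
    fix D assume "D \<in> Pow {..<N} - {{}}"
    then have "finite D" "D \<noteq> {}" using finite_subset[of D "{..<N}"] by auto
    then show "of_bool (card D = 0) * (\<Prod>i\<in>D. x i) = 0" by simp
  qed auto
  then show ?thesis by simp
qed

lemma esym_0_left: "esym 0 k x = of_bool (k = 0)"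
  by (simp add: esym_def)

lemma esym_Suc_Suc: "esym (Suc N) (Suc k) x = esym N (Suc k) x + x N * esym N k x"
proof -
  have "of_bool (card (insert N D) = Suc k) * (\<Prod>i\<in>insert N D. x i) = x N * (of_bool (card D = k) * (\<Prod>i\<in>D. x i))"
    if "D \<in> Pow {..<N}" for D
  proof -
    have "finite D" "N \<notin> D" using that finite_subset[of D "{..<N}"] by auto
    then show ?thesis by simp
  qed
  moreover have "N \<notin> {..<N}" by simp
  ultimately show ?thesis
    unfolding esym_def lessThan_Suc sum_distrib_left
    by (subst sum_Pow_insert) (simp_all only: finite_lessThan not_False_eq_True cong: sum.cong)
qed

text \<open>In generating functions a new variable multiplies the signed elementary series by
  \<open>1 - x N * X\<close> and divides the complete series by the same factor, so their product
  stays 1. The division is stated as a functional equation for \<open>H\<close>.\<close>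

lemma sum_esym_hsym: "(\<Sum>i\<le>k. (- 1) ^ i * esym N i x * hsym N (k - i) x) = of_bool (k = 0)"
proof -
  define E where "E N = Abs_fps (\<lambda>i. (- 1) ^ i * esym N i x)" for N
  define H where "H N = Abs_fps (\<lambda>k. hsym N k x)" for N
  have E: "E (Suc N) = E N - fps_const (x N) * (fps_X * E N)" for N
  proof (rule fps_ext)
    fix k show "fps_nth (E (Suc N)) k = fps_nth (E N - fps_const (x N) * (fps_X * E N)) k"
      by (cases k) (simp_all add: E_def esym_Suc_Suc algebra_simps)
  qed
  have H: "H (Suc N) = H N + fps_const (x N) * (fps_X * H (Suc N))" for N
  proof (rule fps_ext)
    fix k show "fps_nth (H (Suc N)) k = fps_nth (H N + fps_const (x N) * (fps_X * H (Suc N))) k"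
      by (cases k) (simp_all add: H_def hsym_Suc_Suc del: hsym.simps(2))
  qed
  have "E N * H N = 1"
  proof (induction N)
    case 0
    show ?case by (rule fps_ext) (simp add: E_def H_def fps_mult_nth esym_0_left if_distrib sum.delta)
  next
    case (Suc N)
    have "H N = H (Suc N) - fps_const (x N) * (fps_X * H (Suc N))"
      using H[of N] by (simp add: algebra_simps)
    moreover have "E (Suc N) * H (Suc N) = E N * (H (Suc N) - fps_const (x N) * (fps_X * H (Suc N)))"
      unfolding E by (simp add: algebra_simps)
    ultimately show ?case using Suc by metis
  qed
  then have "fps_nth (E N * H N) k = of_bool (k = 0)" by simp
  then show ?thesis
    by (simp add: fps_mult_nth E_def H_def atLeast0AtMost)
qed

text \<open>Maximum and minimum of two parts add up to their sum, so reflecting the intervals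
  preserves the total size except for the surplus \<open>i\<close> placed in the first row.\<close>

lemma flip_size:
  assumes "\<nu>0 = max (part \<kappa> 0) (part \<zeta> 0) + i" "part \<nu> 0 = \<nu>0"
    and "\<And>j. part \<nu> (Suc j) + part \<eta> j = max (part \<kappa> (Suc j)) (part \<zeta> (Suc j)) + min (part \<kappa> j) (part \<zeta> j)"
  shows "sum_list \<nu> + sum_list \<eta> = i + sum_list \<kappa> + sum_list \<zeta>"
proof -
  define L where "L = length \<nu> + length \<eta> + length \<kappa> + length \<zeta>"
  have "sum_list \<nu> + sum_list \<eta> = (\<Sum>j<Suc L. part \<nu> j) + (\<Sum>j<L. part \<eta> j)"
    using sum_list_eq_sum_part[of \<nu> "Suc L"] sum_list_eq_sum_part[of \<eta> L] by (simp add: L_def)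
  also have "\<dots> = part \<nu> 0 + (\<Sum>j<L. part \<nu> (Suc j) + part \<eta> j)"
    unfolding sum.lessThan_Suc_shift by (simp add: sum.distrib)
  also have "\<dots> = i + ((max (part \<kappa> 0) (part \<zeta> 0) + (\<Sum>j<L. max (part \<kappa> (Suc j)) (part \<zeta> (Suc j)))) + (\<Sum>j<L. min (part \<kappa> j) (part \<zeta> j)))"
    unfolding assms by (simp add: sum.distrib)
  also have "max (part \<kappa> 0) (part \<zeta> 0) + (\<Sum>j<L. max (part \<kappa> (Suc j)) (part \<zeta> (Suc j))) = (\<Sum>j<Suc L. max (part \<kappa> j) (part \<zeta> j))"
    by (simp add: sum.lessThan_Suc_shift del: sum.lessThan_Suc)
  also have "\<dots> = (\<Sum>j<L. max (part \<kappa> j) (part \<zeta> j))" by (simp add: L_def part_def)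
  also have "\<dots> + (\<Sum>j<L. min (part \<kappa> j) (part \<zeta> j)) = (\<Sum>j<L. part \<kappa> j) + (\<Sum>j<L. part \<zeta> j)"
    by (simp add: sum.distrib[symmetric] max_def min_def if_distrib add.commute cong: if_cong)
  also have "\<dots> = sum_list \<kappa> + sum_list \<zeta>"
    using sum_list_eq_sum_part[of \<kappa> L] sum_list_eq_sum_part[of \<zeta> L] by (simp add: L_def)
  finally show ?thesis by simp
qed

text \<open>The local rule of the Robinson--Schensted correspondence: the interlacing interval of each
  part is reflected, which exchanges common inner strips and common outer strips of \<open>\<kappa>\<close> and \<open>\<zeta>\<close>.\<close>

definition flip_up :: "nat list \<Rightarrow> nat list \<Rightarrow> nat list \<Rightarrow> nat \<Rightarrow> nat list" where
  "flip_up \<kappa> \<zeta> \<eta> i = to_partition (\<lambda>j. case j of 0 \<Rightarrow> max (part \<kappa> 0) (part \<zeta> 0) + i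
     | Suc j \<Rightarrow> max (part \<kappa> (Suc j)) (part \<zeta> (Suc j)) + min (part \<kappa> j) (part \<zeta> j) - part \<eta> j)"

definition flip_down :: "nat list \<Rightarrow> nat list \<Rightarrow> nat list \<Rightarrow> nat list" where
  "flip_down \<kappa> \<zeta> \<nu> = to_partition (\<lambda>j. max (part \<kappa> (Suc j)) (part \<zeta> (Suc j)) + min (part \<kappa> j) (part \<zeta> j) - part \<nu> (Suc j))"

lemma flip_up:
  fixes i :: nat
  assumes "is_partition \<kappa>" "is_partition \<zeta>" "strip \<eta> \<kappa>" "strip \<eta> \<zeta>"
  defines "\<nu> \<equiv> flip_up \<kappa> \<zeta> \<eta> i"
  shows "is_partition \<nu>" "part \<nu> 0 = max (part \<kappa> 0) (part \<zeta> 0) + i"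
    "part \<nu> (Suc j) + part \<eta> j = max (part \<kappa> (Suc j)) (part \<zeta> (Suc j)) + min (part \<kappa> j) (part \<zeta> j)"
    "strip \<kappa> \<nu>" "strip \<zeta> \<nu>"
proof -
  define f where "f = (\<lambda>j. case j of 0 \<Rightarrow> max (part \<kappa> 0) (part \<zeta> 0) + i
     | Suc j \<Rightarrow> max (part \<kappa> (Suc j)) (part \<zeta> (Suc j)) + min (part \<kappa> j) (part \<zeta> j) - part \<eta> j)"
  have s: "part \<eta> j \<le> part \<kappa> j" "part \<kappa> (Suc j) \<le> part \<eta> j" "part \<eta> j \<le> part \<zeta> j" "part \<zeta> (Suc j) \<le> part \<eta> j" for j
    using assms(3,4) by (auto simp: strip_def)
  \<comment> \<open>Part \<open>j\<close> of the new partition must lie between the larger of the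
    parts \<open>j\<close> and the smaller of the parts \<open>j - 1\<close> of \<kappa> and
    \<zeta>. Only the first part has no upper bound, which leaves room for \<open>i\<close>.\<close>
  have lo: "max (part \<kappa> j) (part \<zeta> j) \<le> f j" for j
    using s[of "j - 1"] by (cases j) (auto simp: f_def)
  have hi: "f (Suc j) \<le> min (part \<kappa> j) (part \<zeta> j)" for j
    using s[of j] by (auto simp: f_def)
  have anti: "f (Suc j) \<le> f j" for j using lo[of j] hi[of j] by simp
  have z: "f (Suc (length \<kappa>)) = 0" using hi[of "length \<kappa>"] by (simp add: part_def)
  note tp = to_partition[of f, OF anti z, unfolded f_def, folded flip_up_def, folded \<nu>_def]
  show "is_partition \<nu>" by (rule tp)
  have p: "part \<nu> j = f j" for j unfolding f_def by (rule tp)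
  show "part \<nu> 0 = max (part \<kappa> 0) (part \<zeta> 0) + i" by (simp add: p f_def)
  show "part \<nu> (Suc j) + part \<eta> j = max (part \<kappa> (Suc j)) (part \<zeta> (Suc j)) + min (part \<kappa> j) (part \<zeta> j)"
    using s[of j] by (simp add: p f_def)
  show "strip \<kappa> \<nu>" "strip \<zeta> \<nu>"
    using lo hi by (auto simp: strip_def p)
qed

lemma flip_down:
  assumes "is_partition \<kappa>" "is_partition \<zeta>" "strip \<kappa> \<nu>" "strip \<zeta> \<nu>"
  defines "\<eta> \<equiv> flip_down \<kappa> \<zeta> \<nu>"
  shows "is_partition \<eta>"
    "part \<nu> (Suc j) + part \<eta> j = max (part \<kappa> (Suc j)) (part \<zeta> (Suc j)) + min (part \<kappa> j) (part \<zeta> j)"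
    "strip \<eta> \<kappa>" "strip \<eta> \<zeta>"
proof -
  define f where "f = (\<lambda>j. max (part \<kappa> (Suc j)) (part \<zeta> (Suc j)) + min (part \<kappa> j) (part \<zeta> j) - part \<nu> (Suc j))"
  have s: "part \<kappa> j \<le> part \<nu> j" "part \<nu> (Suc j) \<le> part \<kappa> j" "part \<zeta> j \<le> part \<nu> j" "part \<nu> (Suc j) \<le> part \<zeta> j" for j
    using assms(3,4) by (auto simp: strip_def)
  have lo: "max (part \<kappa> (Suc j)) (part \<zeta> (Suc j)) \<le> f j" for j
    using s(2,4)[of j] by (auto simp: f_def)
  have hi: "f j \<le> min (part \<kappa> j) (part \<zeta> j)" for j
    using s(1,3)[of "Suc j"] by (auto simp: f_def)
  have anti: "f (Suc j) \<le> f j" for j using lo[of j] hi[of "Suc j"] by simp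
  have z: "f (length \<kappa>) = 0" using hi[of "length \<kappa>"] by (simp add: part_def)
  note tp = to_partition[of f, OF anti z, unfolded f_def, folded flip_down_def, folded \<eta>_def]
  show "is_partition \<eta>" by (rule tp)
  have p: "part \<eta> j = f j" for j unfolding f_def by (rule tp)
  show "part \<nu> (Suc j) + part \<eta> j = max (part \<kappa> (Suc j)) (part \<zeta> (Suc j)) + min (part \<kappa> j) (part \<zeta> j)"
    using s(2,4)[of j] by (simp add: p f_def)
  show "strip \<eta> \<kappa>" "strip \<eta> \<zeta>"
    using lo hi by (auto simp: strip_def p)
qed

text \<open>Both factors are expanded in the last variable. The induction hypothesis turns the left
  side into a sum over an inner strip \<eta> of \<kappa> and an outer strip \<zeta> of \<eta>; the
  right side is a sum over an outer strip \<nu> of \<kappa> and an inner strip \<zeta> of \<nu>. The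
  local rule matches them with \<zeta> fixed, the exponent \<open>i\<close> of the last variable in
  \<open>hsym\<close> becoming the surplus in the first row of \<nu>.\<close>

lemma hsym_mult_schur:
  assumes "is_partition \<kappa>"
  shows "hsym N k x * schur N x \<kappa> = (\<Sum>\<nu>\<in>outer_strips \<kappa> k. schur N x \<nu>)"
  using assms
proof (induction N arbitrary: \<kappa> k)
  case 0
  have "(\<Sum>\<nu>\<in>outer_strips \<kappa> k. schur 0 x \<nu>) = (\<Sum>\<nu>\<in>outer_strips \<kappa> k. of_bool (\<nu> = []))"
    by (rule sum.cong) (auto simp: outer_strips_def partitions_of_iff schur_0)
  also have "\<dots> = of_bool ([] \<in> outer_strips \<kappa> k)"
    by (simp add: of_bool_def)
  also have "[] \<in> outer_strips \<kappa> k \<longleftrightarrow> k = 0 \<and> \<kappa> = []"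
  proof
    assume "[] \<in> outer_strips \<kappa> k"
    then have "sum_list \<kappa> = 0" "k = 0" by (auto simp: outer_strips_def partitions_of_iff)
    then show "k = 0 \<and> \<kappa> = []"
      using length_le_sum_list[of \<kappa>] 0 unfolding is_partition_def by (metis le_zero_eq length_0_conv)
  next
    assume "k = 0 \<and> \<kappa> = []"
    then show "[] \<in> outer_strips \<kappa> k"
      by (simp add: outer_strips_def partitions_of_iff is_partition_def strip_def part_def)
  qed
  finally show ?case using schur_0[OF 0, of x] by simp
next
  case (Suc N)
  let ?G = "\<lambda>\<zeta>. x N ^ (sum_list \<kappa> + k - sum_list \<zeta>) * schur N x \<zeta>"
  let ?S1 = "SIGMA i:{..k}. SIGMA \<eta>:inner_strips \<kappa>. outer_strips \<eta> (k - i)"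
  let ?S2 = "SIGMA \<nu>:outer_strips \<kappa> k. inner_strips \<nu>"
  have ps: "is_partition \<eta>" if "\<eta> \<in> inner_strips \<kappa>" for \<eta> \<kappa> using that by (simp add: inner_strips_def)
  have "hsym (Suc N) k x * schur (Suc N) x \<kappa> =
     (\<Sum>i\<le>k. \<Sum>\<eta>\<in>inner_strips \<kappa>. x N ^ i * x N ^ (sum_list \<kappa> - sum_list \<eta>) * (hsym N (k - i) x * schur N x \<eta>))"
    unfolding hsym.simps schur_branching[OF Suc.prems] sum_product by (simp add: mult_ac)
  also have "\<dots> = (\<Sum>i\<le>k. \<Sum>\<eta>\<in>inner_strips \<kappa>. \<Sum>\<zeta>\<in>outer_strips \<eta> (k - i). ?G \<zeta>)"
  proof (intro sum.cong refl)
    fix i \<eta> assume i: "i \<in> {..k}" and \<eta>: "\<eta> \<in> inner_strips \<kappa>"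
    have le: "sum_list \<eta> \<le> sum_list \<kappa>" using \<eta> strip_sum_list_le by (simp add: inner_strips_def)
    have "x N ^ i * x N ^ (sum_list \<kappa> - sum_list \<eta>) = x N ^ (sum_list \<kappa> + k - sum_list \<zeta>)"
      if "\<zeta> \<in> outer_strips \<eta> (k - i)" for \<zeta>
    proof -
      have "sum_list \<zeta> = sum_list \<eta> + (k - i)" using that by (simp add: outer_strips_def partitions_of_iff)
      then have "sum_list \<kappa> + k - sum_list \<zeta> = i + (sum_list \<kappa> - sum_list \<eta>)" using le i by simp
      then show ?thesis by (simp add: power_add)
    qed
    then show "x N ^ i * x N ^ (sum_list \<kappa> - sum_list \<eta>) * (hsym N (k - i) x * schur N x \<eta>) = (\<Sum>\<zeta>\<in>outer_strips \<eta> (k - i). ?G \<zeta>)"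
      unfolding Suc.IH[OF ps[OF \<eta>]] sum_distrib_left by (intro sum.cong) simp_all
  qed
  also have "\<dots> = (\<Sum>(i, \<eta>, \<zeta>)\<in>?S1. ?G \<zeta>)"
    by (simp add: sum.Sigma)
  also have "\<dots> = (\<Sum>(\<nu>, \<zeta>)\<in>?S2. ?G \<zeta>)"
  proof (rule sum.reindex_bij_witness[of _ "\<lambda>(\<nu>, \<zeta>). (part \<nu> 0 - max (part \<kappa> 0) (part \<zeta> 0), flip_down \<kappa> \<zeta> \<nu>, \<zeta>)"
        "\<lambda>(i, \<eta>, \<zeta>). (flip_up \<kappa> \<zeta> \<eta> i, \<zeta>)"], goal_cases)
    case (1 a)
    then obtain i \<eta> \<zeta> where a: "a = (i, \<eta>, \<zeta>)" "i \<le> k" "is_partition \<eta>" "strip \<eta> \<kappa>" "is_partition \<zeta>" "strip \<eta> \<zeta>"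
      by (auto simp: inner_strips_def outer_strips_def partitions_of_iff)
    note up = flip_up[OF Suc.prems a(5) a(4) a(6), of i]
    note down = flip_down[OF Suc.prems a(5) up(4,5)]
    have "flip_down \<kappa> \<zeta> (flip_up \<kappa> \<zeta> \<eta> i) = \<eta>"
    proof (rule part_eqI[OF down(1) a(3)])
      fix j show "part (flip_down \<kappa> \<zeta> (flip_up \<kappa> \<zeta> \<eta> i)) j = part \<eta> j"
        using up(3)[of j] down(2)[of j] by linarith
    qed
    then show ?case using up(2) by (simp add: a(1))
  next
    case (2 a)
    then obtain i \<eta> \<zeta> where a: "a = (i, \<eta>, \<zeta>)" "i \<le> k" "is_partition \<eta>" "strip \<eta> \<kappa>" "is_partition \<zeta>" "strip \<eta> \<zeta>"
      and s: "sum_list \<zeta> = sum_list \<eta> + (k - i)"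
      by (auto simp: inner_strips_def outer_strips_def partitions_of_iff)
    note up = flip_up[OF Suc.prems a(5) a(4) a(6), of i]
    have "sum_list (flip_up \<kappa> \<zeta> \<eta> i) + sum_list \<eta> = i + sum_list \<kappa> + sum_list \<zeta>"
      by (rule flip_size[OF refl up(2,3)])
    then have "sum_list (flip_up \<kappa> \<zeta> \<eta> i) = sum_list \<kappa> + k" using s a(2) by simp
    then show ?case using up a by (simp add: inner_strips_def outer_strips_def partitions_of_iff)
  next
    case (3 a)
    then obtain \<nu> \<zeta> where a: "a = (\<nu>, \<zeta>)" "is_partition \<nu>" "strip \<kappa> \<nu>" "is_partition \<zeta>" "strip \<zeta> \<nu>"
      by (auto simp: inner_strips_def outer_strips_def partitions_of_iff)
    note down = flip_down[OF Suc.prems a(4) a(3) a(5)]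
    let ?i = "part \<nu> 0 - max (part \<kappa> 0) (part \<zeta> 0)"
    have i: "max (part \<kappa> 0) (part \<zeta> 0) + ?i = part \<nu> 0"
      using a(3,5) by (simp add: strip_def)
    note up = flip_up[OF Suc.prems a(4) down(3,4), of ?i]
    have "flip_up \<kappa> \<zeta> (flip_down \<kappa> \<zeta> \<nu>) ?i = \<nu>"
    proof (rule part_eqI[OF up(1) a(2)])
      fix j show "part (flip_up \<kappa> \<zeta> (flip_down \<kappa> \<zeta> \<nu>) ?i) j = part \<nu> j"
        using up(2) up(3)[of "j - 1"] down(2)[of "j - 1"] i by (cases j) simp_all
    qed
    then show ?case by (simp add: a(1))
  next
    case (4 a)
    then obtain \<nu> \<zeta> where a: "a = (\<nu>, \<zeta>)" "is_partition \<nu>" "strip \<kappa> \<nu>" "is_partition \<zeta>" "strip \<zeta> \<nu>"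
      and s: "sum_list \<nu> = sum_list \<kappa> + k"
      by (auto simp: inner_strips_def outer_strips_def partitions_of_iff)
    note down = flip_down[OF Suc.prems a(4) a(3) a(5)]
    let ?i = "part \<nu> 0 - max (part \<kappa> 0) (part \<zeta> 0)"
    have i: "part \<nu> 0 = max (part \<kappa> 0) (part \<zeta> 0) + ?i"
      using a(3,5) by (simp add: strip_def)
    have "sum_list \<nu> + sum_list (flip_down \<kappa> \<zeta> \<nu>) = ?i + sum_list \<kappa> + sum_list \<zeta>"
      by (rule flip_size[OF refl i down(2)])
    moreover have "sum_list (flip_down \<kappa> \<zeta> \<nu>) \<le> sum_list \<zeta>" by (rule strip_sum_list_le[OF down(4)])
    ultimately have "?i \<le> k" "sum_list \<zeta> = sum_list (flip_down \<kappa> \<zeta> \<nu>) + (k - ?i)" using s by linarith+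
    then show ?case using down a by (simp add: inner_strips_def outer_strips_def partitions_of_iff)
  next
    case (5 a)
    then show ?case by (auto split: prod.splits)
  qed
  also have "\<dots> = (\<Sum>\<nu>\<in>outer_strips \<kappa> k. schur (Suc N) x \<nu>)"
  proof -
    have "(\<Sum>\<zeta>\<in>inner_strips \<nu>. ?G \<zeta>) = schur (Suc N) x \<nu>" if "\<nu> \<in> outer_strips \<kappa> k" for \<nu>
      using that schur_branching[of \<nu> N x] by (simp add: outer_strips_def partitions_of_iff)
    then show ?thesis by (simp add: sum.Sigma[symmetric])
  qed
  finally show ?case .
qed

section \<open>Linear independence of Hall--Littlewood polynomials\<close>

lemma digits_eqI:
  fixes \<alpha> \<beta> :: "nat \<Rightarrow> nat"
  assumes "\<And>i. i < N \<Longrightarrow> \<alpha> i < b" "\<And>i. i < N \<Longrightarrow> \<beta> i < b"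
    "(\<Sum>i<N. \<alpha> i * b ^ i) = (\<Sum>i<N. \<beta> i * b ^ i)" "i < N"
  shows "\<alpha> i = \<beta> i"
  using assms
proof (induction N arbitrary: \<alpha> \<beta> i)
  case (Suc N)
  have split: "(\<Sum>i<Suc N. \<gamma> i * b ^ i) = \<gamma> 0 + b * (\<Sum>i<N. \<gamma> (Suc i) * b ^ i)" for \<gamma> :: "nat \<Rightarrow> nat"
    by (simp add: sum.lessThan_Suc_shift sum_distrib_left mult_ac del: sum.lessThan_Suc)
  have eq: "\<alpha> 0 + b * (\<Sum>i<N. \<alpha> (Suc i) * b ^ i) = \<beta> 0 + b * (\<Sum>i<N. \<beta> (Suc i) * b ^ i)"
    using Suc.prems(3) unfolding split .
  have b: "\<alpha> 0 < b" "\<beta> 0 < b" using Suc.prems by auto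
  have 0: "\<alpha> 0 = \<beta> 0" using arg_cong[OF eq, of "\<lambda>m. m mod b"] b by simp
  then have "(\<Sum>i<N. \<alpha> (Suc i) * b ^ i) = (\<Sum>i<N. \<beta> (Suc i) * b ^ i)" using eq b by simp
  then have "\<alpha> (Suc j) = \<beta> (Suc j)" if "j < N" for j
    using Suc.IH[of "\<lambda>i. \<alpha> (Suc i)" "\<lambda>i. \<beta> (Suc i)" j] Suc.prems(1,2) that by simp
  then show ?case using 0 Suc.prems(4) by (cases i) auto
qed simp

lemma shape_part:
  assumes "\<mu> \<in> partitions_of d"
  shows "(\<lambda>i\<in>{..<d}. part \<mu> i) \<in> vectors d \<mu>"
proof -
  have p: "is_partition \<mu>" "sum_list \<mu> = d" using assms by (auto simp: partitions_of_iff)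
  then have l: "length \<mu> \<le> d" using length_le_sum_list by (auto simp: is_partition_def)
  have "card {i. i < d \<and> (\<lambda>i\<in>{..<d}. part \<mu> i) i = v} = count (mset \<mu>) v" if "v \<ge> 1" for v
    unfolding count_list_nth using l that by (intro arg_cong[of _ _ card]) (auto simp: part_def)
  then have "shape d (\<lambda>i\<in>{..<d}. part \<mu> i) = \<mu>" using shape_eq_iff[OF p(1)] by blast
  then show ?thesis by (simp add: vectors_def)
qed

lemma tendsto_theta:
  assumes "c i \<noteq> (c j :: nat)"
  shows "((\<lambda>e. (e ^ c i - t * e ^ c j) / (e ^ c i - e ^ c j)) \<longlongrightarrow> (if c i < c j then 1 else t)) (at (0::complex))"
proof (cases "c i < c j")
  case True
  define m where "m = c j - c i"
  have m: "m > 0" "c j = c i + m" using True by (auto simp: m_def)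
  have "((\<lambda>e::complex. (1 - t * e ^ m) / (1 - e ^ m)) \<longlongrightarrow> (1 - t * 0 ^ m) / (1 - 0 ^ m)) (at 0)"
    using m by (intro tendsto_intros) (simp add: power_0_left)
  moreover have "\<forall>\<^sub>F e in at (0::complex). (1 - t * e ^ m) / (1 - e ^ m) = (e ^ c i - t * e ^ c j) / (e ^ c i - e ^ c j)"
  proof (rule eventually_mono[OF eventually_neq_at_within])
    fix e :: complex assume "e \<noteq> 0"
    then have "(e ^ c i * (1 - t * e ^ m)) / (e ^ c i * (1 - e ^ m)) = (1 - t * e ^ m) / (1 - e ^ m)"
      by (intro mult_divide_mult_cancel_left) simp
    then show "(1 - t * e ^ m) / (1 - e ^ m) = (e ^ c i - t * e ^ c j) / (e ^ c i - e ^ c j)"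
      unfolding m(2) by (simp add: power_add algebra_simps)
  qed
  ultimately have "((\<lambda>e. (e ^ c i - t * e ^ c j) / (e ^ c i - e ^ c j)) \<longlongrightarrow> (1 - t * 0 ^ m) / (1 - 0 ^ m)) (at (0::complex))"
    by (rule Lim_transform_eventually)
  then show ?thesis using True m by (simp add: power_0_left)
next
  case False
  define m where "m = c i - c j"
  have m: "m > 0" "c i = c j + m" using False assms by (auto simp: m_def)
  have "((\<lambda>e::complex. (e ^ m - t) / (e ^ m - 1)) \<longlongrightarrow> (0 ^ m - t) / (0 ^ m - 1)) (at 0)"
    using m by (intro tendsto_intros) (simp add: power_0_left)
  moreover have "\<forall>\<^sub>F e in at (0::complex). (e ^ m - t) / (e ^ m - 1) = (e ^ c i - t * e ^ c j) / (e ^ c i - e ^ c j)"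
  proof (rule eventually_mono[OF eventually_neq_at_within])
    fix e :: complex assume "e \<noteq> 0"
    then have "(e ^ c j * (e ^ m - t)) / (e ^ c j * (e ^ m - 1)) = (e ^ m - t) / (e ^ m - 1)"
      by (intro mult_divide_mult_cancel_left) simp
    then show "(e ^ m - t) / (e ^ m - 1) = (e ^ c i - t * e ^ c j) / (e ^ c i - e ^ c j)"
      unfolding m(2) by (simp add: power_add algebra_simps)
  qed
  ultimately have "((\<lambda>e. (e ^ c i - t * e ^ c j) / (e ^ c i - e ^ c j)) \<longlongrightarrow> (0 ^ m - t) / (0 ^ m - 1)) (at (0::complex))"
    by (rule Lim_transform_eventually)
  then show ?thesis using False m by (simp add: power_0_left)
qed

text \<open>Evaluating at \<open>x i = \<epsilon> ^ ((d + 1) ^ i)\<close> for small \<open>\<epsilon>\<close> orders the monomials linearly, and each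
  factor \<open>(x i - t * x j) / (x i - x j)\<close> tends to \<open>1\<close> or to \<open>t\<close>.\<close>

lemma hall_littlewood_P_independent:
  assumes t: "t \<noteq> 0"
    and zero: "\<And>x. inj_on x {..<d} \<Longrightarrow> (\<Sum>\<mu>\<in>partitions_of d. a \<mu> * hall_littlewood_P d x t \<mu>) = 0"
    and \<mu>: "\<mu> \<in> partitions_of d"
  shows "a \<mu> = 0"
proof (rule ccontr)
  assume nz: "a \<mu> \<noteq> 0"
  let ?R = "\<lambda>\<alpha> :: nat \<Rightarrow> nat. {(i, j). i < d \<and> j < d \<and> \<alpha> i > \<alpha> j}"
  define c where "c i = (d + 1) ^ i" for i
  define x where "x e i = (e :: complex) ^ c i" for e i
  define val where "val \<alpha> = (\<Sum>i<d. \<alpha> i * c i)" for \<alpha>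
  define W where "W = {\<alpha> \<in> {..<d} \<rightarrow>\<^sub>E UNIV. (\<Sum>i<d. \<alpha> i) = d}"
  define S where "S = {\<alpha> \<in> W. a (shape d \<alpha>) \<noteq> 0}"
  define L where "L \<alpha> = (\<Prod>(i, j)\<in>?R \<alpha>. if c i < c j then 1 else t)" for \<alpha> :: "nat \<Rightarrow> nat"
  have finW: "finite W" unfolding W_def by (rule finite_weight_vectors)
  then have finS: "finite S" by (simp add: S_def)
  have "S \<noteq> {}"
  proof -
    have v: "(\<lambda>i\<in>{..<d}. part \<mu> i) \<in> vectors d \<mu>" by (rule shape_part[OF \<mu>])
    then have "(\<lambda>i\<in>{..<d}. part \<mu> i) \<in> S"
      using vectors_weight[OF v] nz \<mu> by (simp add: S_def W_def vectors_def partitions_of_iff)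
    then show ?thesis by blast
  qed
  \<comment> \<open>As \<epsilon> tends to 0, the monomial with the least exponent
    \<open>val\<close> dominates. It is unique: entries are at most \<open>d\<close>, so
    \<open>val\<close> is an expansion in base \<open>d + 1\<close> and determines the
    vector.\<close>
  define \<alpha>0 where "\<alpha>0 = arg_min_on val S"
  have \<alpha>0: "\<alpha>0 \<in> S" "\<And>\<alpha>. \<alpha> \<in> S \<Longrightarrow> val \<alpha>0 \<le> val \<alpha>"
    unfolding \<alpha>0_def using arg_min_if_finite[OF finS \<open>S \<noteq> {}\<close>, of val] by (auto simp: not_less)
  have le: "\<alpha> i < d + 1" if "\<alpha> \<in> W" "i < d" for \<alpha> i
  proof -
    have "\<alpha> i \<le> (\<Sum>i<d. \<alpha> i)" using that(2) by (intro member_le_sum) auto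
    then show ?thesis using that by (simp add: W_def)
  qed
  have strict: "val \<alpha>0 < val \<alpha>" if "\<alpha> \<in> S" "\<alpha> \<noteq> \<alpha>0" for \<alpha>
  proof (rule ccontr)
    assume "\<not> ?thesis"
    then have "val \<alpha> = val \<alpha>0" using \<alpha>0(2)[OF that(1)] by simp
    moreover have w: "\<alpha> \<in> W" "\<alpha>0 \<in> W" using that \<alpha>0 by (auto simp: S_def)
    ultimately have "\<alpha> i = \<alpha>0 i" if "i < d" for i
      using le digits_eqI[of d \<alpha> "d + 1" \<alpha>0 i] that unfolding val_def c_def by blast
    then have "\<alpha> = \<alpha>0"
      using w by (intro PiE_ext[of \<alpha> "{..<d}" "\<lambda>_. UNIV" \<alpha>0]) (auto simp: W_def)
    then show False using that by simp
  qed
  have c_inj: "c i \<noteq> c j" if "i \<noteq> j" "i < d" for i j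
    using that by (simp add: c_def)
  have lim: "((\<lambda>e. pair_weight (x e) t (?R \<alpha>)) \<longlongrightarrow> L \<alpha>) (at 0)" for \<alpha> :: "nat \<Rightarrow> nat"
    unfolding pair_weight_def L_def x_def case_prod_unfold
    by (intro tendsto_prod tendsto_theta c_inj) auto
  have lim2: "((\<lambda>e. e ^ (val \<alpha> - val \<alpha>0) * pair_weight (x e) t (?R \<alpha>))
     \<longlongrightarrow> (if \<alpha> = \<alpha>0 then L \<alpha>0 else 0)) (at 0)" if "\<alpha> \<in> S" for \<alpha>
  proof -
    have "((\<lambda>e. e ^ (val \<alpha> - val \<alpha>0) * pair_weight (x e) t (?R \<alpha>))
     \<longlongrightarrow> 0 ^ (val \<alpha> - val \<alpha>0) * L \<alpha>) (at 0)"
      by (intro tendsto_intros lim)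
    then show ?thesis using strict[OF that] by (cases "\<alpha> = \<alpha>0") (auto simp: power_0_left)
  qed
  have "((\<lambda>e. \<Sum>\<alpha>\<in>S. a (shape d \<alpha>) * (e ^ (val \<alpha> - val \<alpha>0) * pair_weight (x e) t (?R \<alpha>)))
     \<longlongrightarrow> (\<Sum>\<alpha>\<in>S. a (shape d \<alpha>) * (if \<alpha> = \<alpha>0 then L \<alpha>0 else 0))) (at 0)"
    by (intro tendsto_intros lim2)
  moreover have "(\<Sum>\<alpha>\<in>S. a (shape d \<alpha>) * (if \<alpha> = \<alpha>0 then L \<alpha>0 else 0)) = a (shape d \<alpha>0) * L \<alpha>0"
    using finS \<alpha>0(1) by (simp add: if_distrib sum.delta cong: if_cong)
  moreover have "\<forall>\<^sub>F e in at 0. (\<Sum>\<alpha>\<in>S. a (shape d \<alpha>) * (e ^ (val \<alpha> - val \<alpha>0) * pair_weight (x e) t (?R \<alpha>))) = 0"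
  proof -
    have "\<forall>\<^sub>F e in at (0::complex). e \<noteq> 0 \<and> norm e < 1"
      by (intro eventually_conj eventually_neq_at_within)
         (auto simp: eventually_at intro!: exI[of _ 1])
    then show ?thesis
    proof (rule eventually_mono)
      fix e :: complex assume e: "e \<noteq> 0 \<and> norm e < 1"
      have "inj_on (x e) {..<d}"
      proof (rule inj_onI)
        fix i j assume ij: "i \<in> {..<d}" "j \<in> {..<d}" "x e i = x e j"
        then have "norm e ^ c i = norm e ^ c j" by (metis norm_power x_def)
        then have "c i = c j"
          using e power_strict_decreasing[of "c i" "c j" "norm e"] power_strict_decreasing[of "c j" "c i" "norm e"]
          by (metis linorder_neqE_nat less_irrefl zero_less_norm_iff)
        then show "i = j" using c_inj ij by auto
      qed
      from zero[OF this] have "0 = (\<Sum>\<mu>\<in>partitions_of d. \<Sum>\<alpha>\<in>vectors d \<mu>. a (shape d \<alpha>) * hl_term d (x e) t \<alpha>)"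
      proof -
        have "a \<mu> * hall_littlewood_P d (x e) t \<mu> = (\<Sum>\<alpha>\<in>vectors d \<mu>. a (shape d \<alpha>) * hl_term d (x e) t \<alpha>)"
          if "\<mu> \<in> partitions_of d" for \<mu>
        proof -
          have "is_partition \<mu>" using that by (simp add: partitions_of_iff)
          then show ?thesis
            unfolding hall_littlewood_P_eq[OF \<open>is_partition \<mu>\<close>] sum_distrib_left
            by (intro sum.cong refl) (simp add: vectors_def)
        qed
        then show ?thesis using zero[OF \<open>inj_on (x e) {..<d}\<close>] by simp
      qed
      also have "\<dots> = (\<Sum>\<alpha>\<in>W. a (shape d \<alpha>) * hl_term d (x e) t \<alpha>)"
        unfolding W_def by (rule sum_vectors_partitions[symmetric])
      also have "\<dots> = (\<Sum>\<alpha>\<in>S. a (shape d \<alpha>) * hl_term d (x e) t \<alpha>)"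
        unfolding S_def using finW by (intro sum.mono_neutral_right) auto
      also have "\<dots> = (\<Sum>\<alpha>\<in>S. e ^ val \<alpha>0 * (a (shape d \<alpha>) * (e ^ (val \<alpha> - val \<alpha>0) * pair_weight (x e) t (?R \<alpha>))))"
      proof (rule sum.cong[OF refl])
        fix \<alpha> assume "\<alpha> \<in> S"
        then have "val \<alpha> = val \<alpha>0 + (val \<alpha> - val \<alpha>0)" using \<alpha>0 by simp
        moreover have "(\<Prod>i<d. x e i ^ \<alpha> i) = e ^ val \<alpha>"
          by (simp add: x_def val_def power_sum power_mult[symmetric] mult.commute)
        ultimately have "(\<Prod>i<d. x e i ^ \<alpha> i) = e ^ val \<alpha>0 * e ^ (val \<alpha> - val \<alpha>0)"
          by (metis power_add)
        then show "a (shape d \<alpha>) * hl_term d (x e) t \<alpha> =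
          e ^ val \<alpha>0 * (a (shape d \<alpha>) * (e ^ (val \<alpha> - val \<alpha>0) * pair_weight (x e) t (?R \<alpha>)))"
          by (simp add: hl_term_def)
      qed
      finally show "(\<Sum>\<alpha>\<in>S. a (shape d \<alpha>) * (e ^ (val \<alpha> - val \<alpha>0) * pair_weight (x e) t (?R \<alpha>))) = 0"
        using e unfolding sum_distrib_left[symmetric] by simp
    qed
  qed
  ultimately have "((\<lambda>e::complex. 0) \<longlongrightarrow> a (shape d \<alpha>0) * L \<alpha>0) (at 0)"
    by (simp add: Lim_transform_eventually)
  then have "a (shape d \<alpha>0) * L \<alpha>0 = 0"
    using tendsto_unique[OF _ _ tendsto_const] by (metis at_neq_bot)
  \<comment> \<open>Every factor of the limit is 1 or \<open>t\<close>, and \<open>t\<close> is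
    nonzero.\<close>
  moreover have "L \<alpha>0 \<noteq> 0"
  proof -
    have "finite (?R \<alpha>0)"
      by (rule finite_subset[of _ "{..<d} \<times> {..<d}"]) auto
    then show ?thesis using t by (auto simp: L_def prod_zero_iff split: if_splits)
  qed
  ultimately show False using \<alpha>0(1) by (simp add: S_def)
qed

section \<open>Kostka--Foulkes polynomials\<close>

definition eval_int_poly :: "int poly \<Rightarrow> complex \<Rightarrow> complex" where
  "eval_int_poly p t = poly (map_poly of_int p) t"

lemma eval_int_poly_0 [simp]: "eval_int_poly 0 t = 0"
  by (simp add: eval_int_poly_def)

lemma eval_int_poly_1 [simp]: "eval_int_poly 1 t = 1"
  by (simp add: eval_int_poly_def one_pCons map_poly_pCons)

lemma eval_int_poly_X [simp]: "eval_int_poly [:0, 1:] t = t"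
  by (simp add: eval_int_poly_def map_poly_pCons)

lemma eval_int_poly_add [simp]: "eval_int_poly (p + r) t = eval_int_poly p t + eval_int_poly r t"
proof -
  have "map_poly of_int (p + r) = (map_poly of_int p + map_poly of_int r :: complex poly)"
    by (rule poly_eqI) (simp add: coeff_map_poly)
  then show ?thesis by (simp add: eval_int_poly_def)
qed

lemma eval_int_poly_diff [simp]: "eval_int_poly (p - r) t = eval_int_poly p t - eval_int_poly r t"
  using eval_int_poly_add[of "p - r" r t] by simp

lemma eval_int_poly_uminus [simp]: "eval_int_poly (- p) t = - eval_int_poly p t"
  using eval_int_poly_diff[of 0 p] by simp

lemma eval_int_poly_mult [simp]: "eval_int_poly (p * r) t = eval_int_poly p t * eval_int_poly r t"
proof -
  have "map_poly of_int (p * r) = (map_poly of_int p * map_poly of_int r :: complex poly)"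
    by (rule poly_eqI) (simp add: coeff_map_poly coeff_mult)
  then show ?thesis by (simp add: eval_int_poly_def)
qed

lemma eval_int_poly_of_int [simp]: "eval_int_poly (of_int c) t = of_int c"
  by (simp add: eval_int_poly_def of_int_poly map_poly_pCons)

lemma eval_int_poly_of_bool [simp]: "eval_int_poly (of_bool b) t = of_bool b"
  by (cases b) simp_all

lemma eval_int_poly_power [simp]: "eval_int_poly (p ^ n) t = eval_int_poly p t ^ n"
  by (induction n) simp_all

lemma eval_int_poly_sum [simp]: "eval_int_poly (\<Sum>i\<in>I. f i) t = (\<Sum>i\<in>I. eval_int_poly (f i) t)"
  by (induction I rule: infinite_finite_induct) simp_all

lemma eval_int_poly_prod [simp]: "eval_int_poly (\<Prod>i\<in>I. f i) t = (\<Prod>i\<in>I. eval_int_poly (f i) t)"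
  by (induction I rule: infinite_finite_induct) simp_all

text \<open>The Pascal recursion makes \<open>qbinom\<close> available over integer polynomials and
  compatible with evaluation at every \<open>t\<close>; a quotient of Pochhammer symbols would break
  down at roots of unity.\<close>

lemma eval_int_poly_qbinom [simp]: "eval_int_poly (qbinom p n k) t = qbinom (eval_int_poly p t) n k"
  by (induction p n k rule: qbinom.induct) simp_all

lemma eval_int_poly_pieri_coeff [simp]:
  "eval_int_poly (pieri_coeff p k \<nu> \<mu>) t = pieri_coeff (eval_int_poly p t) k \<nu> \<mu>"
  by (simp add: pieri_coeff_def)

text \<open>Agreement at infinitely many points suffices. The point 0 is left out because linear
  independence is established for nonzero \<open>t\<close>.\<close>

lemma eval_int_poly_eqI:
  assumes "\<And>t. t \<noteq> 0 \<Longrightarrow> eval_int_poly p t = eval_int_poly r t"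
  shows "p = r"
proof -
  let ?P = "map_poly of_int (p - r) :: complex poly"
  have "?P = 0"
  proof (rule ccontr)
    assume "?P \<noteq> 0"
    then have "finite {t. poly ?P t = 0}" by (rule poly_roots_finite)
    moreover have "UNIV - {0} \<subseteq> {t. poly ?P t = 0}"
      using assms eval_int_poly_diff[of p r] by (auto simp: eval_int_poly_def)
    ultimately have "finite (UNIV - {0 :: complex})" by (rule rev_finite_subset)
    then show False by (simp add: infinite_UNIV_char_0)
  qed
  then have "coeff (p - r) n = 0" for n
    by (metis coeff_map_poly of_int_0 of_int_eq_0_iff coeff_0)
  then have "p - r = 0" by (intro poly_eqI) simp
  then show ?thesis by simp
qed

text \<open>The condition inside the definite description \<open>kostka_foulkes\<close>, for an
  arbitrary family \<open>f\<close> in place of a Schur function. In this generality it is stable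
  under integral combinations and under multiplication by elementary and complete symmetric
  functions.\<close>

definition expands :: "nat \<Rightarrow> (nat \<Rightarrow> (nat \<Rightarrow> complex) \<Rightarrow> complex) \<Rightarrow> (nat list \<Rightarrow> int poly) \<Rightarrow> bool" where
  "expands d f K \<longleftrightarrow> (\<forall>\<mu>. \<mu> \<notin> partitions_of d \<longrightarrow> K \<mu> = 0) \<and>
    (\<forall>N x t. inj_on x {..<N} \<longrightarrow>
      f N x = (\<Sum>\<mu>\<in>partitions_of d. eval_int_poly (K \<mu>) t * hall_littlewood_P N x t \<mu>))"

lemma expandsD:
  assumes "expands d f K" "inj_on x {..<N}"
  shows "f N x = (\<Sum>\<mu>\<in>partitions_of d. eval_int_poly (K \<mu>) t * hall_littlewood_P N x t \<mu>)"
  using assms unfolding expands_def by blast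

lemma expands_unique:
  assumes "expands d f K" "expands d f K'"
  shows "K = K'"
proof (rule ext)
  fix \<mu> show "K \<mu> = K' \<mu>"
  proof (cases "\<mu> \<in> partitions_of d")
    case True
    show ?thesis
    proof (rule eval_int_poly_eqI)
      fix t :: complex assume "t \<noteq> 0"
      then have "eval_int_poly (K \<mu>) t - eval_int_poly (K' \<mu>) t = 0"
      proof (rule hall_littlewood_P_independent[OF _ _ True])
        fix x :: "nat \<Rightarrow> complex" assume "inj_on x {..<d}"
        then have "f d x = (\<Sum>\<mu>\<in>partitions_of d. eval_int_poly (K \<mu>) t * hall_littlewood_P d x t \<mu>)"
          "f d x = (\<Sum>\<mu>\<in>partitions_of d. eval_int_poly (K' \<mu>) t * hall_littlewood_P d x t \<mu>)"
          using expandsD assms by blast+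
        then show "(\<Sum>\<mu>\<in>partitions_of d. (eval_int_poly (K \<mu>) t - eval_int_poly (K' \<mu>) t) * hall_littlewood_P d x t \<mu>) = 0"
          by (simp add: left_diff_distrib sum_subtractf)
      qed
      then show "eval_int_poly (K \<mu>) t = eval_int_poly (K' \<mu>) t" by simp
    qed
  qed (use assms in \<open>simp add: expands_def\<close>)
qed

lemma expands_sum:
  assumes "finite I" "\<And>i. i \<in> I \<Longrightarrow> expands d (f i) (K i)"
  shows "expands d (\<lambda>N x. \<Sum>i\<in>I. of_int (c i) * f i N x) (\<lambda>\<mu>. \<Sum>i\<in>I. of_int (c i) * K i \<mu>)"
  unfolding expands_def
proof (intro conjI allI impI)
  fix \<mu> assume "\<mu> \<notin> partitions_of d"
  then show "(\<Sum>i\<in>I. of_int (c i) * K i \<mu>) = 0" using assms(2) by (simp add: expands_def)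
next
  fix N :: nat and x :: "nat \<Rightarrow> complex" and t :: complex assume "inj_on x {..<N}"
  then have "(\<Sum>i\<in>I. of_int (c i) * f i N x) =
      (\<Sum>i\<in>I. of_int (c i) * (\<Sum>\<mu>\<in>partitions_of d. eval_int_poly (K i \<mu>) t * hall_littlewood_P N x t \<mu>))"
    using assms(2) by (intro sum.cong refl arg_cong2[where f = "(*)"]) (auto simp: expands_def)
  also have "\<dots> = (\<Sum>\<mu>\<in>partitions_of d. eval_int_poly (\<Sum>i\<in>I. of_int (c i) * K i \<mu>) t * hall_littlewood_P N x t \<mu>)"
    by (simp add: sum_distrib_left sum_distrib_right mult.assoc sum.swap[of _ I])
  finally show "(\<Sum>i\<in>I. of_int (c i) * f i N x) =
    (\<Sum>\<mu>\<in>partitions_of d. eval_int_poly (\<Sum>i\<in>I. of_int (c i) * K i \<mu>) t * hall_littlewood_P N x t \<mu>)" .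
qed

lemma expands_esym:
  assumes "expands d f K"
  shows "expands (d + k) (\<lambda>N x. esym N k x * f N x)
    (\<lambda>\<nu>. if \<nu> \<in> partitions_of (d + k) then \<Sum>\<mu>\<in>partitions_of d. pieri_coeff [:0, 1:] k \<nu> \<mu> * K \<mu> else 0)"
  unfolding expands_def
proof (intro conjI allI impI)
  fix N :: nat and x :: "nat \<Rightarrow> complex" and t :: complex assume inj: "inj_on x {..<N}"
  have "esym N k x * f N x = (\<Sum>\<mu>\<in>partitions_of d. eval_int_poly (K \<mu>) t * (esym N k x * hall_littlewood_P N x t \<mu>))"
    unfolding expandsD[OF assms inj, of t] sum_distrib_left by (simp only: mult_ac)
  also have "\<dots> = (\<Sum>\<mu>\<in>partitions_of d. eval_int_poly (K \<mu>) t *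
      (\<Sum>\<nu>\<in>partitions_of (d + k). pieri_coeff t k \<nu> \<mu> * hall_littlewood_P N x t \<nu>))"
    by (intro sum.cong refl arg_cong2[where f = "(*)"])
       (auto simp: esym_mult_hall_littlewood_P[OF inj] partitions_of_iff)
  also have "\<dots> = (\<Sum>\<nu>\<in>partitions_of (d + k). \<Sum>\<mu>\<in>partitions_of d. eval_int_poly (K \<mu>) t *
      (pieri_coeff t k \<nu> \<mu> * hall_littlewood_P N x t \<nu>))"
    unfolding sum_distrib_left by (rule sum.swap)
  also have "\<dots> = (\<Sum>\<nu>\<in>partitions_of (d + k). eval_int_poly (if \<nu> \<in> partitions_of (d + k)
      then \<Sum>\<mu>\<in>partitions_of d. pieri_coeff [:0, 1:] k \<nu> \<mu> * K \<mu> else 0) t * hall_littlewood_P N x t \<nu>)"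
    by (rule sum.cong) (auto simp: sum_distrib_left mult_ac)
  finally show "esym N k x * f N x = \<dots>" .
qed simp

lemma hsym_eq_sum_esym:
  assumes "k > 0"
  shows "hsym N k x = (\<Sum>i\<in>{1..k}. of_int (- ((- 1) ^ i)) * (esym N i x * hsym N (k - i) x))"
proof -
  have "0 = (\<Sum>i\<in>insert 0 {1..k}. (- 1) ^ i * esym N i x * hsym N (k - i) x)"
    using sum_esym_hsym[of N x k] assms by (simp add: atMost_atLeast0 Icc_eq_insert_lb_nat)
  then show ?thesis by (simp add: sum_negf mult.assoc eq_neg_iff_add_eq_0)
qed

text \<open>The relation between both kinds of symmetric functions writes \<open>h_k\<close> as an
  integral combination of products \<open>e_i * h_(k - i)\<close> with \<open>i > 0\<close>, so
  strong induction reduces to \<open>expands_esym\<close> without any division. Explicit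
  coefficients are derived later, for two columns only.\<close>

lemma expands_hsym:
  assumes "expands d f K"
  shows "\<exists>K'. expands (d + k) (\<lambda>N x. hsym N k x * f N x) K'"
proof (induction k rule: less_induct)
  case (less k)
  show ?case
  proof (cases "k = 0")
    case True
    then show ?thesis using assms by auto
  next
    case False
    have "\<exists>K'. expands (d + k) (\<lambda>N x. esym N i x * (hsym N (k - i) x * f N x)) K'" if i: "i \<in> {1..k}" for i
    proof -
      obtain K' where "expands (d + (k - i)) (\<lambda>N x. hsym N (k - i) x * f N x) K'"
        using less.IH[of "k - i"] i by auto
      from expands_esym[OF this, of i] i show ?thesis by auto
    qed
    then have "\<exists>K'. \<forall>i\<in>{1..k}. expands (d + k) (\<lambda>N x. esym N i x * (hsym N (k - i) x * f N x)) (K' i)"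
      by (intro bchoice ballI)
    then obtain K' where K': "\<And>i. i \<in> {1..k} \<Longrightarrow> expands (d + k) (\<lambda>N x. esym N i x * (hsym N (k - i) x * f N x)) (K' i)"
      by blast
    from expands_sum[OF finite_atLeastAtMost K', where c = "\<lambda>i. - ((- 1) ^ i)"]
    have "expands (d + k) (\<lambda>N x. \<Sum>i\<in>{1..k}. of_int (- ((- 1) ^ i)) * (esym N i x * (hsym N (k - i) x * f N x)))
       (\<lambda>\<mu>. \<Sum>i\<in>{1..k}. of_int (- ((- 1) ^ i)) * K' i \<mu>)" by simp
    moreover have "(\<lambda>N x. \<Sum>i\<in>{1..k}. of_int (- ((- 1) ^ i)) * (esym N i x * (hsym N (k - i) x * f N x))) =
       (\<lambda>N x. hsym N k x * f N x)"
      using False by (simp add: hsym_eq_sum_esym sum_distrib_right mult.assoc fun_eq_iff del: of_int_minus of_int_power)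
    ultimately show ?thesis by auto
  qed
qed

lemma partitions_of_0: "partitions_of 0 = {[]}"
proof -
  have "\<mu> = []" if "\<mu> \<in> partitions_of 0" for \<mu>
    using that length_le_sum_list[of \<mu>] by (simp only: partitions_of_def mem_Collect_eq) (metis le_zero_eq length_0_conv)
  then show ?thesis by (auto simp: partitions_of_def)
qed

lemma hall_littlewood_P_Nil: "hall_littlewood_P N x t [] = 1"
proof -
  have "rearrangements N [] = {replicate N 0}"
  proof (intro equalityI subsetI)
    fix \<alpha> :: "nat list" assume "\<alpha> \<in> rearrangements N []"
    then have m: "mset \<alpha> = mset (replicate N 0)" by (simp add: rearrangements_def)
    then have "length \<alpha> = N" "set \<alpha> = set (replicate N 0)"
      by (metis size_mset length_replicate, metis mset_eq_setD)
    then show "\<alpha> \<in> {replicate N 0}" by (auto intro!: replicate_eqI)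
  qed (simp add: rearrangements_def)
  moreover have "(\<Prod>(i, j)\<in>{(i, j). i < N \<and> j < N \<and> replicate N 0 ! i > (replicate N 0 ! j :: nat)}. g i j) = 1" for g :: "nat \<Rightarrow> nat \<Rightarrow> complex"
  proof -
    have "{(i, j). i < N \<and> j < N \<and> replicate N 0 ! i > (replicate N 0 ! j :: nat)} = {}" by auto
    then show ?thesis by (simp only: prod.empty)
  qed
  ultimately show ?thesis unfolding hall_littlewood_P_def by simp
qed

lemma schur_Nil: "schur N x [] = 1"
proof -
  have "ssyt N [] = {\<lambda>_. undefined}" by (auto simp: ssyt_def diagram_def)
  then show ?thesis by (simp add: schur_def diagram_def)
qed

lemma expands_schur_Nil: "expands 0 (\<lambda>N x. schur N x []) (\<lambda>\<mu>. of_bool (\<mu> = []))"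
  by (simp add: expands_def partitions_of_0 hall_littlewood_P_Nil schur_Nil)

text \<open>A statistic that strictly decreases when a partition moves up in dominance order:
  dominance compares the partial sums, which are subtracted here.\<close>

definition codominance :: "nat list \<Rightarrow> nat" where
  "codominance \<nu> = (\<Sum>i<sum_list \<nu>. sum_list \<nu> - (\<Sum>j\<le>i. part \<nu> j))"

text \<open>Among the partitions obtained from \<nu> without its last part by adding a horizontal
  strip of the size of that part, \<nu> itself is lowest in dominance order: the other ones put some
  of the cells into higher rows.\<close>

lemma codominance_less:
  assumes \<nu>: "is_partition \<nu>" "\<nu> \<noteq> []" and \<eta>: "\<eta> \<in> outer_strips (butlast \<nu>) (last \<nu>)" "\<eta> \<noteq> \<nu>"
  shows "codominance \<eta> < codominance \<nu>"
proof -
  define d where "d = sum_list \<nu>"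
  define l where "l = length \<nu>"
  have l0: "l > 0" using \<nu> by (simp add: l_def)
  have sl: "sum_list (butlast \<nu>) + last \<nu> = d"
    unfolding d_def by (subst (3) append_butlast_last_id[OF \<nu>(2), symmetric]) (simp del: append_butlast_last_id)
  have \<eta>': "is_partition \<eta>" "sum_list \<eta> = d" "strip (butlast \<nu>) \<eta>"
    using \<eta>(1) by (auto simp: outer_strips_def partitions_of_iff sl)
  have len: "length \<nu> \<le> d" "length \<eta> \<le> d"
    using length_le_sum_list[of \<nu>] length_le_sum_list[of \<eta>] \<nu> \<eta>' by (auto simp: is_partition_def d_def)
  have pb: "part (butlast \<nu>) i = (if i < l - 1 then part \<nu> i else 0)" for i
    by (auto simp: part_def nth_butlast l_def)
  have ge: "part \<nu> i \<le> part \<eta> i" if "i < l - 1" for i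
    using \<eta>'(3) that pb[of i] unfolding strip_def by metis
  have z: "part \<eta> i = 0" if "i \<ge> l" for i
  proof -
    have "i = Suc (i - 1)" "\<not> i - 1 < l - 1" using that l0 by auto
    then show ?thesis using \<eta>'(3) pb[of "i - 1"] unfolding strip_def by (metis le_zero_eq)
  qed
  have z': "part \<nu> i = 0" if "i \<ge> l" for i using that by (simp add: part_def l_def)
  have full: "(\<Sum>j\<le>i. part \<mu> j) = d" if "l \<le> Suc i" "\<And>i. i \<ge> l \<Longrightarrow> part \<mu> i = 0" "sum_list \<mu> = d" "length \<mu> \<le> d" for \<mu> i
  proof -
    have "d = (\<Sum>j<d + Suc i. part \<mu> j)" using sum_list_eq_sum_part[of \<mu> "d + Suc i"] that by simp
    also have "\<dots> = (\<Sum>j<Suc i. part \<mu> j)"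
      using that by (intro sum.mono_neutral_right) auto
    finally show ?thesis by (simp add: lessThan_Suc_atMost)
  qed
  have pre: "(\<Sum>j\<le>i. part \<nu> j) \<le> (\<Sum>j\<le>i. part \<eta> j)" for i
  proof (cases "l \<le> Suc i")
    case True
    then show ?thesis using full[of i \<nu>] full[of i \<eta>] z z' \<eta>' len by (simp add: d_def)
  next
    case False
    then show ?thesis by (intro sum_mono ge) auto
  qed
  have bound: "(\<Sum>j\<le>i. part \<eta> j) \<le> d" for i
  proof -
    have "(\<Sum>j\<le>i. part \<eta> j) \<le> (\<Sum>j\<le>max i d. part \<eta> j)" by (intro sum_mono2) auto
    also have "\<dots> = (\<Sum>j<Suc (max i d). part \<eta> j)" by (simp only: lessThan_Suc_atMost)
    also have "\<dots> = d" using sum_list_eq_sum_part[of \<eta> "Suc (max i d)"] \<eta>' len by simp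
    finally show ?thesis .
  qed
  have "codominance \<eta> \<noteq> codominance \<nu>"
  proof
    assume "codominance \<eta> = codominance \<nu>"
    then have "(\<Sum>i<d. d - (\<Sum>j\<le>i. part \<eta> j)) = (\<Sum>i<d. d - (\<Sum>j\<le>i. part \<nu> j))"
      by (simp add: codominance_def \<eta>' d_def)
    then have e: "d - (\<Sum>j\<le>i. part \<eta> j) = d - (\<Sum>j\<le>i. part \<nu> j)" if "i < d" for i
      by (rule sum_mono_inv) (use that pre in \<open>auto intro: diff_le_mono2\<close>)
    have eq: "(\<Sum>j\<le>i. part \<eta> j) = (\<Sum>j\<le>i. part \<nu> j)" if "i < d" for i
      using e[OF that] pre[of i] bound[of i] by simp
    have "part \<eta> i = part \<nu> i" for i
    proof (cases "i < d")
      case True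
      then show ?thesis using eq[of i] eq[of "i - 1"] by (cases i) auto
    qed (use len in \<open>simp add: part_def\<close>)
    then show False using part_eqI[OF \<eta>'(1) \<nu>(1)] \<eta>(2) by blast
  qed
  moreover have "codominance \<eta> \<le> codominance \<nu>"
    unfolding codominance_def \<eta>'(2) d_def[symmetric] by (intro sum_mono diff_le_mono2 pre)
  ultimately show ?thesis by simp
qed

text \<open>With \<kappa> obtained by removing the last part \<open>k\<close>, the Pieri rule gives
  \<open>h_k\<close> times the Schur function of \<kappa> as that of \<nu> plus Schur functions of
  the same degree and smaller \<open>codominance\<close>. Hence the induction is on size first and
  \<open>codominance\<close> second.\<close>

lemma expands_schur_exists:
  assumes "is_partition \<nu>"
  shows "\<exists>K. expands (sum_list \<nu>) (\<lambda>N x. schur N x \<nu>) K"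
  using assms
proof (induction \<nu> rule: wf_induct_rule[OF wf_measures[of "[sum_list, codominance]"]])
  case (1 \<nu>)
  show ?case
  proof (cases "\<nu> = []")
    case True
    then show ?thesis using expands_schur_Nil by auto
  next
    case False
    define \<kappa> where "\<kappa> = butlast \<nu>"
    define k where "k = last \<nu>"
    have eq: "\<nu> = \<kappa> @ [k]" using False by (simp add: \<kappa>_def k_def)
    have p: "is_partition \<kappa>" "k > 0" and sl: "sum_list \<nu> = sum_list \<kappa> + k"
      using 1(2) by (auto simp: eq is_partition_def sorted_wrt_append)
    have "(\<kappa>, \<nu>) \<in> measures [sum_list, codominance]" using sl p by simp
    from 1(1)[OF this p(1)] obtain K where "expands (sum_list \<kappa>) (\<lambda>N x. schur N x \<kappa>) K" by blast
    from expands_hsym[OF this, of k] obtain K0 where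
      "expands (sum_list \<nu>) (\<lambda>N x. hsym N k x * schur N x \<kappa>) K0" unfolding sl by blast
    then have K0: "expands (sum_list \<nu>) (\<lambda>N x. \<Sum>\<eta>\<in>outer_strips \<kappa> k. schur N x \<eta>) K0"
      by (simp add: hsym_mult_schur[OF p(1)])
    have "\<exists>K. expands (sum_list \<nu>) (\<lambda>N x. schur N x \<eta>) K" if "\<eta> \<in> outer_strips \<kappa> k - {\<nu>}" for \<eta>
    proof -
      have \<eta>: "is_partition \<eta>" "sum_list \<eta> = sum_list \<nu>"
        using that by (auto simp: outer_strips_def partitions_of_iff sl)
      moreover have "codominance \<eta> < codominance \<nu>"
        using codominance_less[OF 1(2) False, of \<eta>] that by (auto simp: \<kappa>_def k_def)
      ultimately show ?thesis using 1(1)[of \<eta>] by simp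
    qed
    then have "\<exists>K. \<forall>\<eta>\<in>outer_strips \<kappa> k - {\<nu>}. expands (sum_list \<nu>) (\<lambda>N x. schur N x \<eta>) (K \<eta>)"
      by (intro bchoice ballI)
    then obtain K where K: "\<And>\<eta>. \<eta> \<in> outer_strips \<kappa> k - {\<nu>} \<Longrightarrow> expands (sum_list \<nu>) (\<lambda>N x. schur N x \<eta>) (K \<eta>)"
      by blast
    let ?K1 = "\<lambda>\<mu>. \<Sum>\<eta>\<in>outer_strips \<kappa> k - {\<nu>}. of_int 1 * K \<eta> \<mu>"
    have K1: "expands (sum_list \<nu>) (\<lambda>N x. \<Sum>\<eta>\<in>outer_strips \<kappa> k - {\<nu>}. of_int 1 * schur N x \<eta>) ?K1"
      by (rule expands_sum[where c = "\<lambda>_. 1"]) (simp_all add: K)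
    \<comment> \<open>A difference of two expansions, encoded as a sum over the booleans with
      coefficients 1 and -1 so that \<open>expands_sum\<close> covers it.\<close>
    have "expands (sum_list \<nu>) (\<lambda>N x. \<Sum>i\<in>UNIV. of_int (if i then 1 else - 1) *
       (if i then (\<Sum>\<eta>\<in>outer_strips \<kappa> k. schur N x \<eta>) else (\<Sum>\<eta>\<in>outer_strips \<kappa> k - {\<nu>}. of_int 1 * schur N x \<eta>)))
       (\<lambda>\<mu>. \<Sum>i\<in>UNIV. of_int (if i then 1 else - 1) * (if i then K0 else ?K1) \<mu>)"
    proof (rule expands_sum)
      fix i show "expands (sum_list \<nu>) (\<lambda>N x. if i then (\<Sum>\<eta>\<in>outer_strips \<kappa> k. schur N x \<eta>)
         else (\<Sum>\<eta>\<in>outer_strips \<kappa> k - {\<nu>}. of_int 1 * schur N x \<eta>)) (if i then K0 else ?K1)"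
        using K0 K1 by (cases i) simp_all
    qed simp
    moreover have "\<nu> \<in> outer_strips \<kappa> k"
    proof -
      have "strip \<kappa> \<nu>"
        unfolding strip_def
      proof
        fix i
        have "part \<kappa> i = (if i < length \<kappa> then part \<nu> i else 0)" by (auto simp: part_def eq nth_append)
        moreover have "part \<nu> (Suc i) = 0" if "\<not> i < length \<kappa>" using that by (simp add: part_def eq)
        ultimately show "part \<kappa> i \<le> part \<nu> i \<and> part \<nu> (Suc i) \<le> part \<kappa> i"
          using part_antimono[OF 1(2), of i "Suc i"] by auto
      qed
      then show ?thesis using 1(2) sl by (simp add: outer_strips_def partitions_of_iff)
    qed
    then have "(\<Sum>\<eta>\<in>outer_strips \<kappa> k. schur N x \<eta>) = schur N x \<nu> + (\<Sum>\<eta>\<in>outer_strips \<kappa> k - {\<nu>}. schur N x \<eta>)" for N x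
      by (intro sum.remove) simp_all
    ultimately show ?thesis by (auto simp: UNIV_bool)
  qed
qed

text \<open>From here on the definite description is replaced by its defining property.\<close>

lemma expands_kostka_foulkes:
  assumes "is_partition \<nu>"
  shows "expands (sum_list \<nu>) (\<lambda>N x. schur N x \<nu>) (kostka_foulkes \<nu>)"
proof -
  have "kostka_foulkes \<nu> = (THE K. expands (sum_list \<nu>) (\<lambda>N x. schur N x \<nu>) K)"
    unfolding kostka_foulkes_def expands_def eval_int_poly_def ..
  moreover have "\<exists>!K. expands (sum_list \<nu>) (\<lambda>N x. schur N x \<nu>) K"
    using expands_schur_exists[OF assms] expands_unique by blast
  ultimately show ?thesis by (metis (no_types, lifting) theI')
qed

lemma kostka_foulkes_Nil: "kostka_foulkes [] = (\<lambda>\<mu>. of_bool (\<mu> = []))"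
  using expands_unique[OF expands_kostka_foulkes[of "[]"], simplified, OF _ expands_schur_Nil]
  by (simp add: is_partition_def)

lemma modified_hall_littlewood_Nil: "modified_hall_littlewood N x q [] = 1"
  by (simp add: modified_hall_littlewood_def partitions_of_0 schur_Nil kostka_foulkes_Nil)

section \<open>Partitions with at most two columns\<close>

definition two_columns :: "nat \<Rightarrow> nat \<Rightarrow> nat list" where
  "two_columns r b = replicate r 2 @ replicate b 1"

lemma is_partition_two_columns [simp]: "is_partition (two_columns r b)"
proof -
  have "sorted_wrt (\<ge>) (replicate n c)" for n and c :: nat by (induction n) auto
  then show ?thesis by (simp add: is_partition_def two_columns_def sorted_wrt_append)
qed

lemma sum_list_two_columns [simp]: "sum_list (two_columns r b) = 2 * r + b"
  by (simp add: two_columns_def sum_list_replicate)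

lemma count_two_columns: "count (mset (two_columns r b)) v = (if v = 1 then b else if v = 2 then r else 0)"
  by (auto simp: two_columns_def)

lemma two_columns_in_partitions_of: "two_columns r b \<in> partitions_of d \<longleftrightarrow> 2 * r + b = d"
  by (simp add: partitions_of_iff)

lemma two_columns_Nil [simp]: "two_columns 0 0 = []"
  by (simp add: two_columns_def)

text \<open>Only entries 1 and 2 are available: \<open>i\<close> ones are lowered to 0 and
  \<open>j\<close> twos to 1. So two-column partitions arise only from two-column partitions, and
  the system of coefficients closes.\<close>

lemma pieri_coeff_two_columns:
  assumes "is_partition \<mu>"
  shows "pieri_coeff t k (two_columns r b) \<mu> = (\<Sum>i\<le>b. \<Sum>j\<le>r.
    of_bool (i + j = k \<and> \<mu> = two_columns (r - j) (b + j - i)) * (qbinom t b (b - i) * qbinom t r (r - j)))"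
proof -
  define \<nu> where "\<nu> = two_columns r b"
  define M where "M = sum_list \<nu> + 2"
  define m where "m v = count (mset \<nu>) v" for v
  have m: "m 1 = b" "m 2 = r" "\<And>v. v \<noteq> 1 \<Longrightarrow> v \<noteq> 2 \<Longrightarrow> m v = 0"
    by (auto simp: m_def \<nu>_def count_two_columns)
  define F where "F d = (of_bool ((\<Sum>v\<in>{1..M}. d v) = k \<and>
        (\<forall>v\<ge>1. count (mset \<mu>) v + (if v \<le> M then d v else 0) = m v + (if Suc v \<le> M then d (Suc v) else 0))) *
      (\<Prod>v\<in>{1..M}. qbinom t (m v) (m v - d v)))" for d
  \<comment> \<open>The summand 2 in the index range of \<open>pieri_coeff\<close> ensures that 1
    and 2 belong to the range even for the empty partition.\<close>
  have M: "{1..M} = insert 1 (insert 2 {3..M})" "M \<ge> 2" by (auto simp: M_def)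
  let ?z = "\<lambda>v\<in>{3..M}. 0 :: nat"
  have "pieri_coeff t k \<nu> \<mu> = (\<Sum>d\<in>PiE (insert 1 (insert 2 {3..M})) (\<lambda>v. {..m v}). F d)"
    unfolding pieri_coeff_def F_def m_def M(1)[symmetric] by (simp only: M_def)
  also have "\<dots> = (\<Sum>i\<le>b. \<Sum>j\<le>r. \<Sum>d\<in>PiE {3..M} (\<lambda>v. {..m v}). F (d(2 := j, 1 := i)))"
    using m by (subst sum_PiE_insert, simp, subst sum_PiE_insert, simp) (simp add: numeral_2_eq_2)
  also have "PiE {3..M} (\<lambda>v. {..m v}) = PiE {3..M} (\<lambda>v. {0})"
    using m by (intro PiE_cong) auto
  also have "\<dots> = {?z}"
    using PiE_singleton[of ?z "{3..M}"] by (simp add: PiE_cong[of "{3..M}" "\<lambda>v. {?z v}" "\<lambda>v. {0}"])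
  also have "(\<Sum>i\<le>b. \<Sum>j\<le>r. \<Sum>d\<in>{?z}. F (d(2 := j, 1 := i))) = (\<Sum>i\<le>b. \<Sum>j\<le>r.
    of_bool (i + j = k \<and> \<mu> = two_columns (r - j) (b + j - i)) * (qbinom t b (b - i) * qbinom t r (r - j)))"
  proof (intro sum.cong refl)
    fix i j assume ij: "i \<in> {..b}" "j \<in> {..r}"
    let ?d = "?z(2 := j, 1 := i)"
    have d: "?d 1 = i" "?d 2 = j" by simp_all
    have d0: "?d v = 0" if "3 \<le> v" "v \<le> M" for v using that by auto
    have s: "(\<Sum>v\<in>{1..M}. ?d v) = i + j"
      unfolding M(1) by (simp add: d0)
    have p: "(\<Prod>v\<in>{1..M}. qbinom t (m v) (m v - ?d v)) = qbinom t b (b - i) * qbinom t r (r - j)"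
      unfolding M(1) using m by (simp add: d0 numeral_2_eq_2)
    have "(\<forall>v\<ge>1. count (mset \<mu>) v + (if v \<le> M then ?d v else 0) = m v + (if Suc v \<le> M then ?d (Suc v) else 0))
       \<longleftrightarrow> (\<forall>v\<ge>1. count (mset \<mu>) v = count (mset (two_columns (r - j) (b + j - i))) v)"
    proof (intro all_cong)
      fix v :: nat assume "v \<ge> 1"
      then consider "v = 1" | "v = 2" | "v \<ge> 3" by linarith
      then show "(count (mset \<mu>) v + (if v \<le> M then ?d v else 0) = m v + (if Suc v \<le> M then ?d (Suc v) else 0)) \<longleftrightarrow>
          (count (mset \<mu>) v = count (mset (two_columns (r - j) (b + j - i))) v)"
      proof cases
        case 1
        then show ?thesis using M(2) m(1) ij by (auto simp: count_two_columns numeral_2_eq_2)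
      next
        case 2
        then show ?thesis using M(2) m(2) ij d0[of 3] by (auto simp: count_two_columns)
      next
        case 3
        then have "(if v \<le> M then ?d v else 0) = 0" "(if Suc v \<le> M then ?d (Suc v) else 0) = 0" using d0 by auto
        then show ?thesis using 3 m(3)[of v] by (simp only: count_two_columns) simp
      qed
    qed
    also have "\<dots> \<longleftrightarrow> \<mu> = two_columns (r - j) (b + j - i)"
      using is_partition_count_eqI[OF assms is_partition_two_columns] by auto
    finally show "(\<Sum>d\<in>{?z}. F (d(2 := j, 1 := i))) =
      of_bool (i + j = k \<and> \<mu> = two_columns (r - j) (b + j - i)) * (qbinom t b (b - i) * qbinom t r (r - j))"
      by (simp only: F_def s p sum.insert_remove sum.empty finite.emptyI Diff_empty empty_Diff add_0_right)
  qed
  finally show ?thesis unfolding \<nu>_def .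
qed

lemma sum_pieri_coeff_two_columns:
  assumes "2 * r + b = d + k"
  shows "(\<Sum>\<mu>\<in>partitions_of d. pieri_coeff t k (two_columns r b) \<mu> * a \<mu>) =
    (\<Sum>i\<le>b. \<Sum>j\<le>r. of_bool (i + j = k) * (qbinom t b (b - i) * qbinom t r (r - j) * a (two_columns (r - j) (b + j - i))))"
proof -
  have "(\<Sum>\<mu>\<in>partitions_of d. pieri_coeff t k (two_columns r b) \<mu> * a \<mu>) =
    (\<Sum>\<mu>\<in>partitions_of d. \<Sum>i\<le>b. \<Sum>j\<le>r. of_bool (i + j = k \<and> \<mu> = two_columns (r - j) (b + j - i)) *
        (qbinom t b (b - i) * qbinom t r (r - j)) * a \<mu>)"
    by (intro sum.cong refl) (simp only: pieri_coeff_two_columns partitions_of_iff sum_distrib_right)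
  also have "\<dots> = (\<Sum>i\<le>b. \<Sum>j\<le>r. \<Sum>\<mu>\<in>partitions_of d. of_bool (i + j = k \<and> \<mu> = two_columns (r - j) (b + j - i)) *
        (qbinom t b (b - i) * qbinom t r (r - j)) * a \<mu>)"
    by (subst sum.swap, intro sum.cong refl, rule sum.swap)
  also have "\<dots> = (\<Sum>i\<le>b. \<Sum>j\<le>r. of_bool (i + j = k) * (qbinom t b (b - i) * qbinom t r (r - j) * a (two_columns (r - j) (b + j - i))))"
  proof (intro sum.cong refl)
    fix i j assume ij: "i \<in> {..b}" "j \<in> {..r}"
    let ?\<mu> = "two_columns (r - j) (b + j - i)"
    show "(\<Sum>\<mu>\<in>partitions_of d. of_bool (i + j = k \<and> \<mu> = ?\<mu>) * (qbinom t b (b - i) * qbinom t r (r - j)) * a \<mu>) =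
       of_bool (i + j = k) * (qbinom t b (b - i) * qbinom t r (r - j) * a ?\<mu>)"
    proof (cases "i + j = k")
      case True
      then have "?\<mu> \<in> partitions_of d" using assms ij by (auto simp: two_columns_in_partitions_of)
      then have "(\<Sum>\<mu>\<in>partitions_of d. of_bool (i + j = k \<and> \<mu> = ?\<mu>) * (qbinom t b (b - i) * qbinom t r (r - j)) * a \<mu>) =
        (\<Sum>\<mu>\<in>{?\<mu>}. of_bool (i + j = k \<and> \<mu> = ?\<mu>) * (qbinom t b (b - i) * qbinom t r (r - j)) * a \<mu>)"
        by (intro sum.mono_neutral_right) auto
      then show ?thesis by simp
    qed simp
  qed
  finally show ?thesis .
qed

section \<open>From elementary to complete symmetric functions on two columns\<close>

lemma sum_swap_pairs:
  "(\<Sum>i\<in>I. \<Sum>j\<in>J i. \<Sum>r\<in>R. \<Sum>s\<in>S r. f i j r s) = (\<Sum>r\<in>R. \<Sum>s\<in>S r. \<Sum>i\<in>I. \<Sum>j\<in>J i. f i j r s)"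
proof -
  have "(\<Sum>i\<in>I. \<Sum>j\<in>J i. \<Sum>r\<in>R. \<Sum>s\<in>S r. f i j r s) = (\<Sum>i\<in>I. \<Sum>r\<in>R. \<Sum>j\<in>J i. \<Sum>s\<in>S r. f i j r s)"
    by (rule sum.cong[OF refl], rule sum.swap)
  also have "\<dots> = (\<Sum>r\<in>R. \<Sum>i\<in>I. \<Sum>j\<in>J i. \<Sum>s\<in>S r. f i j r s)" by (rule sum.swap)
  also have "\<dots> = (\<Sum>r\<in>R. \<Sum>i\<in>I. \<Sum>s\<in>S r. \<Sum>j\<in>J i. f i j r s)"
    by (rule sum.cong[OF refl], rule sum.cong[OF refl], rule sum.swap)
  also have "\<dots> = (\<Sum>r\<in>R. \<Sum>s\<in>S r. \<Sum>i\<in>I. \<Sum>j\<in>J i. f i j r s)"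
    by (rule sum.cong[OF refl], rule sum.swap)
  finally show ?thesis .
qed

text \<open>The coefficient with which a term at \<open>two_columns r' b'\<close> contributes to
  \<open>two_columns r b\<close> under multiplication by the complete symmetric function of degree
  \<open>(2 * r + b) - (2 * r' + b')\<close>. It is a product of two kernels of the q-binomial
  inversion.\<close>

definition hsym_coeff :: "complex \<Rightarrow> nat \<Rightarrow> nat \<Rightarrow> nat \<Rightarrow> nat \<Rightarrow> complex" where
  "hsym_coeff q r b r' b' = qbinom q r r' * q ^ tri (r - r') * (qbinom q (r + b - r') b' * q ^ tri (r + b - r' - b'))"

text \<open>The alternating sum of \<open>e_m * h_(k - m)\<close>, read off at one two-column
  partition. \<open>A r b\<close> stands for the coefficient of \<open>h_k * f\<close> at
  \<open>two_columns r b\<close>, where \<open>k\<close> is determined by the size, so one function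
  collects all \<open>k\<close>.\<close>

definition pieri_system :: "complex \<Rightarrow> (nat \<Rightarrow> nat \<Rightarrow> complex) \<Rightarrow> nat \<Rightarrow> nat \<Rightarrow> complex" where
  "pieri_system q A r b = (\<Sum>i\<le>b. \<Sum>j\<le>r. (- 1) ^ (i + j) * (qbinom q b i * qbinom q r j) * A (r - j) (b + j - i))"

text \<open>The system is triangular: the summand for \<open>i = j = 0\<close> is
  \<open>A r b\<close> itself, and all others refer to smaller sizes.\<close>

lemma pieri_system_unique:
  assumes "\<And>r b. pieri_system q A r b = pieri_system q B r b"
  shows "A r b = B r b"
proof (induction "2 * r + b" arbitrary: r b rule: less_induct)
  case less
  have split: "pieri_system q A r b = A r b +
     (\<Sum>(i, j)\<in>{..b} \<times> {..r} - {(0, 0)}. (- 1) ^ (i + j) * (qbinom q b i * qbinom q r j) * A (r - j) (b + j - i))" for A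
    unfolding pieri_system_def sum.cartesian_product by (subst sum.remove[of _ "(0, 0)"]) auto
  have "(\<Sum>(i, j)\<in>{..b} \<times> {..r} - {(0, 0)}. (- 1) ^ (i + j) * (qbinom q b i * qbinom q r j) * A (r - j) (b + j - i)) =
    (\<Sum>(i, j)\<in>{..b} \<times> {..r} - {(0, 0)}. (- 1) ^ (i + j) * (qbinom q b i * qbinom q r j) * B (r - j) (b + j - i))"
  proof (rule sum.cong[OF refl])
    fix a assume "a \<in> {..b} \<times> {..r} - {(0, 0)}"
    then obtain i j where a: "a = (i, j)" "i \<le> b" "j \<le> r" "i + j > 0" by (cases a) auto
    then have "2 * (r - j) + (b + j - i) < 2 * r + b" by auto
    from less.hyps[OF this] show "(case a of (i, j) \<Rightarrow> (- 1) ^ (i + j) * (qbinom q b i * qbinom q r j) * A (r - j) (b + j - i)) =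
      (case a of (i, j) \<Rightarrow> (- 1) ^ (i + j) * (qbinom q b i * qbinom q r j) * B (r - j) (b + j - i))"
      by (simp add: a)
  qed
  then show ?case using assms[of r b] unfolding split by simp
qed

text \<open>After substitution \<open>(r - j) + (b + j - i) = r + b - i\<close> no longer contains
  \<open>j\<close>, so the double sum factors into a sum \<open>X\<close> over \<open>j\<close> and
  a sum \<open>Y\<close> over \<open>i\<close>. The inversion applied to \<open>X\<close> forces
  \<open>r' = r\<close>; only then does \<open>Y\<close> have the right form for the inversion to
  force \<open>b' = b\<close>.\<close>

lemma pieri_system_hsym_coeff:
  assumes q: "norm q < 1"
  shows "pieri_system q (\<lambda>r b. \<Sum>r'\<le>r. \<Sum>b'\<le>r + b - r'. hsym_coeff q r b r' b' * a r' b') r b = a r b"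
proof -
  have zero: "hsym_coeff q r b r' b' = 0" if "r < r' \<or> r + b - r' < b'" for r b r' b'
    using that by (auto simp: hsym_coeff_def qbinom_eq_0)
  have ext: "(\<Sum>r'\<le>r - j. \<Sum>b'\<le>(r - j) + (b + j - i) - r'. hsym_coeff q (r - j) (b + j - i) r' b' * a r' b') =
     (\<Sum>r'\<le>r. \<Sum>b'\<le>r + b - r'. hsym_coeff q (r - j) (b + j - i) r' b' * a r' b')" if "i \<le> b" "j \<le> r" for i j
  proof -
    have "(\<Sum>r'\<le>r - j. \<Sum>b'\<le>(r - j) + (b + j - i) - r'. hsym_coeff q (r - j) (b + j - i) r' b' * a r' b') =
      (\<Sum>r'\<le>r - j. \<Sum>b'\<le>r + b - r'. hsym_coeff q (r - j) (b + j - i) r' b' * a r' b')"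
      by (intro sum.cong refl sum.mono_neutral_left) (use that in \<open>auto simp: zero\<close>)
    also have "\<dots> = (\<Sum>r'\<le>r. \<Sum>b'\<le>r + b - r'. hsym_coeff q (r - j) (b + j - i) r' b' * a r' b')"
      by (intro sum.mono_neutral_left) (auto simp: zero intro!: sum.neutral)
    finally show ?thesis .
  qed
  define X where "X r' = (\<Sum>j\<le>r. (- 1) ^ j * qbinom q r j * (qbinom q (r - j) r' * q ^ tri (r - j - r')))" for r'
  define Y where "Y r' b' = (\<Sum>i\<le>b. (- 1) ^ i * qbinom q b i * (qbinom q (r + b - i - r') b' * q ^ tri (r + b - i - r' - b')))" for r' b'
  have "pieri_system q (\<lambda>r b. \<Sum>r'\<le>r. \<Sum>b'\<le>r + b - r'. hsym_coeff q r b r' b' * a r' b') r b =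
    (\<Sum>i\<le>b. \<Sum>j\<le>r. \<Sum>r'\<le>r. \<Sum>b'\<le>r + b - r'.
      (- 1) ^ (i + j) * (qbinom q b i * qbinom q r j) * (hsym_coeff q (r - j) (b + j - i) r' b' * a r' b'))"
    unfolding pieri_system_def
    by (intro sum.cong refl, subst ext) (simp, simp, simp only: sum_distrib_left)
  also have "\<dots> = (\<Sum>r'\<le>r. \<Sum>b'\<le>r + b - r'. \<Sum>i\<le>b. \<Sum>j\<le>r.
      (- 1) ^ (i + j) * (qbinom q b i * qbinom q r j) * (hsym_coeff q (r - j) (b + j - i) r' b' * a r' b'))"
    by (rule sum_swap_pairs)
  also have "\<dots> = (\<Sum>r'\<le>r. \<Sum>b'\<le>r + b - r'. X r' * Y r' b' * a r' b')"
  proof (intro sum.cong refl)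
    fix r' b'
    have "(- 1) ^ (i + j) * (qbinom q b i * qbinom q r j) * (hsym_coeff q (r - j) (b + j - i) r' b' * a r' b') =
       ((- 1) ^ j * qbinom q r j * (qbinom q (r - j) r' * q ^ tri (r - j - r'))) *
       ((- 1) ^ i * qbinom q b i * (qbinom q (r + b - i - r') b' * q ^ tri (r + b - i - r' - b'))) * a r' b'"
      if "i \<in> {..b}" "j \<in> {..r}" for i j
    proof -
      have "r - j + (b + j - i) = r + b - i" using that by auto
      then show ?thesis by (simp add: hsym_coeff_def power_add mult_ac)
    qed
    then have "(\<Sum>i\<le>b. \<Sum>j\<le>r. (- 1) ^ (i + j) * (qbinom q b i * qbinom q r j) * (hsym_coeff q (r - j) (b + j - i) r' b' * a r' b')) =
      (\<Sum>i\<le>b. \<Sum>j\<le>r. ((- 1) ^ j * qbinom q r j * (qbinom q (r - j) r' * q ^ tri (r - j - r'))) *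
       ((- 1) ^ i * qbinom q b i * (qbinom q (r + b - i - r') b' * q ^ tri (r + b - i - r' - b'))) * a r' b')"
      by (intro sum.cong refl)
    also have "\<dots> = X r' * Y r' b' * a r' b'"
      unfolding X_def Y_def sum_product unfolding sum_distrib_right by (rule sum.swap)
    finally show "(\<Sum>i\<le>b. \<Sum>j\<le>r. (- 1) ^ (i + j) * (qbinom q b i * qbinom q r j) * (hsym_coeff q (r - j) (b + j - i) r' b' * a r' b')) =
      X r' * Y r' b' * a r' b'" .
  qed
  also have "\<dots> = (\<Sum>r'\<le>r. if r' = r then \<Sum>b'\<le>b. Y r b' * a r b' else 0)"
  proof -
    have "X r' = (if r' = r then 1 else 0)" for r'
      unfolding X_def by (rule qbinom_inversion[OF q])
    then show ?thesis by (intro sum.cong refl) simp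
  qed
  also have "\<dots> = (\<Sum>b'\<le>b. Y r b' * a r b')" by simp
  also have "\<dots> = (\<Sum>b'\<le>b. if b' = b then a r b else 0)"
  proof (intro sum.cong refl)
    fix b'
    have "Y r b' = (\<Sum>i\<le>b. (- 1) ^ i * qbinom q b i * (qbinom q (b - i) b' * q ^ tri (b - i - b')))"
      unfolding Y_def
    proof (intro sum.cong refl)
      fix i assume "i \<in> {..b}"
      then have "r + b - i - r = b - i" by simp
      then show "(- 1) ^ i * qbinom q b i * (qbinom q (r + b - i - r) b' * q ^ tri (r + b - i - r - b')) =
        (- 1) ^ i * qbinom q b i * (qbinom q (b - i) b' * q ^ tri (b - i - b'))" by simp
    qed
    also have "\<dots> = (if b' = b then 1 else 0)" by (rule qbinom_inversion[OF q])
    finally show "Y r b' * a r b' = (if b' = b then a r b else 0)" by simp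
  qed
  finally show ?thesis by simp
qed

text \<open>Comparing coefficients in the alternating sum of \<open>e_m * h_(k - m) * f\<close>,
  which is \<open>f\<close> for \<open>k = 0\<close> and zero otherwise, gives
  \<open>pieri_system\<close> for the unknown coefficients; \<open>hsym_coeff\<close> provides its
  unique solution.\<close>

lemma expands_hsym_two_columns:
  assumes q: "norm q < 1"
    and K: "expands d f K" and A: "\<And>k. expands (d + k) (\<lambda>N x. hsym N k x * f N x) (A k)"
    and rb: "2 * r + b = d + k"
  shows "eval_int_poly (A k (two_columns r b)) q =
    (\<Sum>r'\<le>r. \<Sum>b'\<le>r + b - r'. hsym_coeff q r b r' b' * eval_int_poly (K (two_columns r' b')) q)"
proof -
  \<comment> \<open>Sizes below \<open>d\<close> get the value 0, so that the equations hold for all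
    \<open>r\<close> and \<open>b\<close> and uniqueness can be applied to the whole system.\<close>
  define B where "B r b = (if d \<le> 2 * r + b then eval_int_poly (A (2 * r + b - d) (two_columns r b)) q else 0)" for r b
  define a where "a r b = eval_int_poly (K (two_columns r b)) q" for r b
  have a0: "a r b = 0" if "2 * r + b \<noteq> d" for r b
    using K that by (simp add: a_def expands_def two_columns_in_partitions_of)
  have sys: "pieri_system q B r b = a r b" for r b
  proof (cases "d \<le> 2 * r + b")
    case False
    then have "B (r - j) (b + j - i) = 0" if "i \<le> b" "j \<le> r" for i j
      using that by (auto simp: B_def)
    then have "pieri_system q B r b = 0" by (auto simp: pieri_system_def intro!: sum.neutral)
    then show ?thesis using a0[of r b] False by simp
  next
    case True
    define k where "k = 2 * r + b - d"
    have k: "2 * r + b = d + k" using True by (simp add: k_def)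
    let ?E = "\<lambda>i \<nu>. if \<nu> \<in> partitions_of (d + k) then \<Sum>\<mu>\<in>partitions_of (d + (k - i)). pieri_coeff [:0, 1:] i \<nu> \<mu> * A (k - i) \<mu> else 0"
    have "expands (d + k) (\<lambda>N x. esym N i x * (hsym N (k - i) x * f N x)) (?E i)" if "i \<in> {..k}" for i
      using expands_esym[OF A[of "k - i"], of i] that by simp
    from expands_sum[OF finite_atMost this, where c = "\<lambda>i. (- 1) ^ i"]
    have e1: "expands (d + k) (\<lambda>N x. \<Sum>i\<le>k. of_int ((- 1) ^ i) * (esym N i x * (hsym N (k - i) x * f N x)))
      (\<lambda>\<nu>. \<Sum>i\<le>k. of_int ((- 1) ^ i) * ?E i \<nu>)" .
    have eq: "(\<lambda>N x. \<Sum>i\<le>k. of_int ((- 1) ^ i) * (esym N i x * (hsym N (k - i) x * f N x))) =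
       (\<lambda>N x. of_bool (k = 0) * f N x)"
    proof (intro ext)
      fix N x
      have "(\<Sum>i\<le>k. of_int ((- 1) ^ i) * (esym N i x * (hsym N (k - i) x * f N x))) =
         (\<Sum>i\<le>k. (- 1) ^ i * esym N i x * hsym N (k - i) x) * f N x"
        by (simp add: sum_distrib_right mult.assoc)
      then show "(\<Sum>i\<le>k. of_int ((- 1) ^ i) * (esym N i x * (hsym N (k - i) x * f N x))) = of_bool (k = 0) * f N x"
        by (simp only: sum_esym_hsym)
    qed
    have e2: "expands (d + k) (\<lambda>N x. of_bool (k = 0) * f N x) (\<lambda>\<mu>. of_bool (k = 0) * K \<mu>)"
      using K by (cases "k = 0") (simp_all add: expands_def)
    let ?S = "\<lambda>m. \<Sum>\<mu>\<in>partitions_of (d + (k - m)). pieri_coeff q m (two_columns r b) \<mu> * eval_int_poly (A (k - m) \<mu>) q"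
    let ?T = "\<lambda>m i j. if m = i + j then (- 1) ^ (i + j) * (qbinom q b i * qbinom q r j) * B (r - j) (b + j - i) else 0"
    have t: "two_columns r b \<in> partitions_of (d + k)" using k by (simp add: two_columns_in_partitions_of)
    from arg_cong[OF expands_unique[OF e1[unfolded eq] e2], of "\<lambda>g. eval_int_poly (g (two_columns r b)) q"]
    have "(\<Sum>m\<le>k. (- 1) ^ m * ?S m) =
       of_bool (k = 0) * a r b"
      by (simp only: t if_True eval_int_poly_sum eval_int_poly_mult eval_int_poly_of_int eval_int_poly_pieri_coeff
          eval_int_poly_X eval_int_poly_of_bool a_def
          eval_int_poly_power eval_int_poly_uminus eval_int_poly_1 of_int_power of_int_minus of_int_1)
    moreover have "(\<Sum>m\<le>k. (- 1) ^ m * ?S m) =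
       pieri_system q B r b"
    proof -
      have "(\<Sum>m\<le>k. (- 1) ^ m * ?S m) =
        (\<Sum>m\<le>k. \<Sum>i\<le>b. \<Sum>j\<le>r. ?T m i j)"
      proof (intro sum.cong refl)
        fix m assume m: "m \<in> {..k}"
        have "2 * r + b = (d + (k - m)) + m" using k m by auto
        note S = sum_pieri_coeff_two_columns[OF this, of q "\<lambda>\<mu>. eval_int_poly (A (k - m) \<mu>) q"]
        show "(- 1) ^ m * ?S m =
          (\<Sum>i\<le>b. \<Sum>j\<le>r. ?T m i j)"
          unfolding S unfolding sum_distrib_left
        proof (intro sum.cong refl)
          fix i j assume ij: "i \<in> {..b}" "j \<in> {..r}"
          have "B (r - j) (b + j - i) = eval_int_poly (A (k - m) (two_columns (r - j) (b + j - i))) q" if "i + j = m"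
          proof -
            have "2 * (r - j) + (b + j - i) = d + (k - m)" using k m ij that by auto
            then show ?thesis unfolding B_def by simp
          qed
          then show "(- 1) ^ m * (of_bool (i + j = m) * (qbinom q b (b - i) * qbinom q r (r - j) * eval_int_poly (A (k - m) (two_columns (r - j) (b + j - i))) q)) =
            ?T m i j"
            using ij by (auto simp: qbinom_symmetric[OF q])
        qed
      qed
      also have "\<dots> = (\<Sum>i\<le>b. \<Sum>m\<le>k. \<Sum>j\<le>r. ?T m i j)"
        by (rule sum.swap)
      also have "\<dots> = (\<Sum>i\<le>b. \<Sum>j\<le>r. \<Sum>m\<le>k. ?T m i j)"
        by (rule sum.cong[OF refl], rule sum.swap)
      also have "\<dots> = pieri_system q B r b"
        unfolding pieri_system_def
      proof (intro sum.cong refl)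
        fix i j assume ij: "i \<in> {..b}" "j \<in> {..r}"
        show "(\<Sum>m\<le>k. ?T m i j) =
          (- 1) ^ (i + j) * (qbinom q b i * qbinom q r j) * B (r - j) (b + j - i)"
        proof (cases "i + j \<le> k")
          case False
          then have "B (r - j) (b + j - i) = 0" using ij k by (auto simp: B_def)
          then show ?thesis by (simp only: mult_zero_right if_cancel sum.neutral_const)
        qed simp
      qed
      finally show ?thesis .
    qed
    ultimately show ?thesis using a0[of r b] k by (cases "k = 0") auto
  qed
  have "B r b = (\<Sum>r'\<le>r. \<Sum>b'\<le>r + b - r'. hsym_coeff q r b r' b' * a r' b')"
    by (rule pieri_system_unique[where q = q]) (simp only: sys pieri_system_hsym_coeff[OF q])
  then show ?thesis using rb by (simp add: B_def a_def)
qed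

section \<open>The recursion of Q' in the number of variables\<close>

lemma modified_hall_littlewood_0:
  "modified_hall_littlewood 0 x q (two_columns r b) = of_bool (r = 0 \<and> b = 0)"
proof -
  have "modified_hall_littlewood 0 x q (two_columns r b) =
    (\<Sum>\<nu>\<in>partitions_of (2 * r + b). if \<nu> = [] then eval_int_poly (kostka_foulkes \<nu> (two_columns r b)) q else 0)"
    unfolding modified_hall_littlewood_def eval_int_poly_def[symmetric] sum_list_two_columns
    by (intro sum.cong refl) (simp add: schur_0 partitions_of_iff)
  also have "\<dots> = of_bool (r = 0 \<and> b = 0)"
  proof (cases "r = 0 \<and> b = 0")
    case True
    then show ?thesis by (simp add: partitions_of_0 kostka_foulkes_Nil)
  next
    case False
    then have "[] \<notin> partitions_of (2 * r + b)" by (simp add: partitions_of_iff)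
    then have "(\<Sum>\<nu>\<in>partitions_of (2 * r + b). if \<nu> = [] then eval_int_poly (kostka_foulkes \<nu> (two_columns r b)) q else 0) = 0"
      by (intro sum.neutral) auto
    then show ?thesis using False by simp
  qed
  finally show ?thesis .
qed

text \<open>Branching turns the Schur function of \<nu> into those of its inner strips \<kappa>.
  With \<kappa> fixed, the Kostka--Foulkes polynomials of its outer strips \<nu> add up to an
  expansion coefficient of a complete symmetric function times the Schur function of \<kappa>, which
  \<open>expands_hsym_two_columns\<close> evaluates.\<close>

lemma modified_hall_littlewood_Suc:
  assumes q: "norm q < 1"
  shows "modified_hall_littlewood (Suc N) x q (two_columns r b) =
    (\<Sum>r'\<le>r. \<Sum>b'\<le>r + b - r'. hsym_coeff q r b r' b' * x N ^ (2 * r + b - (2 * r' + b')) *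
      modified_hall_littlewood N x q (two_columns r' b'))"
proof -
  define D where "D = 2 * r + b"
  let ?\<tau> = "two_columns r b"
  let ?e = "\<lambda>\<nu> \<mu>. eval_int_poly (kostka_foulkes \<nu> \<mu>) q"
  have fin: "finite (\<Union>m\<le>D. partitions_of m)" by simp
  have "modified_hall_littlewood (Suc N) x q ?\<tau> =
      (\<Sum>\<nu>\<in>partitions_of D. \<Sum>\<kappa>\<in>inner_strips \<nu>. ?e \<nu> ?\<tau> * (x N ^ (D - sum_list \<kappa>) * schur N x \<kappa>))"
    unfolding modified_hall_littlewood_def eval_int_poly_def[symmetric] sum_list_two_columns D_def[symmetric]
    by (intro sum.cong refl) (simp add: schur_branching partitions_of_iff sum_distrib_left)
  also have "\<dots> = (\<Sum>(\<nu>, \<kappa>)\<in>Sigma (partitions_of D) inner_strips. ?e \<nu> ?\<tau> * (x N ^ (D - sum_list \<kappa>) * schur N x \<kappa>))"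
    by (simp add: sum.Sigma)
  \<comment> \<open>The same pairs, now listed by the inner partition and its size
    \<open>m\<close>.\<close>
  also have "\<dots> = (\<Sum>(m, \<kappa>, \<nu>)\<in>(SIGMA m:{..D}. SIGMA \<kappa>:partitions_of m. outer_strips \<kappa> (D - m)).
      ?e \<nu> ?\<tau> * (x N ^ (D - sum_list \<kappa>) * schur N x \<kappa>))"
    by (rule sum.reindex_bij_witness[of _ "\<lambda>(m, \<kappa>, \<nu>). (\<nu>, \<kappa>)" "\<lambda>(\<nu>, \<kappa>). (sum_list \<kappa>, \<kappa>, \<nu>)"])
       (auto simp: inner_strips_def outer_strips_def partitions_of_iff strip_sum_list_le)
  also have "\<dots> = (\<Sum>m\<le>D. \<Sum>\<kappa>\<in>partitions_of m. x N ^ (D - m) * schur N x \<kappa> * (\<Sum>\<nu>\<in>outer_strips \<kappa> (D - m). ?e \<nu> ?\<tau>))"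
    by (simp add: sum.Sigma[symmetric] sum_distrib_left) (intro sum.cong refl, simp add: partitions_of_iff)
  also have "\<dots> = (\<Sum>m\<le>D. \<Sum>\<kappa>\<in>partitions_of m. x N ^ (D - m) * schur N x \<kappa> *
      (\<Sum>r'\<le>r. \<Sum>b'\<le>r + b - r'. hsym_coeff q r b r' b' * ?e \<kappa> (two_columns r' b')))"
  proof (intro sum.cong refl arg_cong2[where f = "(*)"])
    fix m \<kappa> assume m: "m \<in> {..D}" and "\<kappa> \<in> partitions_of m"
    then have \<kappa>: "is_partition \<kappa>" "sum_list \<kappa> = m" by (auto simp: partitions_of_iff)
    have "expands (m + k) (\<lambda>N x. hsym N k x * schur N x \<kappa>) (\<lambda>\<mu>. \<Sum>\<nu>\<in>outer_strips \<kappa> k. kostka_foulkes \<nu> \<mu>)" for k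
    proof -
      have "expands (m + k) (\<lambda>N x. schur N x \<nu>) (kostka_foulkes \<nu>)" if "\<nu> \<in> outer_strips \<kappa> k" for \<nu>
        using expands_kostka_foulkes[of \<nu>] that \<kappa> by (simp add: outer_strips_def partitions_of_iff)
      from expands_sum[OF finite_outer_strips this, where c = "\<lambda>_. 1"] show ?thesis
        by (simp add: hsym_mult_schur[OF \<kappa>(1)])
    qed
    from expands_hsym_two_columns[OF q expands_kostka_foulkes[OF \<kappa>(1), unfolded \<kappa>(2)] this, of r b "D - m"] m
    show "(\<Sum>\<nu>\<in>outer_strips \<kappa> (D - m). ?e \<nu> ?\<tau>) =
      (\<Sum>r'\<le>r. \<Sum>b'\<le>r + b - r'. hsym_coeff q r b r' b' * ?e \<kappa> (two_columns r' b'))"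
      by (simp add: D_def)
  qed
  also have "\<dots> = (\<Sum>r'\<le>r. \<Sum>b'\<le>r + b - r'. \<Sum>m\<le>D. \<Sum>\<kappa>\<in>partitions_of m. x N ^ (D - m) * schur N x \<kappa> *
      (hsym_coeff q r b r' b' * ?e \<kappa> (two_columns r' b')))"
    unfolding sum_distrib_left by (rule sum_swap_pairs)
  also have "\<dots> = (\<Sum>r'\<le>r. \<Sum>b'\<le>r + b - r'. hsym_coeff q r b r' b' * x N ^ (2 * r + b - (2 * r' + b')) *
      modified_hall_littlewood N x q (two_columns r' b'))"
  proof (intro sum.cong refl)
    fix r' b' assume r': "r' \<in> {..r}" "b' \<in> {..r + b - r'}"
    define d where "d = 2 * r' + b'"
    have "d \<le> D" using r' by (auto simp: d_def D_def)
    \<comment> \<open>Kostka--Foulkes polynomials vanish between partitions of different sizes, so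
      only \<open>m = d\<close> survives.\<close>
    have "(\<Sum>m\<le>D. \<Sum>\<kappa>\<in>partitions_of m. x N ^ (D - m) * schur N x \<kappa> * (hsym_coeff q r b r' b' * ?e \<kappa> (two_columns r' b'))) =
      (\<Sum>m\<in>{d}. \<Sum>\<kappa>\<in>partitions_of m. x N ^ (D - m) * schur N x \<kappa> * (hsym_coeff q r b r' b' * ?e \<kappa> (two_columns r' b')))"
    proof (intro sum.mono_neutral_right ballI)
      fix m assume m: "m \<in> {..D} - {d}"
      have "kostka_foulkes \<kappa> (two_columns r' b') = 0" if "\<kappa> \<in> partitions_of m" for \<kappa>
      proof -
        have "is_partition \<kappa>" "sum_list \<kappa> = m" using that by (auto simp: partitions_of_iff)
        moreover have "two_columns r' b' \<notin> partitions_of m" using m by (simp add: two_columns_in_partitions_of d_def)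
        ultimately show ?thesis using expands_kostka_foulkes[of \<kappa>] by (simp add: expands_def)
      qed
      then show "(\<Sum>\<kappa>\<in>partitions_of m. x N ^ (D - m) * schur N x \<kappa> * (hsym_coeff q r b r' b' * ?e \<kappa> (two_columns r' b'))) = 0"
        by (intro sum.neutral) simp
    qed (use \<open>d \<le> D\<close> in auto)
    also have "\<dots> = hsym_coeff q r b r' b' * x N ^ (2 * r + b - (2 * r' + b')) * modified_hall_littlewood N x q (two_columns r' b')"
      unfolding modified_hall_littlewood_def eval_int_poly_def[symmetric] sum_list_two_columns
      by (simp add: sum_distrib_left d_def D_def mult_ac)
    finally show "(\<Sum>m\<le>D. \<Sum>\<kappa>\<in>partitions_of m. x N ^ (D - m) * schur N x \<kappa> * (hsym_coeff q r b r' b' * ?e \<kappa> (two_columns r' b'))) =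
      hsym_coeff q r b r' b' * x N ^ (2 * r + b - (2 * r' + b')) * modified_hall_littlewood N x q (two_columns r' b')" .
  qed
  finally show ?thesis .
qed

section \<open>The multisum\<close>

lemma prod_le_exp_geometric:
  fixes \<rho> c :: real
  assumes "0 \<le> \<rho>" "\<rho> < 1" "0 \<le> c" "\<And>i. 0 \<le> f i" "\<And>i. f i \<le> 1 + c * \<rho> ^ Suc i"
  shows "(\<Prod>i<n. f i) \<le> exp (c / (1 - \<rho>))"
proof -
  have "(\<Prod>i<n. f i) \<le> (\<Prod>i<n. exp (c * \<rho> ^ Suc i))"
    by (intro prod_mono conjI assms(4) order_trans[OF assms(5) exp_ge_add_one_self])
  also have "\<dots> = exp (c * (\<Sum>i<n. \<rho> ^ Suc i))"
    by (simp add: exp_sum sum_distrib_left)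
  also have "(\<Sum>i<n. \<rho> ^ Suc i) \<le> (\<Sum>i. \<rho> ^ i)"
  proof -
    have "(\<Sum>i<n. \<rho> ^ Suc i) \<le> (\<Sum>i<n. \<rho> ^ i)"
      using assms by (intro sum_mono) (simp add: mult_left_le_one_le)
    also have "\<dots> \<le> (\<Sum>i. \<rho> ^ i)"
      using assms by (intro sum_le_suminf) (auto intro: summable_geometric)
    finally show ?thesis .
  qed
  also have "(\<Sum>i. \<rho> ^ i) = 1 / (1 - \<rho>)" using assms by (intro suminf_geometric) simp
  finally show ?thesis using assms by (simp add: mult_left_mono)
qed

text \<open>The factors of the Pochhammer symbols and of their inverses exceed 1 by at most a
  geometric sequence, so one constant serves all \<open>n\<close> and \<open>k\<close>. It enters
  every domination argument below.\<close>

lemma qpoch_bounds: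
  fixes q :: complex
  assumes "norm q < 1"
  obtains C where "C \<ge> 1" "\<And>n. norm (1 / qpoch q q n) \<le> C" "\<And>n k. norm (qbinom q n k) \<le> C"
proof -
  define \<rho> where "\<rho> = norm q"
  have \<rho>: "0 \<le> \<rho>" "\<rho> < 1" using assms by (auto simp: \<rho>_def)
  define A where "A = exp (1 / (1 - \<rho>))"
  define B where "B = exp (1 / (1 - \<rho>) / (1 - \<rho>))"
  have A: "norm (qpoch q q n) \<le> A" for n
  proof -
    have "norm (1 - q * q ^ i) \<le> 1 + 1 * \<rho> ^ Suc i" for i
      using norm_triangle_ineq4[of 1 "q ^ Suc i"] by (simp add: norm_mult norm_power \<rho>_def)
    then show ?thesis
      unfolding qpoch_def A_def prod_norm[symmetric] by (intro prod_le_exp_geometric \<rho>) auto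
  qed
  have B: "norm (1 / qpoch q q n) \<le> B" for n
  proof -
    have f: "norm (1 / (1 - q * q ^ i)) \<le> 1 + 1 / (1 - \<rho>) * \<rho> ^ Suc i" for i
    proof -
      define u where "u = \<rho> ^ Suc i"
      have u: "0 \<le> u" "u \<le> \<rho>" using \<rho> by (auto simp: u_def mult_left_le power_le_one)
      have "1 - u \<le> norm (1 - q * q ^ i)"
        using norm_triangle_ineq2[of 1 "q ^ Suc i"] by (simp add: norm_mult norm_power u_def \<rho>_def)
      then have "norm (1 / (1 - q * q ^ i)) \<le> 1 / (1 - u)"
        using u \<rho> by (simp add: norm_divide frac_le)
      also have "\<dots> = 1 + u / (1 - u)" using u \<rho> by (simp add: field_simps)
      also have "\<dots> \<le> 1 + u / (1 - \<rho>)" using u \<rho> by (simp add: frac_le)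
      finally show ?thesis by (simp add: u_def)
    qed
    have "norm (1 / qpoch q q n) = (\<Prod>i<n. norm (1 / (1 - q * q ^ i)))"
      by (simp add: qpoch_def norm_divide prod_norm[symmetric] prod_dividef)
    also have "\<dots> \<le> B"
      unfolding B_def using \<rho> f by (intro prod_le_exp_geometric) auto
    finally show ?thesis .
  qed
  have AB: "A \<ge> 1" "B \<ge> 1" using \<rho> by (auto simp: A_def B_def)
  have "norm (qbinom q n k) \<le> A * B * B" for n k
  proof (cases "k \<le> n")
    case True
    then have "norm (qbinom q n k) = norm (qpoch q q n) * norm (1 / qpoch q q k) * norm (1 / qpoch q q (n - k))"
      by (simp add: qbinom_eq_divide[OF assms] norm_divide norm_mult)
    also have "\<dots> \<le> A * B * B" using A B AB by (intro mult_mono) auto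
    finally show ?thesis .
  qed (use AB in \<open>simp add: qbinom_eq_0 not_le\<close>)
  moreover have "B \<le> A * B * B" "1 \<le> A * B * B"
  proof -
    have "1 \<le> A * B" using AB mult_mono[of 1 A 1 B] by simp
    then show "B \<le> A * B * B" "1 \<le> A * B * B" using AB mult_mono[of 1 "A * B" 1 B] mult_right_mono[of 1 "A * B" B] by auto
  qed
  ultimately show ?thesis using that[of "A * B * B"] B order_trans by blast
qed

lemma summable_power_tri:
  fixes R \<rho> :: real
  assumes "0 \<le> R" "0 \<le> \<rho>" "\<rho> < 1"
  shows "summable (\<lambda>k. R ^ k * \<rho> ^ tri k)"
proof -
  have "(\<lambda>k. R * \<rho> ^ k) \<longlonglongrightarrow> R * 0" using assms by (intro tendsto_intros LIMSEQ_realpow_zero)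
  then have "\<forall>\<^sub>F k in sequentially. R * \<rho> ^ k < 1 / 2" by (rule order_tendstoD) simp
  then obtain K where K: "\<And>k. k \<ge> K \<Longrightarrow> R * \<rho> ^ k < 1 / 2" by (auto simp: eventually_sequentially)
  show ?thesis
  proof (rule summable_ratio_test[of "1 / 2" K])
    fix k assume "k \<ge> K"
    have "R ^ Suc k * \<rho> ^ tri (Suc k) = (R * \<rho> ^ k) * (R ^ k * \<rho> ^ tri k)"
      by (simp add: power_add mult_ac)
    also have "\<dots> \<le> 1 / 2 * (R ^ k * \<rho> ^ tri k)"
      using K[OF \<open>k \<ge> K\<close>] assms by (intro mult_right_mono) auto
    finally show "norm (R ^ Suc k * \<rho> ^ tri (Suc k)) \<le> 1 / 2 * norm (R ^ k * \<rho> ^ tri k)"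
      using assms by (simp add: abs_mult)
  qed simp
qed

lemma summable_nonneg_imp_summable_on:
  fixes f :: "nat \<Rightarrow> real"
  assumes "summable f" "\<And>n. 0 \<le> f n"
  shows "f summable_on UNIV"
  using assms by (intro norm_summable_imp_summable_on) simp

lemma summable_on_times:
  fixes f g :: "_ \<Rightarrow> real"
  assumes "f summable_on A" "g summable_on B" "\<And>a. a \<in> A \<Longrightarrow> 0 \<le> f a" "\<And>b. b \<in> B \<Longrightarrow> 0 \<le> g b"
  shows "(\<lambda>(a, b). f a * g b) summable_on A \<times> B"
proof (rule summable_on_SigmaI)
  show "((\<lambda>b. case (a, b) of (a, b) \<Rightarrow> f a * g b) has_sum f a * infsum g B) B" for a
    using has_sum_cmult_right[OF has_sum_infsum[OF assms(2)]] by simp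
  show "(\<lambda>a. f a * infsum g B) summable_on A" by (intro summable_on_cmult_left assms)
qed (use assms in auto)

lemma bij_betw_PiE_Suc:
  "bij_betw (\<lambda>(n, r). r(N := n)) (UNIV \<times> ({..<N::nat} \<rightarrow>\<^sub>E UNIV)) ({..<Suc N} \<rightarrow>\<^sub>E UNIV)"
proof -
  have "inj_on (\<lambda>(n, r). r(N := n)) (UNIV \<times> ({..<N} \<rightarrow>\<^sub>E UNIV))"
    by (rule inj_combinator) simp
  then show ?thesis
    unfolding bij_betw_def lessThan_Suc PiE_insert_eq by simp
qed

lemma summable_on_prod_PiE:
  fixes f :: "nat \<Rightarrow> nat \<Rightarrow> real"
  assumes "\<And>i. f i summable_on UNIV" "\<And>i k. 0 \<le> f i k"
  shows "(\<lambda>r. \<Prod>i<N. f i (r i)) summable_on ({..<N} \<rightarrow>\<^sub>E UNIV)"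
proof (induction N)
  case (Suc N)
  have "(\<lambda>(n, r). f N n * (\<Prod>i<N. f i (r i))) summable_on UNIV \<times> ({..<N} \<rightarrow>\<^sub>E UNIV)"
    using assms by (intro summable_on_times Suc.IH prod_nonneg) auto
  also have "(\<lambda>(n, r). f N n * (\<Prod>i<N. f i (r i))) = (\<lambda>p. (\<Prod>i<Suc N. f i ((case p of (n, r) \<Rightarrow> r(N := n)) i)))"
    by (auto simp: fun_eq_iff mult.commute)
  finally show ?case
    using summable_on_reindex_bij_betw[OF bij_betw_PiE_Suc, of "\<lambda>r. \<Prod>i<Suc N. f i (r i)" N] by simp
qed simp

lemma has_sum_sum:
  fixes f :: "'i \<Rightarrow> 'a \<Rightarrow> complex"
  assumes "finite I" "\<And>i. i \<in> I \<Longrightarrow> (f i has_sum S i) A"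
  shows "((\<lambda>a. \<Sum>i\<in>I. f i a) has_sum (\<Sum>i\<in>I. S i)) A"
  using assms by (induction I rule: finite_induct) (auto intro: has_sum_add)

text \<open>With \<open>r\<close> extended by 0 at both ends, twice the form is the sum of the
  squared differences of neighbours. Each \<open>r k\<close> telescopes into at most
  \<open>N\<close> of these differences, so Cauchy--Schwarz bounds its square by
  \<open>2 * N\<close> times the form; the sum over \<open>k\<close> gives another factor
  \<open>N\<close>.\<close>

lemma quadratic_form_bound:
  fixes r :: "nat \<Rightarrow> nat"
  shows "(\<Sum>i<N. int (r i) ^ 2) \<le> 2 * int N ^ 2 * half_cartan_form N r"
proof (cases N)
  case (Suc M)
  define d where "d i = (case i of 0 \<Rightarrow> int (r 0) | Suc j \<Rightarrow> int (r (Suc j)) - int (r j))" for i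
  have tel: "int (r k) = (\<Sum>i\<le>k. d i)" for k
    by (induction k) (auto simp: d_def)
  have form: "2 * half_cartan_form N r = (\<Sum>i<N. d i ^ 2) + int (r M) ^ 2"
  proof -
    have "2 * ((\<Sum>i\<le>m. int (r i) ^ 2) - (\<Sum>i<m. int (r i) * int (r (Suc i)))) = (\<Sum>i\<le>m. d i ^ 2) + int (r m) ^ 2" for m
      by (induction m) (auto simp: d_def power2_eq_square algebra_simps)
    from this[of M] show ?thesis by (simp add: half_cartan_form_eq Suc lessThan_Suc_atMost)
  qed
  have "int (r k) ^ 2 \<le> int N * (2 * half_cartan_form N r)" if "k < N" for k
  proof -
    have "real_of_int ((\<Sum>i\<le>k. d i) ^ 2) \<le> real_of_int (int (Suc k) * (\<Sum>i\<le>k. d i ^ 2))"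
      using sum_squared_le_sum_of_squares[of "\<lambda>i. real_of_int (d i)" "{..k}"] by (simp add: mult.commute)
    then have "int (r k) ^ 2 \<le> int (Suc k) * (\<Sum>i\<le>k. d i ^ 2)" unfolding tel by linarith
    also have "\<dots> \<le> int N * (2 * half_cartan_form N r)"
    proof (rule mult_mono)
      have "(\<Sum>i\<le>k. d i ^ 2) \<le> (\<Sum>i<N. d i ^ 2)" using that by (intro sum_mono2) auto
      then show "(\<Sum>i\<le>k. d i ^ 2) \<le> 2 * half_cartan_form N r" unfolding form by (simp add: add_increasing2)
    qed (use that in \<open>auto intro: sum_nonneg\<close>)
    finally show ?thesis .
  qed
  then have "(\<Sum>i<N. int (r i) ^ 2) \<le> (\<Sum>i<N. int N * (2 * half_cartan_form N r))" by (intro sum_mono) auto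
  then show ?thesis by (simp add: power2_eq_square mult_ac)
qed (simp add: half_cartan_form_eq)

lemma half_cartan_form_nonneg: "half_cartan_form N r \<ge> 0"
proof (cases "N = 0")
  case False
  have "0 \<le> (\<Sum>i<N. int (r i) ^ 2)" by (intro sum_nonneg) auto
  then have "0 \<le> 2 * int N ^ 2 * half_cartan_form N r" using quadratic_form_bound order_trans by blast
  then show ?thesis using False by (simp add: zero_le_mult_iff)
qed (simp add: half_cartan_form_eq)

text \<open>The parameter \<open>s\<close> acts as the fixed value of one further coordinate,
  coupled to the last one by the off-diagonal Cartan entry; its own square and Pochhammer symbol are
  left out. When variables are removed one by one, the index of the functional is this boundary
  value.\<close>

definition multisum_term :: "complex \<Rightarrow> (nat \<Rightarrow> complex) \<Rightarrow> nat \<Rightarrow> nat \<Rightarrow> (nat \<Rightarrow> nat) \<Rightarrow> complex" where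
  "multisum_term q w s N r = q powi (half_cartan_form N r - (if N = 0 then 0 else int s * int (r (N - 1)))) *
     (\<Prod>i<N. w i ^ r i) / (\<Prod>i<N. qpoch q q (r i))"

lemma multisum_term_Suc:
  assumes "q \<noteq> 0"
  shows "multisum_term q w s (Suc N) (r(N := n)) =
    q powi (int n * int n - int s * int n) * w N ^ n / qpoch q q n * multisum_term q w n N r"
proof -
  have "half_cartan_form (Suc N) (r(N := n)) = half_cartan_form N r + int n * int n - (if N = 0 then 0 else int n * int (r (N - 1)))"
  proof -
    have "(\<Sum>i<N - 1. int ((r(N := n)) i) * int ((r(N := n)) (Suc i))) = (\<Sum>i<N - 1. int (r i) * int (r (Suc i)))"
      by (rule sum.cong) auto
    moreover have "(\<Sum>i<N. int ((r(N := n)) i) ^ 2) = (\<Sum>i<N. int (r i) ^ 2)" by (rule sum.cong) auto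
    ultimately show ?thesis
      by (cases N) (simp_all add: half_cartan_form_eq power2_eq_square mult.commute)
  qed
  then have e: "half_cartan_form (Suc N) (r(N := n)) - int s * int n =
      (int n * int n - int s * int n) + (half_cartan_form N r - (if N = 0 then 0 else int n * int (r (N - 1))))"
    by simp
  have p: "(\<Prod>i<N. w i ^ (r(N := n)) i) = (\<Prod>i<N. w i ^ r i)"
    "(\<Prod>i<N. qpoch q q ((r(N := n)) i)) = (\<Prod>i<N. qpoch q q (r i))"
    by (rule prod.cong; simp)+
  have l: "(if Suc N = 0 then 0 else int s * int ((r(N := n)) (Suc N - 1))) = int s * int n" by simp
  have E: "q powi (half_cartan_form (Suc N) (r(N := n)) - int s * int n) =
      q powi (int n * int n - int s * int n) *
      q powi (half_cartan_form N r - (if N = 0 then 0 else int n * int (r (N - 1))))"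
    unfolding e using assms by (simp add: power_int_add)
  show ?thesis
    unfolding multisum_term_def prod.lessThan_Suc p l E by (simp add: mult_ac)
qed

text \<open>The term is dominated by a product of one-variable sequences, each of which decays like
  a power with triangular exponent.\<close>

lemma multisum_term_summable:
  assumes q: "q \<noteq> 0" "norm q < 1"
  shows "multisum_term q w s N summable_on ({..<N} \<rightarrow>\<^sub>E UNIV)"
proof (cases "N = 0")
  case False
  obtain C where C: "C \<ge> 1" "\<And>n. norm (1 / qpoch q q n) \<le> C" using qpoch_bounds[OF q(2)] by metis
  \<comment> \<open>The constant of \<open>quadratic_form_bound\<close>. With \<rho> the
    \<open>D\<close>-th root of \<open>norm q\<close>, the power of \<open>norm q\<close> given by
    the form is at most \<rho> to the sum of the triangular numbers.\<close>
  define D where "D = 2 * N ^ 2"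
  have D: "D > 0" using False by (simp add: D_def)
  define \<rho> where "\<rho> = root D (norm q)"
  have \<rho>: "0 \<le> \<rho>" "\<rho> < 1" "\<rho> ^ D = norm q" using q D by (auto simp: \<rho>_def real_root_pow_pos2)
  \<comment> \<open>Absorbs the coupling to \<open>s\<close>: the size of
    \<open>q powi (- s r)\<close> is \<open>R ^ r\<close>. Since \<open>R\<close> is at least 1,
    this factor may be granted to every coordinate, which makes the majorant a product.\<close>
  define R where "R = 1 / norm q ^ s"
  have R: "R \<ge> 1" using q by (simp add: R_def power_le_one)
  define f where "f i k = C * ((norm (w i) * R) ^ k * \<rho> ^ tri k)" for i k
  have f: "f i summable_on UNIV" "0 \<le> f i k" for i k
  proof -
    show "0 \<le> f i k" for k using C R \<rho> by (simp add: f_def)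
    then show "f i summable_on UNIV"
      unfolding f_def using R \<rho> by (intro summable_nonneg_imp_summable_on summable_mult summable_power_tri) auto
  qed
  have bound: "norm (multisum_term q w s N r) \<le> (\<Prod>i<N. f i (r i))" for r
  proof -
    define h where "h = nat (half_cartan_form N r)"
    have h: "half_cartan_form N r = int h" using half_cartan_form_nonneg by (simp add: h_def)
    have "int (\<Sum>i<N. tri (r i)) \<le> int (D * h)"
    proof -
      have "int (tri k) \<le> int k ^ 2" for k using two_tri[of k] by (simp add: power2_eq_square flip: of_nat_mult)
      then have "int (\<Sum>i<N. tri (r i)) \<le> (\<Sum>i<N. int (r i) ^ 2)" by (simp add: sum_mono)
      also have "\<dots> \<le> int (D * h)" using quadratic_form_bound[of r N] by (simp add: D_def h)
      finally show ?thesis .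
    qed
    then have "(\<Sum>i<N. tri (r i)) \<le> D * h" by (simp only: of_nat_le_iff)
    then have "norm q ^ h \<le> \<rho> ^ (\<Sum>i<N. tri (r i))"
      unfolding \<rho>(3)[symmetric] power_mult[symmetric] using \<rho> by (intro power_decreasing) auto
    also have "\<dots> = (\<Prod>i<N. \<rho> ^ tri (r i))" by (simp add: power_sum)
    finally have 1: "norm q ^ h \<le> (\<Prod>i<N. \<rho> ^ tri (r i))" .
    have "R ^ r (N - 1) \<le> (\<Prod>i<N. R ^ r i)"
    proof -
      have "r (N - 1) \<le> (\<Sum>i<N. r i)" using False by (intro member_le_sum) auto
      then show ?thesis unfolding power_sum[symmetric] using R by (intro power_increasing)
    qed
    moreover have "norm (q powi (- (int s * int (r (N - 1))))) = R ^ r (N - 1)"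
      by (simp add: R_def norm_power_int norm_divide norm_power power_int_minus power_mult[symmetric] field_simps flip: of_nat_mult)
    ultimately have 2: "norm (q powi (- (int s * int (r (N - 1))))) \<le> (\<Prod>i<N. R ^ r i)" by simp
    have 3: "norm (1 / (\<Prod>i<N. qpoch q q (r i))) \<le> (\<Prod>i<N. C)"
    proof -
      have "norm (1 / (\<Prod>i<N. qpoch q q (r i))) = (\<Prod>i<N. norm (1 / qpoch q q (r i)))"
        by (simp add: norm_divide prod_norm[symmetric] prod_dividef)
      also have "\<dots> \<le> (\<Prod>i<N. C)" using C by (intro prod_mono) auto
      finally show ?thesis .
    qed
    have E: "q powi (int h - int s * int (r (N - 1))) = q ^ h * q powi (- (int s * int (r (N - 1))))"
      unfolding diff_conv_add_uminus power_int_add[OF disjI1[OF q(1)]] power_int_of_nat ..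
    have "norm (multisum_term q w s N r) = norm q ^ h * norm (q powi (- (int s * int (r (N - 1))))) *
        norm (\<Prod>i<N. w i ^ r i) * norm (1 / (\<Prod>i<N. qpoch q q (r i)))"
      using False unfolding multisum_term_def h
      by (simp only: if_False E norm_mult norm_divide norm_power) (simp add: norm_divide)
    also have "\<dots> \<le> (\<Prod>i<N. \<rho> ^ tri (r i)) * (\<Prod>i<N. R ^ r i) * norm (\<Prod>i<N. w i ^ r i) * (\<Prod>i<N. C)"
      using 1 2 3 \<rho> R by (intro mult_mono) (auto intro!: prod_nonneg mult_nonneg_nonneg)
    also have "norm (\<Prod>i<N. w i ^ r i) = (\<Prod>i<N. norm (w i) ^ r i)"
      by (simp add: prod_norm[symmetric] norm_power)
    also have "(\<Prod>i<N. \<rho> ^ tri (r i)) * (\<Prod>i<N. R ^ r i) * (\<Prod>i<N. norm (w i) ^ r i) * (\<Prod>i<N. C) = (\<Prod>i<N. f i (r i))"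
      unfolding prod.distrib[symmetric] f_def by (rule prod.cong) (auto simp: power_mult_distrib mult_ac)
    finally show ?thesis .
  qed
  show ?thesis
    by (rule abs_summable_summable, rule Infinite_Sum.abs_summable_on_comparison_test'[OF summable_on_prod_PiE[of f N]])
       (use f bound in auto)
qed simp

section \<open>Boundedness of Q' on two-column partitions\<close>

abbreviation two_column_Q :: "nat \<Rightarrow> (nat \<Rightarrow> complex) \<Rightarrow> complex \<Rightarrow> nat \<Rightarrow> nat \<Rightarrow> complex" where
  "two_column_Q N x q r b \<equiv> modified_hall_littlewood N x q (two_columns r b)"

text \<open>In this arrangement the inner sum depends on \<open>r\<close> and \<open>b\<close> only
  through \<open>r - r' + b\<close> and on \<open>r'\<close>; that combination becomes the new
  summation index in \<open>functional_step\<close>.\<close>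

lemma two_column_Q_Suc:
  assumes "norm q < 1"
  shows "two_column_Q (Suc N) x q r b = (\<Sum>r'\<le>r. qbinom q r r' * (x N ^ (r - r') * q ^ tri (r - r')) *
    (\<Sum>b'\<le>r - r' + b. qbinom q (r - r' + b) b' * (x N ^ (r - r' + b - b') * q ^ tri (r - r' + b - b')) * two_column_Q N x q r' b'))"
  unfolding modified_hall_littlewood_Suc[OF assms]
proof (intro sum.cong refl, unfold sum_distrib_left)
  fix r' assume r': "r' \<in> {..r}"
  then have e: "r + b - r' = r - r' + b" by simp
  show "(\<Sum>b'\<le>r + b - r'. hsym_coeff q r b r' b' * x N ^ (2 * r + b - (2 * r' + b')) * two_column_Q N x q r' b') =
    (\<Sum>b'\<le>r - r' + b. qbinom q r r' * (x N ^ (r - r') * q ^ tri (r - r')) *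
      (qbinom q (r - r' + b) b' * (x N ^ (r - r' + b - b') * q ^ tri (r - r' + b - b')) * two_column_Q N x q r' b'))"
    unfolding e
  proof (rule sum.cong[OF refl])
    fix b' assume b': "b' \<in> {..r - r' + b}"
    have "2 * r + b - (2 * r' + b') = (r - r') + (r - r' + b - b')" using r' b' by auto
    then show "hsym_coeff q r b r' b' * x N ^ (2 * r + b - (2 * r' + b')) * two_column_Q N x q r' b' =
      qbinom q r r' * (x N ^ (r - r') * q ^ tri (r - r')) *
      (qbinom q (r - r' + b) b' * (x N ^ (r - r' + b - b') * q ^ tri (r - r' + b - b')) * two_column_Q N x q r' b')"
      by (simp add: hsym_coeff_def e power_add mult_ac)
  qed
qed

lemma sum_reversed_le_suminf:
  fixes w :: "nat \<Rightarrow> real"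
  assumes "summable w" "\<And>k. 0 \<le> w k"
  shows "(\<Sum>k\<le>n. w (n - k)) \<le> suminf w"
proof -
  have "(\<Sum>k\<le>n. w (n - k)) = (\<Sum>k\<le>n. w k)"
    by (rule sum.reindex_bij_witness[of _ "\<lambda>k. n - k" "\<lambda>k. n - k"]) auto
  also have "\<dots> \<le> suminf w" using assms by (intro sum_le_suminf) auto
  finally show ?thesis .
qed

text \<open>The factor \<open>q ^ tri (n - b)\<close> beats the power of \<open>X\<close>, so after
  reversal the sum is dominated by one convergent series, uniformly in \<open>n\<close> and
  \<open>r\<close>.\<close>

lemma two_column_inner_bounded:
  fixes q X :: complex and g :: "nat \<Rightarrow> nat \<Rightarrow> complex"
  assumes q: "norm q < 1" and B: "\<And>r b. norm (g r b) \<le> B"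
  shows "\<exists>D\<ge>0. \<forall>n r. norm (\<Sum>b\<le>n. qbinom q n b * (X ^ (n - b) * q ^ tri (n - b)) * g r b) \<le> D"
proof -
  obtain C where C: "C \<ge> 1" "\<And>n k. norm (qbinom q n k) \<le> C" using qpoch_bounds[OF q] by metis
  define w where "w = (\<lambda>k. norm X ^ k * norm q ^ tri k)"
  have w: "summable w" "0 \<le> w k" for k
    using q by (auto simp: w_def intro!: summable_power_tri)
  have B0: "0 \<le> B" using B[of 0 0] norm_ge_zero order_trans by blast
  have "norm (\<Sum>b\<le>n. qbinom q n b * (X ^ (n - b) * q ^ tri (n - b)) * g r b) \<le> C * suminf w * B" for n r
  proof -
    have "norm (\<Sum>b\<le>n. qbinom q n b * (X ^ (n - b) * q ^ tri (n - b)) * g r b) \<le> (\<Sum>b\<le>n. C * w (n - b) * B)"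
    proof (rule sum_norm_le)
      fix b show "norm (qbinom q n b * (X ^ (n - b) * q ^ tri (n - b)) * g r b) \<le> C * w (n - b) * B"
        unfolding norm_mult norm_power w_def
        using C B by (intro mult_mono order_refl mult_nonneg_nonneg zero_le_power norm_ge_zero) auto
    qed
    also have "\<dots> = C * (\<Sum>b\<le>n. w (n - b)) * B" by (simp add: sum_distrib_left sum_distrib_right)
    also have "\<dots> \<le> C * suminf w * B"
      using C B0 sum_reversed_le_suminf[OF w] by (intro mult_right_mono mult_left_mono) auto
    finally show ?thesis .
  qed
  moreover have "0 \<le> C * suminf w * B" using C w B0 by (intro mult_nonneg_nonneg suminf_nonneg) auto
  ultimately show ?thesis by blast
qed

text \<open>A bound independent of \<open>r\<close> and \<open>b\<close> leaves the geometric decay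
  of \<open>z ^ r\<close> to secure absolute convergence for every \<open>z\<close> of norm below
  1.\<close>

lemma two_column_Q_bounded:
  assumes "norm q < 1"
  shows "\<exists>B. \<forall>r b. norm (two_column_Q N x q r b) \<le> B"
proof (induction N)
  case 0
  show ?case by (intro exI[of _ 1]) (simp add: modified_hall_littlewood_0)
next
  case (Suc N)
  then obtain B where B: "\<And>r b. norm (two_column_Q N x q r b) \<le> B" by blast
  obtain C where C: "C \<ge> 1" "\<And>n k. norm (qbinom q n k) \<le> C" using qpoch_bounds[OF assms] by metis
  define w where "w = (\<lambda>k. norm (x N) ^ k * norm q ^ tri k)"
  have w: "summable w" "0 \<le> w k" for k
    using assms by (auto simp: w_def intro!: summable_power_tri)
  obtain D where D: "0 \<le> D" "\<And>n r. norm (\<Sum>b\<le>n. qbinom q n b * (x N ^ (n - b) * q ^ tri (n - b)) * two_column_Q N x q r b) \<le> D"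
    using two_column_inner_bounded[OF assms, of "two_column_Q N x q"] B by metis
  have "norm (two_column_Q (Suc N) x q r b) \<le> C * suminf w * D" for r b
  proof -
    have "norm (two_column_Q (Suc N) x q r b) \<le> (\<Sum>r'\<le>r. C * w (r - r') * D)"
      unfolding two_column_Q_Suc[OF assms]
    proof (rule sum_norm_le)
      fix r'
      show "norm (qbinom q r r' * (x N ^ (r - r') * q ^ tri (r - r')) *
         (\<Sum>b'\<le>r - r' + b. qbinom q (r - r' + b) b' * (x N ^ (r - r' + b - b') * q ^ tri (r - r' + b - b')) * two_column_Q N x q r' b'))
         \<le> C * w (r - r') * D"
        unfolding norm_mult[of "_ * _" "sum _ _"]
      proof (rule mult_mono[OF _ D(2)])
        show "norm (qbinom q r r' * (x N ^ (r - r') * q ^ tri (r - r'))) \<le> C * w (r - r')"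
          unfolding norm_mult norm_power w_def using C by (intro mult_mono) auto
      qed (use C D w in auto)
    qed
    also have "\<dots> = C * (\<Sum>r'\<le>r. w (r - r')) * D" by (simp add: sum_distrib_left sum_distrib_right)
    also have "\<dots> \<le> C * suminf w * D"
      using C D sum_reversed_le_suminf[OF w] by (intro mult_right_mono mult_left_mono) auto
    finally show ?thesis .
  qed
  then show ?case by blast
qed

section \<open>The functionals and the removal of one variable\<close>

context
  fixes q z :: complex and x :: "nat \<Rightarrow> complex"
  assumes q: "q \<noteq> 0" "norm q < 1" and z: "norm z < 1"
begin

text \<open>The exponent of \<open>q\<close> is \<open>b (b + 1) / 2 - s b\<close>; it can be
  negative, hence the split into a natural and an integer power.\<close>

definition column_weight :: "nat \<Rightarrow> nat \<Rightarrow> complex" where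
  "column_weight s b = q ^ tri (Suc b) * q powi (- (int s * int b)) * qbinom q s b"

text \<open>The functionals \<open>\<Phi>\<^sub>s\<close>, applied to \<open>Q'\<close> in the variables \<open>x 0, \<dots>, x (N - 1)\<close>.\<close>

definition functional_term :: "complex \<Rightarrow> nat \<Rightarrow> nat \<Rightarrow> nat \<Rightarrow> complex" where
  "functional_term y N s r = z ^ r / qpoch q q r * (\<Sum>b\<le>s. y ^ b * column_weight s b * two_column_Q N x q r b)"

definition functional :: "complex \<Rightarrow> nat \<Rightarrow> nat \<Rightarrow> complex" where
  "functional y N s = infsum (functional_term y N s) UNIV"

lemma geometric_summable_on: "(\<lambda>r. norm z ^ r) summable_on UNIV"
  using z by (intro summable_nonneg_imp_summable_on summable_geometric) auto

lemma functional_term_bounded: "\<exists>B\<ge>0. \<forall>r. norm (functional_term y N s r) \<le> B * norm z ^ r"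
proof -
  obtain C where C: "C \<ge> 1" "\<And>n. norm (1 / qpoch q q n) \<le> C" using qpoch_bounds[OF q(2)] by metis
  obtain B where B: "\<And>r b. norm (two_column_Q N x q r b) \<le> B" using two_column_Q_bounded[OF q(2)] by blast
  have B0: "0 \<le> B" using B[of 0 0] norm_ge_zero order_trans by blast
  define K where "K = (\<Sum>b\<le>s. norm (y ^ b * column_weight s b) * B)"
  have K: "0 \<le> K" using B0 by (auto simp: K_def intro!: sum_nonneg)
  have "norm (functional_term y N s r) \<le> C * K * norm z ^ r" for r
  proof -
    have "norm (functional_term y N s r) = norm z ^ r * norm (1 / qpoch q q r) *
        norm (\<Sum>b\<le>s. y ^ b * column_weight s b * two_column_Q N x q r b)"
      by (simp add: functional_term_def norm_mult norm_divide norm_power)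
    also have "\<dots> \<le> norm z ^ r * C * K"
    proof (intro mult_mono order_refl)
      show "norm (\<Sum>b\<le>s. y ^ b * column_weight s b * two_column_Q N x q r b) \<le> K"
        unfolding K_def by (rule sum_norm_le) (simp only: norm_mult, intro mult_left_mono B, simp)
    qed (use C K in auto)
    finally show ?thesis by (simp add: mult_ac)
  qed
  then show ?thesis using C K by (intro exI[of _ "C * K"]) auto
qed

lemma functional_term_summable: "functional_term y N s summable_on UNIV"
proof -
  obtain B where B: "B \<ge> 0" "\<And>r. norm (functional_term y N s r) \<le> B * norm z ^ r"
    using functional_term_bounded by blast
  show ?thesis
    by (rule abs_summable_summable, rule Infinite_Sum.abs_summable_on_comparison_test'[OF summable_on_cmult_right[OF geometric_summable_on, of B]])
       (rule B)
qed

lemma functional_0: "functional y 0 s = 1"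
proof -
  have "functional_term y 0 s r = (if r = 0 then 1 else 0)" for r
  proof (cases "r = 0")
    case True
    have "(\<Sum>b\<le>s. y ^ b * column_weight s b * two_column_Q 0 x q 0 b) = (\<Sum>b\<in>{0}. y ^ b * column_weight s b * two_column_Q 0 x q 0 b)"
      by (rule sum.mono_neutral_right) (auto simp: modified_hall_littlewood_0)
    then show ?thesis using True modified_hall_littlewood_0[of x q 0 0] by (simp add: functional_term_def column_weight_def)
  qed (simp add: functional_term_def modified_hall_littlewood_0)
  then have "functional y 0 s = infsum (\<lambda>r. 1) {0 :: nat}"
    unfolding functional_def by (intro infsum_cong_neutral) auto
  then show ?thesis by simp
qed

text \<open>All factors that still depend on \<open>b\<close> once \<open>n = r - r' + b\<close> is
  kept fixed; \<open>r - r'\<close> has been replaced by \<open>n - b\<close>.\<close>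

definition step_weight :: "complex \<Rightarrow> nat \<Rightarrow> nat \<Rightarrow> nat \<Rightarrow> nat \<Rightarrow> complex" where
  "step_weight y N s b n = (if b \<le> n then y ^ b * column_weight s b *
     ((z * x N) ^ (n - b) * q ^ tri (n - b) / qpoch q q (n - b)) else 0)"

text \<open>The relation between \<open>z\<close>, \<open>x N\<close> and \<open>y\<close> turns
  \<open>y ^ b * (z * x N) ^ (n - b)\<close> into \<open>y ^ n * q ^ (n - b)\<close>. The remaining
  powers of \<open>q\<close> combine so that \<open>qbinom_rank_sum\<close> gives the sum.\<close>

lemma sum_step_weight:
  assumes zx: "z * x N = q * y"
  shows "(\<Sum>b\<le>s. step_weight y N s b n) = y ^ n * (q ^ tri (Suc n) * q powi (- (int s * int n)) / qpoch q q n)"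
proof -
  have "(\<Sum>b\<le>s. step_weight y N s b n) = (\<Sum>b\<le>min s n. step_weight y N s b n)"
    by (rule sum.mono_neutral_right) (auto simp: step_weight_def)
  also have "\<dots> = (\<Sum>b\<le>min s n. y ^ n * q ^ tri (Suc n) *
      (qbinom q s b * q powi (int b * int b - int (n + s) * int b) / qpoch q q (n - b)))"
  proof (rule sum.cong[OF refl])
    fix b assume "b \<in> {..min s n}"
    then have b: "b \<le> n" by simp
    have "2 * int (tri (Suc b)) = int b * int b + int b" "2 * int (tri (Suc n)) = int n * int n + int n"
      by (simp_all add: int_tri algebra_simps del: tri_Suc)
    moreover have "2 * int (tri (n - b)) + int (n - b) = (int n - int b) * (int n - int b)"
      using b by (simp add: int_tri of_nat_diff)
    \<comment> \<open>The exponents of \<open>q\<close> are compared as integers; up to the constant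
      \<open>tri (Suc n)\<close> they form the exponent of the rank count.\<close>
    ultimately have "int (tri (Suc b)) + - (int s * int b) + int (n - b) + int (tri (n - b)) =
       int (tri (Suc n)) + (int b * int b - int (n + s) * int b)"
      using b by (simp add: algebra_simps del: tri_Suc)
    then have e: "q powi (int (tri (Suc b))) * q powi (- (int s * int b)) * q powi (int (n - b)) * q powi (int (tri (n - b))) =
       q powi (int (tri (Suc n))) * q powi (int b * int b - int (n + s) * int b)"
      by (simp only: power_int_add[OF disjI1[OF q(1)], symmetric])
    have y: "y ^ b * y ^ (n - b) = y ^ n" using b by (simp add: power_add[symmetric])
    have "step_weight y N s b n = (y ^ b * y ^ (n - b)) *
       (q powi (int (tri (Suc b))) * q powi (- (int s * int b)) * q powi (int (n - b)) * q powi (int (tri (n - b)))) * (qbinom q s b / qpoch q q (n - b))"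
      using b unfolding power_int_of_nat
      by (simp add: step_weight_def column_weight_def zx power_mult_distrib mult_ac del: tri_Suc)
    then show "step_weight y N s b n = y ^ n * q ^ tri (Suc n) *
      (qbinom q s b * q powi (int b * int b - int (n + s) * int b) / qpoch q q (n - b))"
      unfolding e y by (simp add: mult_ac del: tri_Suc)
  qed
  also have "\<dots> = y ^ n * q ^ tri (Suc n) * (q powi (- int s * int n) / qpoch q q n)"
    unfolding sum_distrib_left[symmetric] qbinom_rank_sum[OF q(2,1)] ..
  finally show ?thesis by simp
qed

definition inner_term :: "nat \<Rightarrow> nat \<Rightarrow> nat \<Rightarrow> complex" where
  "inner_term N n r = z ^ r / qpoch q q r *
    (\<Sum>b\<le>n. qbinom q n b * (x N ^ (n - b) * q ^ tri (n - b)) * two_column_Q N x q r b)"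

text \<open>The identity \<open>tri (n - b) = tri n + tri (Suc b) - n b\<close> shows that the inner
  sum is a functional term with index \<open>n\<close> and parameter \<open>1 / x N\<close>: this is
  where the new \<open>y\<close> comes from.\<close>

lemma inner_term_eq:
  assumes "x N \<noteq> 0"
  shows "inner_term N n r = x N ^ n * q ^ tri n * functional_term (1 / x N) N n r"
proof -
  have "(\<Sum>b\<le>n. qbinom q n b * (x N ^ (n - b) * q ^ tri (n - b)) * two_column_Q N x q r b) =
    (\<Sum>b\<le>n. x N ^ n * q ^ tri n * ((1 / x N) ^ b * column_weight n b * two_column_Q N x q r b))"
  proof (rule sum.cong[OF refl])
    fix b assume "b \<in> {..n}"
    then have b: "b \<le> n" by simp
    have nb: "int (n - b) = int n - int b" using b by simp
    have "2 * int (tri (n - b)) = 2 * (int (tri n) + int (tri (Suc b)) - int n * int b)"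
      using int_tri[of "n - b"] int_tri[of n] int_tri[of "Suc b"] unfolding nb
      by (simp add: algebra_simps del: tri_Suc)
    then have "int (tri (n - b)) = int (tri n) + (int (tri (Suc b)) + - (int n * int b))" by simp
    then have "q ^ tri (n - b) = q ^ tri n * (q ^ tri (Suc b) * q powi (- (int n * int b)))"
      using q(1) by (simp only: power_int_of_nat[symmetric] power_int_add[OF disjI1[OF q(1)], symmetric])
    moreover have "x N ^ (n - b) = x N ^ n * (1 / x N) ^ b"
      using assms b by (simp add: power_diff power_one_over)
    ultimately show "qbinom q n b * (x N ^ (n - b) * q ^ tri (n - b)) * two_column_Q N x q r b =
       x N ^ n * q ^ tri n * ((1 / x N) ^ b * column_weight n b * two_column_Q N x q r b)"
      by (simp add: column_weight_def mult_ac del: tri_Suc)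
  qed
  then show ?thesis
    unfolding inner_term_def functional_term_def by (simp only: sum_distrib_left[symmetric]) (simp add: mult_ac)
qed

lemma norm_inner_term_le: "\<exists>B\<ge>0. \<forall>n r. norm (inner_term N n r) \<le> B * norm z ^ r"
proof -
  obtain C where C: "C \<ge> 1" "\<And>n. norm (1 / qpoch q q n) \<le> C" "\<And>n k. norm (qbinom q n k) \<le> C"
    using qpoch_bounds[OF q(2)] by metis
  obtain B where B: "\<And>r b. norm (two_column_Q N x q r b) \<le> B" using two_column_Q_bounded[OF q(2)] by blast
  obtain D where D: "0 \<le> D" "\<And>n r. norm (\<Sum>b\<le>n. qbinom q n b * (x N ^ (n - b) * q ^ tri (n - b)) * two_column_Q N x q r b) \<le> D"
    using two_column_inner_bounded[OF q(2), of "two_column_Q N x q"] B by metis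
  have "norm (inner_term N n r) \<le> C * D * norm z ^ r" for n r
  proof -
    have "norm (inner_term N n r) = norm z ^ r * norm (1 / qpoch q q r) *
        norm (\<Sum>b\<le>n. qbinom q n b * (x N ^ (n - b) * q ^ tri (n - b)) * two_column_Q N x q r b)"
      by (simp add: inner_term_def norm_mult norm_divide norm_power)
    also have "\<dots> \<le> norm z ^ r * C * D"
      using C D by (intro mult_mono order_refl) auto
    finally show ?thesis by (simp add: mult_ac)
  qed
  then show ?thesis using C D by (intro exI[of _ "C * D"]) auto
qed

lemma step_weight_summable: "(\<lambda>n. norm (step_weight y N s b n)) summable_on UNIV"
proof -
  obtain C where C: "C \<ge> 1" "\<And>n. norm (1 / qpoch q q n) \<le> C" using qpoch_bounds[OF q(2)] by metis
  define K where "K = norm (y ^ b * column_weight s b)"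
  define f where "f n = K * (norm (z * x N) ^ n * norm q ^ tri n * C)" for n
  have f: "summable f"
    unfolding f_def using q(2) by (intro summable_mult summable_mult2 summable_power_tri) auto
  have le: "norm (norm (step_weight y N s b (n + b))) \<le> f n" for n
  proof -
    have "norm (step_weight y N s b (n + b)) = K * (norm (z * x N) ^ n * norm q ^ tri n * norm (1 / qpoch q q n))"
      by (simp add: step_weight_def K_def norm_mult norm_divide norm_power)
    also have "\<dots> \<le> f n" unfolding f_def using C by (intro mult_left_mono) (auto simp: K_def)
    finally show ?thesis by simp
  qed
  have "summable (\<lambda>n. norm (step_weight y N s b (n + b)))"
    by (rule summable_comparison_test'[OF f]) (rule le)
  then have "summable (\<lambda>n. norm (step_weight y N s b n))" by (rule summable_iff_shift[of "\<lambda>n. norm (step_weight y N s b n)" b, THEN iffD1])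
  then show ?thesis by (intro summable_nonneg_imp_summable_on) auto
qed

text \<open>The q-binomial of \<open>r\<close> and \<open>r'\<close> divided by \<open>(q)_r\<close>
  splits into the reciprocals of \<open>(q)_r'\<close> and \<open>(q)_(r - r')\<close>. The sum is
  then regrouped by \<open>n = r - r' + b\<close>: the dependence on \<open>b\<close> is confined to
  \<open>step_weight\<close>, and what is left is \<open>inner_term\<close>. Absolute convergence
  permits summing the same family in both orders.\<close>

lemma functional_step:
  assumes zx: "z * x N = q * y" and x: "x N \<noteq> 0"
  shows "((\<lambda>n. q powi (int n * int n - int s * int n) * (y * x N) ^ n / qpoch q q n * functional (1 / x N) N n)
     has_sum functional y (Suc N) s) UNIV"
proof -
  obtain B where B: "B \<ge> 0" "\<And>n r. norm (inner_term N n r) \<le> B * norm z ^ r" using norm_inner_term_le by blast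
  let ?F = "\<lambda>b (n, r). step_weight y N s b n * inner_term N n r"
  define S where "S b = infsum (?F b) (UNIV \<times> UNIV)" for b
  have S: "(?F b has_sum S b) (UNIV \<times> UNIV)" for b
  proof -
    have g: "(\<lambda>(n, r). norm (step_weight y N s b n) * (B * norm z ^ r)) summable_on UNIV \<times> UNIV"
      using B by (intro summable_on_times step_weight_summable summable_on_cmult_right geometric_summable_on) auto
    have "?F b summable_on UNIV \<times> UNIV"
      by (rule abs_summable_summable, rule Infinite_Sum.abs_summable_on_comparison_test'[OF g])
         (use B in \<open>auto simp: norm_mult intro!: mult_left_mono\<close>)
    then show ?thesis unfolding S_def by (rule has_sum_infsum)
  qed
  have row: "((\<lambda>r. z ^ r / qpoch q q r * (y ^ b * column_weight s b * two_column_Q (Suc N) x q r b)) has_sum S b) UNIV" for b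
  proof -
    have "(?F b has_sum S b) {(n, r). b \<le> n}"
      using S[of b] by (rule has_sum_cong_neutral[THEN iffD1, rotated 3]) (auto simp: step_weight_def)
    \<comment> \<open>For fixed \<open>b\<close>, the pairs \<open>(n, r')\<close> with
      \<open>n\<close> at least \<open>b\<close> correspond to the pairs \<open>(r, r')\<close> with
      \<open>r'\<close> at most \<open>r\<close>.\<close>
    then have "((\<lambda>(r, r'). ?F b (r - r' + b, r')) has_sum S b) (SIGMA r:UNIV. {..r})"
      by (rule has_sum_reindex_bij_witness[of _ "\<lambda>(n, r'). (n - b + r', r')" "\<lambda>(r, r'). (r - r' + b, r')", THEN iffD2, rotated -1]) auto
    then show ?thesis
    proof (rule has_sum_SigmaD)
      fix r
      have "(\<Sum>r'\<le>r. ?F b (r - r' + b, r')) = z ^ r / qpoch q q r * (y ^ b * column_weight s b * two_column_Q (Suc N) x q r b)"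
        unfolding two_column_Q_Suc[OF q(2)] sum_distrib_left[of _ _ "{..r}"]
      proof (rule sum.cong[OF refl])
        fix r' assume "r' \<in> {..r}"
        then have r': "r' \<le> r" by simp
        have zz: "z ^ r = z ^ (r - r') * z ^ r'" using r' by (simp add: power_add[symmetric])
        let ?I = "\<Sum>b'\<le>r - r' + b. qbinom q (r - r' + b) b' * (x N ^ (r - r' + b - b') * q ^ tri (r - r' + b - b')) * two_column_Q N x q r' b'"
        show "?F b (r - r' + b, r') = z ^ r / qpoch q q r * (y ^ b * column_weight s b *
          (qbinom q r r' * (x N ^ (r - r') * q ^ tri (r - r')) * ?I))"
          using qpoch_nonzero[OF q(2)] unfolding zz
          by (simp add: step_weight_def inner_term_def qbinom_eq_divide[OF q(2) r'] power_mult_distrib mult_ac)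
      qed
      then show "((\<lambda>r'. case (r, r') of (r, r') \<Rightarrow> ?F b (r - r' + b, r')) has_sum
          z ^ r / qpoch q q r * (y ^ b * column_weight s b * two_column_Q (Suc N) x q r b)) {..r}"
        by (intro has_sum_finiteI) auto
    qed
  qed
  have "(functional_term y (Suc N) s has_sum (\<Sum>b\<le>s. S b)) UNIV"
    using has_sum_sum[OF finite_atMost[of s] row] unfolding functional_term_def sum_distrib_left .
  then have total: "functional y (Suc N) s = (\<Sum>b\<le>s. S b)" unfolding functional_def by (rule infsumI)
  have "((\<lambda>p. \<Sum>b\<le>s. ?F b p) has_sum (\<Sum>b\<le>s. S b)) (UNIV \<times> UNIV)" by (rule has_sum_sum[OF finite_atMost S])
  then show ?thesis unfolding total
  proof (rule has_sum_SigmaD)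
    fix n
    let ?M = "q powi (int n * int n - int s * int n) * (y * x N) ^ n / qpoch q q n"
    have "(\<Sum>b\<le>s. ?F b (n, r)) = ?M * functional_term (1 / x N) N n r" for r
    proof -
      have "int n * int n - int s * int n = int (tri (Suc n)) + (- (int s * int n) + int (tri n))"
        using int_tri[of n] by simp
      then have e: "q powi (int n * int n - int s * int n) = q ^ tri (Suc n) * (q powi (- (int s * int n)) * q ^ tri n)"
        using q(1) by (simp only: power_int_of_nat[symmetric] power_int_add[OF disjI1[OF q(1)], symmetric])
      have "(\<Sum>b\<le>s. ?F b (n, r)) = (\<Sum>b\<le>s. step_weight y N s b n) * inner_term N n r" by (simp add: sum_distrib_right)
      also have "\<dots> = ?M * functional_term (1 / x N) N n r"
        unfolding sum_step_weight[OF zx] inner_term_eq[of N, OF x] e by (simp add: power_mult_distrib mult_ac del: tri_Suc)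
      finally show ?thesis .
    qed
    then show "((\<lambda>r. \<Sum>b\<le>s. ?F b (n, r)) has_sum ?M * functional (1 / x N) N n) UNIV"
      using has_sum_cmult_right[OF has_sum_infsum[OF functional_term_summable[of "1 / x N" N n]], of ?M]
      by (simp add: functional_def)
  qed
qed

text \<open>Each removal of a variable supplies the sum over one coordinate. Its weight is
  \<open>y * x N\<close> with \<open>y = z * x N / q\<close>, which explains
  \<open>z * x i ^ 2 / q\<close>.\<close>

lemma functional_eq_multisum:
  assumes nz: "z \<noteq> 0" "\<And>i. x i \<noteq> 0" and alt: "\<And>i. x i * x (Suc i) = q / z"
    and y: "N = 0 \<or> z * x (N - 1) = q * y"
  shows "functional y N s = infsum (multisum_term q (\<lambda>i. z * x i ^ 2 / q) s N) ({..<N} \<rightarrow>\<^sub>E UNIV)"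
  using y
proof (induction N arbitrary: y s)
  case 0
  then show ?case by (simp add: functional_0 multisum_term_def half_cartan_form_eq)
next
  case (Suc N)
  let ?w = "\<lambda>i. z * x i ^ 2 / q"
  let ?M = "\<lambda>n. q powi (int n * int n - int s * int n) * ?w N ^ n / qpoch q q n"
  let ?P = "{..<N} \<rightarrow>\<^sub>E (UNIV :: nat set)"
  have zx: "z * x N = q * y" using Suc.prems by simp
  have w: "y * x N = ?w N" using zx q(1) by (simp add: power2_eq_square field_simps)
  have IH: "functional (1 / x N) N n = infsum (multisum_term q ?w n N) ?P" for n
  proof (rule Suc.IH, cases N)
    case (Suc m)
    then have "x m * x N = q / z" using alt[of m] by simp
    \<comment> \<open>The constant product of neighbouring variables is what makes the new parameter
      \<open>1 / x N\<close> admissible for the next removal.\<close>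
    then show "N = 0 \<or> z * x (N - 1) = q * (1 / x N)" using nz Suc by (simp add: field_simps)
  qed simp
  have "functional y (Suc N) s = infsum (\<lambda>n. ?M n * functional (1 / x N) N n) UNIV"
    using infsumI[OF functional_step[OF zx nz(2), of s]] unfolding w by simp
  also have "\<dots> = infsum (\<lambda>n. infsum (\<lambda>r. multisum_term q ?w s (Suc N) (r(N := n))) ?P) UNIV"
    by (intro infsum_cong) (simp only: IH multisum_term_Suc[OF q(1)] infsum_cmult_right')
  also have "\<dots> = infsum (\<lambda>(n, r). multisum_term q ?w s (Suc N) (r(N := n))) (UNIV \<times> ?P)"
  proof (rule infsum_Sigma'_banach)
    show "(\<lambda>(n, r). multisum_term q ?w s (Suc N) (r(N := n))) summable_on UNIV \<times> ?P"
      using summable_on_reindex_bij_betw[OF bij_betw_PiE_Suc, of "multisum_term q ?w s (Suc N)" N]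
        multisum_term_summable[OF q, of ?w s "Suc N"] by (simp add: case_prod_unfold)
  qed
  also have "\<dots> = infsum (multisum_term q ?w s (Suc N)) ({..<Suc N} \<rightarrow>\<^sub>E UNIV)"
    using infsum_reindex_bij_betw[OF bij_betw_PiE_Suc, of "multisum_term q ?w s (Suc N)" N] by (simp add: case_prod_unfold)
  finally show ?case .
qed

text \<open>For \<open>s = 0\<close> the functional involves \<open>b = 0\<close> only, that is, the
  partitions with all parts 2; its value does not depend on \<open>y\<close>, which can therefore be
  chosen to fit the last variable.\<close>

lemma two_column_sum:
  assumes nz: "z \<noteq> 0" "\<And>i. x i \<noteq> 0" and alt: "\<And>i. x i * x (Suc i) = q / z"
  shows "(\<lambda>m. z ^ m / qpoch q q m * modified_hall_littlewood N x q (replicate m 2)) sums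
    infsum (multisum_term q (\<lambda>i. z * x i ^ 2 / q) 0 N) ({..<N} \<rightarrow>\<^sub>E UNIV)"
proof -
  let ?y = "z * x (N - 1) / q"
  have "functional_term ?y N 0 = (\<lambda>m. z ^ m / qpoch q q m * modified_hall_littlewood N x q (replicate m 2))"
    by (simp add: fun_eq_iff functional_term_def column_weight_def two_columns_def)
  moreover have "functional_term ?y N 0 sums functional ?y N 0"
    unfolding functional_def by (intro has_sum_imp_sums has_sum_infsum functional_term_summable)
  moreover have "functional ?y N 0 = infsum (multisum_term q (\<lambda>i. z * x i ^ 2 / q) 0 N) ({..<N} \<rightarrow>\<^sub>E UNIV)"
    using q(1) by (intro functional_eq_multisum assms) simp
  ultimately show ?thesis by simp
qed

end

section \<open>The degenerate case and the two specializations\<close>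

lemma half_cartan_form_eq_0_iff:
  assumes "r \<in> {..<N} \<rightarrow>\<^sub>E UNIV"
  shows "half_cartan_form N r = 0 \<longleftrightarrow> r = (\<lambda>i\<in>{..<N}. 0)"
proof
  assume "half_cartan_form N r = 0"
  then have le: "(\<Sum>i<N. int (r i) ^ 2) \<le> 0" using quadratic_form_bound[of r N] by simp
  have "r i = 0" if "i < N" for i
  proof -
    have "int (r i) ^ 2 \<le> (\<Sum>i<N. int (r i) ^ 2)" using that by (intro member_le_sum) auto
    then have "int (r i) ^ 2 \<le> 0" using le by linarith
    then show ?thesis by simp
  qed
  then show "r = (\<lambda>i\<in>{..<N}. 0)" using assms by (intro PiE_ext[OF assms]) auto
qed (auto simp: half_cartan_form_eq intro!: sum.neutral)

theorem theorem4p1: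
  fixes n :: nat and q :: complex
  assumes "n \<ge> 1" and "norm q < 1"
  shows "(\<lambda>r. q powi half_cartan_form n r / (\<Prod>i<n. qpoch q q (r i)))
           summable_on ({..<n} \<rightarrow>\<^sub>E UNIV)
       \<and> (\<lambda>m. q ^ m / qpoch q q m *
               modified_hall_littlewood n (\<lambda>_. 1) q (replicate m 2))
         sums (\<Sum>\<^sub>\<infinity>r\<in>{..<n} \<rightarrow>\<^sub>E UNIV.
               q powi half_cartan_form n r / (\<Prod>i<n. qpoch q q (r i)))
       \<and> (q \<noteq> 0 \<longrightarrow>
           (\<lambda>r. q powi (half_cartan_form n r + alternating_sum n r) / (\<Prod>i<n. qpoch q q (r i)))
             summable_on ({..<n} \<rightarrow>\<^sub>E UNIV)
         \<and> (\<lambda>m. q ^ (2 * m) / qpoch q q m *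
                 modified_hall_littlewood n (\<lambda>i. if even i then 1 else inverse q) q (replicate m 2))
           sums (\<Sum>\<^sub>\<infinity>r\<in>{..<n} \<rightarrow>\<^sub>E UNIV.
                 q powi (half_cartan_form n r + alternating_sum n r) / (\<Prod>i<n. qpoch q q (r i))))"
proof (cases "q = 0")
  case True
  let ?P = "{..<n} \<rightarrow>\<^sub>E (UNIV :: nat set)" and ?r0 = "\<lambda>i\<in>{..<n}. 0 :: nat"
  let ?f = "\<lambda>r. q powi half_cartan_form n r / (\<Prod>i<n. qpoch q q (r i))"
  have q0: "qpoch q q m = 1" for m using True by (simp add: qpoch_def)
  \<comment> \<open>For \<open>q = 0\<close> an integer power is 1 at exponent 0 and 0 elsewhere,
    and the form vanishes only at the zero vector, so one term survives on either side.\<close>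
  have "(?f has_sum 1) ?P \<longleftrightarrow> ((\<lambda>r. 1 :: complex) has_sum 1) {?r0}"
  proof (rule has_sum_cong_neutral)
    show "?f r = 0" if "r \<in> ?P - {?r0}" for r
      using that half_cartan_form_eq_0_iff[of r n] True by (simp add: power_int_0_left_if)
    show "?f r = 1" if "r \<in> ?P \<inter> {?r0}" for r
      using that half_cartan_form_eq_0_iff[of r n] by (simp add: q0)
  qed auto
  then have f: "(?f has_sum 1) ?P" by (simp add: has_sum_finiteI)
  have "(\<lambda>m. q ^ m / qpoch q q m * modified_hall_littlewood n (\<lambda>_. 1) q (replicate m 2)) sums 1"
  proof -
    have "q ^ m / qpoch q q m * modified_hall_littlewood n (\<lambda>_. 1) q (replicate m 2) = (if m = 0 then 1 else 0)" for m
      by (cases "m = 0") (simp_all add: True modified_hall_littlewood_Nil)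
    then show ?thesis using sums_single[of 0 "\<lambda>_. 1 :: complex"] by simp
  qed
  then show ?thesis using f True infsumI[OF f] has_sum_imp_summable[OF f] by simp
next
  case False
  \<comment> \<open>The specialization \<open>z = q\<close> with all variables 1, where every weight
    \<open>z * x i ^ 2 / q\<close> is 1.\<close>
  have one: "multisum_term q (\<lambda>i. q * 1 ^ 2 / q) 0 n = (\<lambda>r. q powi half_cartan_form n r / (\<Prod>i<n. qpoch q q (r i)))"
    using False by (simp add: multisum_term_def fun_eq_iff)
  \<comment> \<open>The specialization \<open>z = q ^ 2\<close>: neighbouring variables multiply to
    \<open>1 / q = q / z\<close>, and the weights alternate between \<open>q\<close> and
    \<open>1 / q\<close>, which produces the alternating sum in the exponent.\<close>
  let ?x = "\<lambda>i. if even i then 1 else inverse q" and ?w = "\<lambda>i. q ^ 2 * (if even i then 1 else inverse q) ^ 2 / q"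
  have two: "multisum_term q ?w 0 n = (\<lambda>r. q powi (half_cartan_form n r + alternating_sum n r) / (\<Prod>i<n. qpoch q q (r i)))"
  proof
    fix r :: "nat \<Rightarrow> nat"
    have "?w i ^ r i = q powi ((- 1) ^ i * int (r i))" for i
    proof -
      have "?w i = (if even i then q else inverse q)" using False by (simp add: power2_eq_square field_simps)
      then show ?thesis by (simp only:) (simp add: power_int_minus power_inverse)
    qed
    then have "(\<Prod>i<n. ?w i ^ r i) = (\<Prod>i<n. q powi ((- 1) ^ i * int (r i)))" by simp
    also have "\<dots> = q powi alternating_sum n r"
      unfolding alternating_sum_def using False by (induction n) (simp_all add: power_int_add)
    finally show "multisum_term q ?w 0 n r = q powi (half_cartan_form n r + alternating_sum n r) / (\<Prod>i<n. qpoch q q (r i))"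
      using False by (simp add: multisum_term_def power_int_add)
  qed
  have "norm (q ^ 2) < 1" using assms(2) by (simp add: norm_power power_less_one_iff)
  then have "(\<lambda>m. (q ^ 2) ^ m / qpoch q q m * modified_hall_littlewood n ?x q (replicate m 2)) sums
    infsum (multisum_term q ?w 0 n) ({..<n} \<rightarrow>\<^sub>E UNIV)"
    by (intro two_column_sum False assms(2)) (use False in \<open>auto simp: power2_eq_square field_simps\<close>)
  moreover have "(\<lambda>m. q ^ m / qpoch q q m * modified_hall_littlewood n (\<lambda>_. 1) q (replicate m 2)) sums
    infsum (multisum_term q (\<lambda>i. q * 1 ^ 2 / q) 0 n) ({..<n} \<rightarrow>\<^sub>E UNIV)"
    by (intro two_column_sum False assms(2)) (use False in auto)
  ultimately show ?thesis
    using multisum_term_summable[OF False assms(2), of _ 0 n, of "\<lambda>i. q * 1 ^ 2 / q"]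
      multisum_term_summable[OF False assms(2), of ?w 0 n]
    unfolding one two by (simp add: power_mult)
qed

end
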